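(* Let $(M, g, \nabla)$ be a statistical manifold, with $M$ orientable. The following are mutually equivalent: (1) $(M,g,\nabla)$ has a constant curvature, that is, there is a real constant $k$ such that $R(X,Y)Z = k\{g(Y,Z)X - g(X,Z)Y\}$ for all vector fields $X,Y,Z$. (2) $(M,g,\nabla)$ is a projectively flat conjugate symmetric manifold, that is, $\nabla$ is projectively flat and $R = R^*$. (3) $(M,g,\nabla)$ is a projectively flat conjugate Ricci-symmetric manifold, that is, $\nabla$ is projectively flat and $\mathrm{Ric} = \mathrm{Ric}^*$.
   Context: A statistical manifold $(M,g,\nabla)$ is a pseudo-Riemannian manifold $(M,g)$ with a torsion-free affine connection $\nabla$ such that $C(X,Y,Z) = (\nabla_X g)(Y,Z)$ is totally symmetric. The dual connection $\nabla^*$ is the torsion-free affine connection defined by $X g(Y,Z) = g(\nabla_X Y, Z) + g(Y, \nabla^*_X Z)$. $R$ and $R^*$ are the curvature tensors of $\nabla$ and $\nabla^*$, with $R(X,Y)Z = \nabla_X\nabla_Y Z - \nabla_Y\nabla_X Z - \nabla_{[X,Y]}Z$ and $R^*$ defined likewise from $\nabla^*$. The Ricci tensor of $\nabla$ is $\mathrm{Ric}(Y,Z) = \mathrm{tr}\{X \mapsto R(X,Y)Z\}$, and $\mathrm{Ric}^*$ is defined likewise from $R^*$. A torsion-free affine connection $\nabla$ is called locally equiaffine if around any point of $M$ there exists a volume form $\omega$ with $\nabla\omega = 0$. Two torsion-free locally equiaffine connections $\nabla$ and $\overline\nabla$ on $M$ are called projectively equivalent if there exists a closed $1$-form $\rho$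 such that $\overline\nabla_X Y = \nabla_X Y + \rho(X)Y + \rho(Y)X$ holds. In particular, when $\overline\nabla$ is flat, $\nabla$ is called projectively flat.
   Formalization: M is assumed connected (S² ⊔ H² violates (2)⇒(1)), and "projectively flat" is read locally: near each point ∇ is projectively equivalent to a flat connection. With one flat connection on all of M, the round S² satisfies (1) but not (2). *)

theory Defs
  imports "HOL-Analysis.Analysis"
begin

section \<open>Smooth maps between normed spaces\<close>

text \<open>
  For a finite-dimensional domain and open S, \<open>ck_on k S f\<close> says that all iterated directional
  derivatives of order at most k exist and are continuous on S, i.e. that f is of class \<open>C^k\<close>.
\<close>

primrec ck_on ::
  "nat \<Rightarrow> 'b::real_normed_vector set \<Rightarrow> ('b \<Rightarrow> 'c::real_normed_vector) \<Rightarrow> bool" where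
  "ck_on 0 S f = continuous_on S f"
| "ck_on (Suc k) S f =
     ((\<forall>x\<in>S. f differentiable (at x)) \<and>
      (\<forall>v. ck_on k S (\<lambda>x. frechet_derivative f (at x) v)))"

definition smooth_on :: "'b::real_normed_vector set \<Rightarrow> ('b \<Rightarrow> 'c::real_normed_vector) \<Rightarrow> bool" where
  "smooth_on S f \<longleftrightarrow> (\<forall>k. ck_on k S f)"


section \<open>Smooth manifolds\<close>

text \<open>
  The dimension of the manifold is \<open>CARD('n)\<close>. A chart is a domain together with a coordinate map;
  only the values of the coordinate map on the domain matter.
\<close>

type_synonym ('a, 'n) chart = "'a set \<times> ('a \<Rightarrow> real ^ 'n)"

definition chart_inv :: "('a, 'n) chart \<Rightarrow> real ^ 'n \<Rightarrow> 'a" where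
  "chart_inv c = inv_into (fst c) (snd c)"

definition is_chart :: "('a::topological_space, 'n::finite) chart \<Rightarrow> bool" where
  "is_chart c \<longleftrightarrow> open (fst c) \<and> open (snd c ` fst c) \<and>
     homeomorphism (fst c) (snd c ` fst c) (snd c) (chart_inv c)"

definition transition :: "('a, 'n) chart \<Rightarrow> ('a, 'n) chart \<Rightarrow> real ^ 'n \<Rightarrow> real ^ 'n" where
  "transition c d = snd d \<circ> chart_inv c"

text \<open>
  M is an open subset of a Hausdorff second countable space, hence itself a Hausdorff second
  countable space. The atlas is not required to be maximal.
\<close>

definition smooth_manifold ::
  "'a::{t2_space, second_countable_topology} set \<Rightarrow> ('a, 'n::finite) chart set \<Rightarrow> bool" where
  "smooth_manifold M A \<longleftrightarrow>
     \<Union> (fst ` A) = M \<and> (\<forall>c\<in>A. is_chart c) \<and>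
     (\<forall>c\<in>A. \<forall>d\<in>A. smooth_on (snd c ` (fst c \<inter> fst d)) (transition c d))"

text \<open>M is orientable if its smooth structure admits an atlas B with orientation preserving
  changes of coordinates; smoothness of \<open>A \<union> B\<close> says that B belongs to the structure given by A.\<close>

definition orientable ::
  "'a::{t2_space, second_countable_topology} set \<Rightarrow> ('a, 'n::finite) chart set \<Rightarrow> bool" where
  "orientable M A \<longleftrightarrow>
     (\<exists>B. smooth_manifold M B \<and> smooth_manifold M (A \<union> B) \<and>
        (\<forall>c\<in>B. \<forall>d\<in>B. \<forall>x \<in> snd c ` (fst c \<inter> fst d).
           det (matrix (frechet_derivative (transition c d) (at x))) > 0))"


section \<open>Functions, vector fields and differential forms on open subsets\<close>

text \<open>
  Everything below lives on an open subset U of the manifold covered by the atlas A (U may be all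
  of M). Functions and fields are total functions on the ambient type, but only their values on U
  are meaningful.

  The tangent space at p is \<open>real ^ 'n\<close>, identified through one fixed chart at p: the
  vector v stands for the tangent vector whose components in the chart \<open>chart_at A p\<close>
  are v. Its components in any other chart c at p are \<open>coords_in A c p v\<close>.
\<close>

definition chart_at :: "('a, 'n) chart set \<Rightarrow> 'a \<Rightarrow> ('a, 'n) chart" where
  "chart_at A p = (SOME c. c \<in> A \<and> p \<in> fst c)"

definition coords_in ::
  "('a, 'n::finite) chart set \<Rightarrow> ('a, 'n) chart \<Rightarrow> 'a \<Rightarrow> real ^ 'n \<Rightarrow> real ^ 'n" where
  "coords_in A c p v =
     frechet_derivative (transition (chart_at A p) c) (at (snd (chart_at A p) p)) v"

definition smooth_fun ::
  "('a, 'n::finite) chart set \<Rightarrow> 'a set \<Rightarrow> ('a \<Rightarrow> real) \<Rightarrow> bool" where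
  "smooth_fun A U f \<longleftrightarrow> (\<forall>c\<in>A. smooth_on (snd c ` (fst c \<inter> U)) (f \<circ> chart_inv c))"

text \<open>The component functions of the vector field X in the chart c.\<close>

definition local_rep ::
  "('a, 'n::finite) chart set \<Rightarrow> ('a, 'n) chart \<Rightarrow> ('a \<Rightarrow> real ^ 'n) \<Rightarrow> real ^ 'n \<Rightarrow> real ^ 'n" where
  "local_rep A c X x = coords_in A c (chart_inv c x) (X (chart_inv c x))"

definition vector_fields ::
  "('a, 'n::finite) chart set \<Rightarrow> 'a set \<Rightarrow> ('a \<Rightarrow> real ^ 'n) set" where
  "vector_fields A U = {X. \<forall>c\<in>A. smooth_on (snd c ` (fst c \<inter> U)) (local_rep A c X)}"

text \<open>The function \<open>X f\<close> at p, computed in the chart at p.\<close>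

definition dir_deriv ::
  "('a, 'n::finite) chart set \<Rightarrow> ('a \<Rightarrow> real ^ 'n) \<Rightarrow> ('a \<Rightarrow> real) \<Rightarrow> 'a \<Rightarrow> real" where
  "dir_deriv A X f p =
     frechet_derivative (f \<circ> chart_inv (chart_at A p)) (at (snd (chart_at A p) p)) (X p)"

text \<open>\<open>[X, Y]\<close> has components \<open>X Y\<^sup>i - Y X\<^sup>i\<close>, here in the chart at p.\<close>

definition lie_bracket ::
  "('a, 'n::finite) chart set \<Rightarrow> ('a \<Rightarrow> real ^ 'n) \<Rightarrow> ('a \<Rightarrow> real ^ 'n) \<Rightarrow> 'a \<Rightarrow> real ^ 'n" where
  "lie_bracket A X Y p =
     (let c = chart_at A p; x = snd c p in
        frechet_derivative (local_rep A c Y) (at x) (X p) -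
        frechet_derivative (local_rep A c X) (at x) (Y p))"

definition one_form ::
  "('a, 'n::finite) chart set \<Rightarrow> 'a set \<Rightarrow> ('a \<Rightarrow> real ^ 'n \<Rightarrow> real) \<Rightarrow> bool" where
  "one_form A U \<rho> \<longleftrightarrow>
     (\<forall>p\<in>U. linear (\<rho> p)) \<and>
     (\<forall>X\<in>vector_fields A U. smooth_fun A U (\<lambda>p. \<rho> p (X p)))"

text \<open>\<open>d\<rho>(X, Y) = X \<rho>(Y) - Y \<rho>(X) - \<rho>([X, Y])\<close> vanishes.\<close>

definition closed_one_form ::
  "('a, 'n::finite) chart set \<Rightarrow> 'a set \<Rightarrow> ('a \<Rightarrow> real ^ 'n \<Rightarrow> real) \<Rightarrow> bool" where
  "closed_one_form A U \<rho> \<longleftrightarrow> one_form A U \<rho> \<and>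
     (\<forall>X\<in>vector_fields A U. \<forall>Y\<in>vector_fields A U. \<forall>p\<in>U.
        dir_deriv A X (\<lambda>q. \<rho> q (Y q)) p - dir_deriv A Y (\<lambda>q. \<rho> q (X q)) p
          - \<rho> p (lie_bracket A X Y p) = 0)"

text \<open>A volume form is a nowhere vanishing form of top degree. Its arguments are indexed by
  \<open>'n\<close>, of which there are as many as the dimension.\<close>

definition volume_form ::
  "('a, 'n::finite) chart set \<Rightarrow> 'a set \<Rightarrow> ('a \<Rightarrow> ('n \<Rightarrow> real ^ 'n) \<Rightarrow> real) \<Rightarrow> bool" where
  "volume_form A U \<omega> \<longleftrightarrow>
     (\<forall>p\<in>U.
        (\<forall>i u. linear (\<lambda>v. \<omega> p (u(i := v)))) \<and>
        (\<forall>i j u. i \<noteq> j \<longrightarrow> u i = u j \<longrightarrow> \<omega> p u = 0) \<and>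
        (\<exists>u. \<omega> p u \<noteq> 0)) \<and>
     (\<forall>Y. (\<forall>i. Y i \<in> vector_fields A U) \<longrightarrow> smooth_fun A U (\<lambda>p. \<omega> p (\<lambda>i. Y i p)))"


section \<open>Affine connections\<close>

text \<open>The first conjunct of the quantified part says that D is well defined on fields on U, i.e.
  does not see the meaningless values outside U.\<close>

definition affine_connection ::
  "('a, 'n::finite) chart set \<Rightarrow> 'a set \<Rightarrow>
   (('a \<Rightarrow> real ^ 'n) \<Rightarrow> ('a \<Rightarrow> real ^ 'n) \<Rightarrow> 'a \<Rightarrow> real ^ 'n) \<Rightarrow> bool" where
  "affine_connection A U D \<longleftrightarrow>
     (\<forall>X\<in>vector_fields A U. \<forall>Y\<in>vector_fields A U. D X Y \<in> vector_fields A U) \<and>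
     (\<forall>X\<in>vector_fields A U. \<forall>X'\<in>vector_fields A U.
      \<forall>Y\<in>vector_fields A U. \<forall>Y'\<in>vector_fields A U.
        ((\<forall>q\<in>U. X q = X' q \<and> Y q = Y' q) \<longrightarrow> (\<forall>p\<in>U. D X Y p = D X' Y' p)) \<and>
        (\<forall>p\<in>U. D (\<lambda>q. X q + X' q) Y p = D X Y p + D X' Y p) \<and>
        (\<forall>p\<in>U. D X (\<lambda>q. Y q + Y' q) p = D X Y p + D X Y' p) \<and>
        (\<forall>f. smooth_fun A U f \<longrightarrow>
           (\<forall>p\<in>U. D (\<lambda>q. f q *\<^sub>R X q) Y p = f p *\<^sub>R D X Y p) \<and>
           (\<forall>p\<in>U. D X (\<lambda>q. f q *\<^sub>R Y q) p = dir_deriv A X f p *\<^sub>R Y p + f p *\<^sub>R D X Y p)))"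

definition torsion_free ::
  "('a, 'n::finite) chart set \<Rightarrow> 'a set \<Rightarrow>
   (('a \<Rightarrow> real ^ 'n) \<Rightarrow> ('a \<Rightarrow> real ^ 'n) \<Rightarrow> 'a \<Rightarrow> real ^ 'n) \<Rightarrow> bool" where
  "torsion_free A U D \<longleftrightarrow>
     (\<forall>X\<in>vector_fields A U. \<forall>Y\<in>vector_fields A U. \<forall>p\<in>U.
        D X Y p - D Y X p = lie_bracket A X Y p)"

definition curvature ::
  "('a, 'n::finite) chart set \<Rightarrow> (('a \<Rightarrow> real ^ 'n) \<Rightarrow> ('a \<Rightarrow> real ^ 'n) \<Rightarrow> 'a \<Rightarrow> real ^ 'n) \<Rightarrow>
   ('a \<Rightarrow> real ^ 'n) \<Rightarrow> ('a \<Rightarrow> real ^ 'n) \<Rightarrow> ('a \<Rightarrow> real ^ 'n) \<Rightarrow> 'a \<Rightarrow> real ^ 'n" where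
  "curvature A D X Y Z p = D X (D Y Z) p - D Y (D X Z) p - D (lie_bracket A X Y) Z p"

definition flat ::
  "('a, 'n::finite) chart set \<Rightarrow> 'a set \<Rightarrow>
   (('a \<Rightarrow> real ^ 'n) \<Rightarrow> ('a \<Rightarrow> real ^ 'n) \<Rightarrow> 'a \<Rightarrow> real ^ 'n) \<Rightarrow> bool" where
  "flat A U D \<longleftrightarrow>
     (\<forall>X\<in>vector_fields A U. \<forall>Y\<in>vector_fields A U. \<forall>Z\<in>vector_fields A U. \<forall>p\<in>U.
        curvature A D X Y Z p = 0)"

text \<open>
  \<open>Ric(Y, Z)\<close> at p is the trace of the endomorphism \<open>v \<mapsto> (R(X, Y)Z)(p)\<close> of the tangent space at p,
  where X is any vector field on U with \<open>X p = v\<close>. The choice of X is immaterial, since the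
  curvature is tensorial in X.
\<close>

definition field_through ::
  "('a, 'n::finite) chart set \<Rightarrow> 'a set \<Rightarrow> 'a \<Rightarrow> real ^ 'n \<Rightarrow> 'a \<Rightarrow> real ^ 'n" where
  "field_through A U p v = (SOME X. X \<in> vector_fields A U \<and> X p = v)"

definition ricci ::
  "('a, 'n::finite) chart set \<Rightarrow> 'a set \<Rightarrow>
   (('a \<Rightarrow> real ^ 'n) \<Rightarrow> ('a \<Rightarrow> real ^ 'n) \<Rightarrow> 'a \<Rightarrow> real ^ 'n) \<Rightarrow>
   ('a \<Rightarrow> real ^ 'n) \<Rightarrow> ('a \<Rightarrow> real ^ 'n) \<Rightarrow> 'a \<Rightarrow> real" where
  "ricci A U D Y Z p = trace (matrix (\<lambda>v. curvature A D (field_through A U p v) Y Z p))"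


section \<open>Projective equivalence\<close>

text \<open>
  \<open>(\<nabla>\<^sub>X \<omega>)(Y\<^sub>1, \<dots>, Y\<^sub>n) = X \<omega>(Y\<^sub>1, \<dots>, Y\<^sub>n) - \<Sum>\<^sub>j \<omega>(Y\<^sub>1, \<dots>, \<nabla>\<^sub>X Y\<^sub>j, \<dots>, Y\<^sub>n)\<close>.
  The form lives on an open subset V of U. As this expression is tensorial, and every tangent
  vector at a point of V extends to a field on U, fields on U suffice to test that it vanishes on V.
\<close>

definition parallel_on ::
  "('a, 'n::finite) chart set \<Rightarrow> 'a set \<Rightarrow> 'a set \<Rightarrow>
   (('a \<Rightarrow> real ^ 'n) \<Rightarrow> ('a \<Rightarrow> real ^ 'n) \<Rightarrow> 'a \<Rightarrow> real ^ 'n) \<Rightarrow>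
   ('a \<Rightarrow> ('n \<Rightarrow> real ^ 'n) \<Rightarrow> real) \<Rightarrow> bool" where
  "parallel_on A U V D \<omega> \<longleftrightarrow>
     (\<forall>X\<in>vector_fields A U. \<forall>Y. (\<forall>i. Y i \<in> vector_fields A U) \<longrightarrow>
        (\<forall>p\<in>V. dir_deriv A X (\<lambda>q. \<omega> q (\<lambda>i. Y i q)) p
           - (\<Sum>j\<in>UNIV. \<omega> p ((\<lambda>i. Y i p)(j := D X (Y j) p))) = 0))"

definition locally_equiaffine ::
  "('a::topological_space, 'n::finite) chart set \<Rightarrow> 'a set \<Rightarrow>
   (('a \<Rightarrow> real ^ 'n) \<Rightarrow> ('a \<Rightarrow> real ^ 'n) \<Rightarrow> 'a \<Rightarrow> real ^ 'n) \<Rightarrow> bool" where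
  "locally_equiaffine A U D \<longleftrightarrow>
     affine_connection A U D \<and> torsion_free A U D \<and>
     (\<forall>p\<in>U. \<exists>V \<omega>. open V \<and> p \<in> V \<and> V \<subseteq> U \<and> volume_form A V \<omega> \<and> parallel_on A U V D \<omega>)"

definition projectively_equivalent ::
  "('a::topological_space, 'n::finite) chart set \<Rightarrow> 'a set \<Rightarrow>
   (('a \<Rightarrow> real ^ 'n) \<Rightarrow> ('a \<Rightarrow> real ^ 'n) \<Rightarrow> 'a \<Rightarrow> real ^ 'n) \<Rightarrow>
   (('a \<Rightarrow> real ^ 'n) \<Rightarrow> ('a \<Rightarrow> real ^ 'n) \<Rightarrow> 'a \<Rightarrow> real ^ 'n) \<Rightarrow> bool" where
  "projectively_equivalent A U D D' \<longleftrightarrow>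
     locally_equiaffine A U D \<and> locally_equiaffine A U D' \<and>
     (\<exists>\<rho>. closed_one_form A U \<rho> \<and>
        (\<forall>X\<in>vector_fields A U. \<forall>Y\<in>vector_fields A U. \<forall>p\<in>U.
           D' X Y p = D X Y p + \<rho> p (X p) *\<^sub>R Y p + \<rho> p (Y p) *\<^sub>R X p))"

text \<open>The connection on the open subset U of M induced by the connection D on M. Restricting a field
  on M to U does not change the underlying total function.\<close>

definition restricts_to ::
  "('a, 'n::finite) chart set \<Rightarrow> 'a set \<Rightarrow> 'a set \<Rightarrow>
   (('a \<Rightarrow> real ^ 'n) \<Rightarrow> ('a \<Rightarrow> real ^ 'n) \<Rightarrow> 'a \<Rightarrow> real ^ 'n) \<Rightarrow>
   (('a \<Rightarrow> real ^ 'n) \<Rightarrow> ('a \<Rightarrow> real ^ 'n) \<Rightarrow> 'a \<Rightarrow> real ^ 'n) \<Rightarrow> bool" where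
  "restricts_to A M U D D\<^sub>U \<longleftrightarrow> affine_connection A U D\<^sub>U \<and>
     (\<forall>X\<in>vector_fields A M. \<forall>Y\<in>vector_fields A M. \<forall>p\<in>U. D\<^sub>U X Y p = D X Y p)"

text \<open>
  Projective flatness is a local condition: around every point the connection is projectively
  equivalent to a flat one. (A flat connection on all of M would be too much to ask for: the round
  sphere of dimension 2 carries no flat torsion-free connection at all.)
\<close>

definition projectively_flat ::
  "('a::topological_space, 'n::finite) chart set \<Rightarrow> 'a set \<Rightarrow>
   (('a \<Rightarrow> real ^ 'n) \<Rightarrow> ('a \<Rightarrow> real ^ 'n) \<Rightarrow> 'a \<Rightarrow> real ^ 'n) \<Rightarrow> bool" where
  "projectively_flat A M D \<longleftrightarrow>
     (\<forall>p\<in>M. \<exists>U D\<^sub>U D'. open U \<and> p \<in> U \<and> U \<subseteq> M \<and> restricts_to A M U D D\<^sub>U \<and>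
        projectively_equivalent A U D\<^sub>U D' \<and> flat A U D')"


section \<open>Statistical manifolds\<close>

definition pseudo_riemannian ::
  "('a, 'n::finite) chart set \<Rightarrow> 'a set \<Rightarrow> ('a \<Rightarrow> real ^ 'n \<Rightarrow> real ^ 'n \<Rightarrow> real) \<Rightarrow> bool" where
  "pseudo_riemannian A M g \<longleftrightarrow>
     (\<forall>p\<in>M. bilinear (g p) \<and> (\<forall>v w. g p v w = g p w v) \<and>
        (\<forall>v. (\<forall>w. g p v w = 0) \<longrightarrow> v = 0)) \<and>
     (\<forall>X\<in>vector_fields A M. \<forall>Y\<in>vector_fields A M. smooth_fun A M (\<lambda>p. g p (X p) (Y p)))"

text \<open>\<open>(\<nabla>\<^sub>X g)(Y, Z)\<close>\<close>

definition cubic_form ::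
  "('a, 'n::finite) chart set \<Rightarrow> ('a \<Rightarrow> real ^ 'n \<Rightarrow> real ^ 'n \<Rightarrow> real) \<Rightarrow>
   (('a \<Rightarrow> real ^ 'n) \<Rightarrow> ('a \<Rightarrow> real ^ 'n) \<Rightarrow> 'a \<Rightarrow> real ^ 'n) \<Rightarrow>
   ('a \<Rightarrow> real ^ 'n) \<Rightarrow> ('a \<Rightarrow> real ^ 'n) \<Rightarrow> ('a \<Rightarrow> real ^ 'n) \<Rightarrow> 'a \<Rightarrow> real" where
  "cubic_form A g D X Y Z p =
     dir_deriv A X (\<lambda>q. g q (Y q) (Z q)) p - g p (D X Y p) (Z p) - g p (Y p) (D X Z p)"

definition statistical_manifold ::
  "'a::{t2_space, second_countable_topology} set \<Rightarrow> ('a, 'n::finite) chart set \<Rightarrow>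
   ('a \<Rightarrow> real ^ 'n \<Rightarrow> real ^ 'n \<Rightarrow> real) \<Rightarrow>
   (('a \<Rightarrow> real ^ 'n) \<Rightarrow> ('a \<Rightarrow> real ^ 'n) \<Rightarrow> 'a \<Rightarrow> real ^ 'n) \<Rightarrow> bool" where
  "statistical_manifold M A g D \<longleftrightarrow>
     smooth_manifold M A \<and> pseudo_riemannian A M g \<and>
     affine_connection A M D \<and> torsion_free A M D \<and>
     (\<forall>X\<in>vector_fields A M. \<forall>Y\<in>vector_fields A M. \<forall>Z\<in>vector_fields A M. \<forall>p\<in>M.
        cubic_form A g D X Y Z p = cubic_form A g D Y X Z p \<and>
        cubic_form A g D X Y Z p = cubic_form A g D X Z Y p)"

definition dual_connection ::
  "('a, 'n::finite) chart set \<Rightarrow> 'a set \<Rightarrow> ('a \<Rightarrow> real ^ 'n \<Rightarrow> real ^ 'n \<Rightarrow> real) \<Rightarrow>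
   (('a \<Rightarrow> real ^ 'n) \<Rightarrow> ('a \<Rightarrow> real ^ 'n) \<Rightarrow> 'a \<Rightarrow> real ^ 'n) \<Rightarrow>
   (('a \<Rightarrow> real ^ 'n) \<Rightarrow> ('a \<Rightarrow> real ^ 'n) \<Rightarrow> 'a \<Rightarrow> real ^ 'n) \<Rightarrow> bool" where
  "dual_connection A M g D Ds \<longleftrightarrow>
     affine_connection A M Ds \<and> torsion_free A M Ds \<and>
     (\<forall>X\<in>vector_fields A M. \<forall>Y\<in>vector_fields A M. \<forall>Z\<in>vector_fields A M. \<forall>p\<in>M.
        dir_deriv A X (\<lambda>q. g q (Y q) (Z q)) p = g p (D X Y p) (Z p) + g p (Y p) (Ds X Z p))"

definition constant_curvature ::
  "('a, 'n::finite) chart set \<Rightarrow> 'a set \<Rightarrow> ('a \<Rightarrow> real ^ 'n \<Rightarrow> real ^ 'n \<Rightarrow> real) \<Rightarrow>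
   (('a \<Rightarrow> real ^ 'n) \<Rightarrow> ('a \<Rightarrow> real ^ 'n) \<Rightarrow> 'a \<Rightarrow> real ^ 'n) \<Rightarrow> bool" where
  "constant_curvature A M g D \<longleftrightarrow>
     (\<exists>k::real. \<forall>X\<in>vector_fields A M. \<forall>Y\<in>vector_fields A M. \<forall>Z\<in>vector_fields A M. \<forall>p\<in>M.
        curvature A D X Y Z p = k *\<^sub>R (g p (Y p) (Z p) *\<^sub>R X p - g p (X p) (Z p) *\<^sub>R Y p))"

definition conjugate_symmetric ::
  "('a, 'n::finite) chart set \<Rightarrow> 'a set \<Rightarrow>
   (('a \<Rightarrow> real ^ 'n) \<Rightarrow> ('a \<Rightarrow> real ^ 'n) \<Rightarrow> 'a \<Rightarrow> real ^ 'n) \<Rightarrow>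
   (('a \<Rightarrow> real ^ 'n) \<Rightarrow> ('a \<Rightarrow> real ^ 'n) \<Rightarrow> 'a \<Rightarrow> real ^ 'n) \<Rightarrow> bool" where
  "conjugate_symmetric A M D Ds \<longleftrightarrow>
     (\<forall>X\<in>vector_fields A M. \<forall>Y\<in>vector_fields A M. \<forall>Z\<in>vector_fields A M. \<forall>p\<in>M.
        curvature A D X Y Z p = curvature A Ds X Y Z p)"

definition conjugate_ricci_symmetric ::
  "('a, 'n::finite) chart set \<Rightarrow> 'a set \<Rightarrow>
   (('a \<Rightarrow> real ^ 'n) \<Rightarrow> ('a \<Rightarrow> real ^ 'n) \<Rightarrow> 'a \<Rightarrow> real ^ 'n) \<Rightarrow>
   (('a \<Rightarrow> real ^ 'n) \<Rightarrow> ('a \<Rightarrow> real ^ 'n) \<Rightarrow> 'a \<Rightarrow> real ^ 'n) \<Rightarrow> bool" where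
  "conjugate_ricci_symmetric A M D Ds \<longleftrightarrow>
     (\<forall>Y\<in>vector_fields A M. \<forall>Z\<in>vector_fields A M. \<forall>p\<in>M.
        ricci A M D Y Z p = ricci A M Ds Y Z p)"

end

theory Submission
  imports Defs
begin

text \<open>
  Everything is computed in charts. A connection is a field of Christoffel symbols, and changing it by a
  closed 1-form \<open>\<rho>\<close> changes the curvature by \<open>P(u, w)v - P(v, w)u\<close> with \<open>P = \<nabla>\<rho> - \<rho> \<otimes> \<rho>\<close>.

  If \<open>\<nabla>\<close> is projectively flat, then \<open>R(u, v)w = P(v, w)u - P(u, w)v\<close>; the duality
  \<open>g(R(u, v)w, z) = - g(w, R\<^sup>*(u, v)z)\<close> turns \<open>Ric = Ric\<^sup>*\<close> into \<open>n P = (tr P) g\<close>, so \<open>P = \<lambda> g\<close>.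
  Differentiating \<open>\<nabla>\<rho> = \<rho> \<otimes> \<rho> + \<lambda> g\<close> and using the Codazzi equation (the total symmetry of \<open>\<nabla>g\<close>)
  gives \<open>d\<lambda> = 0\<close> if the dimension is at least 2; in dimension 1 all curvatures vanish.

  Conversely, constant curvature k passes to the dual connection by duality, and it is the integrability
  condition for \<open>\<nabla>d\<phi> = - k \<phi> g\<close>. A local solution with \<open>\<phi> > 0\<close> gives \<open>\<rho> = - d\<phi> / \<phi>\<close> with \<open>P = k g\<close>, whence
  a projectively equivalent flat connection. Parallel volume forms exist because the curvatures are
  trace-free. Both existence statements are instances of a Frobenius theorem for linear systems.
\<close>

section \<open>Calculus of smooth maps\<close>

text \<open>Tracing gives Ric = (n - 1) P and, for the dual curvature, (tr P) g - P; this is the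
  origin of n P = (tr P) g. At that stage \<lambda> is a mere pointwise choice: near each point it
  equals a component of P divided by a nonzero component of g, hence is differentiable, and only
  then can d\<lambda> = 0 be derived. The derivation rests on the Ricci identity for \<rho> and not
  on the second Bianchi identity, which is empty in dimension 2. Connectedness of \<open>M\<close>
  finally turns a locally constant \<lambda> into a single k.

  The obstacle that shapes the manifold part: tangent vectors at p are written in a chart chosen at
  p, with no continuity in p, and a connection is known only through its action on whole fields. Its
  Christoffel symbols have to be extracted with cutoff functions. After that everything is calculus
  in one chart, and the results return to the manifold through \<open>vec_of\<close> and
  \<open>conn_of\<close>. The metric may be indefinite, so duality arguments rest on nondegeneracy,
  never on positivity.\<close>

abbreviation ddir :: "('b::real_normed_vector \<Rightarrow> 'c::real_normed_vector) \<Rightarrow> 'b \<Rightarrow> 'b \<Rightarrow> 'c" where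
  "ddir f x v \<equiv> frechet_derivative f (at x) v"

lemma ddir_eqI: "(f has_derivative f') (at x) \<Longrightarrow> ddir f x = f'"
  by (simp add: frechet_derivative_at[symmetric])

text \<open>Holds even where the derivative does not exist: \<open>frechet_derivative\<close> is a
  choice from the set of all derivatives, and near \<open>x\<close> both functions have the same
  ones.\<close>

lemma ddir_cong:
  assumes "open S" "x \<in> S" "\<And>y. y \<in> S \<Longrightarrow> f y = g y"
  shows "ddir f x = ddir g x"
proof -
  have "((f has_derivative f') (at x)) = ((g has_derivative f') (at x))" for f'
    using has_derivative_transform_within_open[OF _ assms(1,2), of f f' UNIV g]
      has_derivative_transform_within_open[OF _ assms(1,2), of g f' UNIV f] assms(3) by auto
  then show ?thesis by (simp add: frechet_derivative_def)
qed

lemma differentiable_cong: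
  assumes "open S" "x \<in> S" "\<And>y. y \<in> S \<Longrightarrow> f y = g y" "f differentiable (at x)"
  shows "g differentiable (at x)"
  using has_derivative_transform_within_open[OF _ assms(1,2), of f _ UNIV g] assms(3,4)
  by (auto simp: differentiable_def)

lemma ck_on_cong:
  assumes "open S" "\<And>y. y \<in> S \<Longrightarrow> f y = g y" "ck_on k S f"
  shows "ck_on k S g"
  using assms(2,3)
proof (induction k arbitrary: f g)
  case 0 then show ?case by (auto cong: continuous_on_cong)
next
  case (Suc k)
  have "g differentiable (at x)" if "x \<in> S" for x
    using Suc.prems differentiable_cong[OF assms(1) that] that by (metis ck_on.simps(2))
  moreover have "ck_on k S (\<lambda>x. ddir g x v)" for v
  proof (rule Suc.IH[of "\<lambda>x. ddir f x v"])
    show "ddir f y v = ddir g y v" if "y \<in> S" for y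
      using ddir_cong[OF assms(1) that Suc.prems(1)] by simp
    show "ck_on k S (\<lambda>x. ddir f x v)" using Suc.prems(2) by simp
  qed
  ultimately show ?case by simp
qed

text \<open>Derivatives in \<open>ck_on\<close> are taken at \<open>x\<close> in the full space, not
  within \<open>S\<close>, so shrinking \<open>S\<close> changes none of them.\<close>

lemma ck_on_subset: "ck_on k S f \<Longrightarrow> T \<subseteq> S \<Longrightarrow> ck_on k T f"
  by (induction k arbitrary: f) (auto intro: continuous_on_subset)

lemma ck_on_SucD: "ck_on (Suc k) S f \<Longrightarrow> ck_on k S f"
proof (induction k arbitrary: f)
  case 0
  then show ?case
    by (simp add: continuous_at_imp_continuous_on differentiable_imp_continuous_within)
qed (metis ck_on.simps(2))

lemma ck_on_mono: "ck_on k S f \<Longrightarrow> j \<le> k \<Longrightarrow> ck_on j S f"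
proof (induction k)
  case (Suc k)
  then show ?case using ck_on_SucD[of k S f] by (cases "j = Suc k") auto
qed simp

lemma ck_on_imp_continuous: "ck_on k S f \<Longrightarrow> continuous_on S f"
  using ck_on_mono[of k S f 0] by simp

lemma ck_on_local:
  assumes "\<And>x. x \<in> S \<Longrightarrow> \<exists>T. open T \<and> x \<in> T \<and> ck_on k T f"
  shows "ck_on k S f"
  using assms
proof (induction k arbitrary: f)
  case 0
  have "isCont f x" if "x \<in> S" for x
    using 0[OF that] continuous_on_eq_continuous_at by auto
  then show ?case by (simp add: continuous_at_imp_continuous_on)
next
  case (Suc k)
  have "f differentiable (at x)" if "x \<in> S" for x
    using Suc.prems[OF that] by auto
  moreover have "ck_on k S (\<lambda>x. ddir f x v)" for v
    using Suc.prems by (intro Suc.IH) fastforce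
  ultimately show ?case by simp
qed

text \<open>Lets an explicit derivative stand in for \<open>frechet_derivative\<close>. Each closure
  property below is then an induction on k driven by the corresponding differentiation rule.\<close>

lemma ck_on_SucI:
  assumes "open S" "\<And>x. x \<in> S \<Longrightarrow> (f has_derivative f' x) (at x)"
    "\<And>v. ck_on k S (\<lambda>x. f' x v)"
  shows "ck_on (Suc k) S f"
proof -
  have "ck_on k S (\<lambda>x. ddir f x v)" for v
    using ddir_eqI[OF assms(2)]
    by (intro ck_on_cong[OF assms(1) _ assms(3)[of v]]) auto
  then show ?thesis using assms(2) by (auto simp: differentiable_def)
qed

lemma ck_on_Suc_derivative:
  "ck_on (Suc k) S f \<Longrightarrow> x \<in> S \<Longrightarrow> (f has_derivative ddir f x) (at x)"
  by (auto simp: frechet_derivative_works[symmetric])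

lemma ck_on_const: "open S \<Longrightarrow> ck_on k S (\<lambda>x. c)"
proof (induction k arbitrary: c)
  case (Suc k)
  then show ?case
    by (intro ck_on_SucI[OF Suc.prems, where f'="\<lambda>_ _. 0"] has_derivative_const Suc.IH)
qed simp

lemma ck_on_linear:
  assumes L: "bounded_linear L" and "open S" "ck_on k S f"
  shows "ck_on k S (\<lambda>x. L (f x))"
  using assms(3)
proof (induction k arbitrary: f)
  case 0
  then show ?case using bounded_linear.continuous_on[OF L] by simp
next
  case (Suc k)
  show ?case
  proof (rule ck_on_SucI[OF assms(2)])
    show "((\<lambda>x. L (f x)) has_derivative (\<lambda>v. L (ddir f x v))) (at x)" if "x \<in> S" for x
      by (rule bounded_linear.has_derivative[OF L ck_on_Suc_derivative[OF Suc.prems that]])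
    show "ck_on k S (\<lambda>x. L (ddir f x v))" for v
      using Suc.prems by (intro Suc.IH) auto
  qed
qed

lemma ck_on_add:
  assumes "open S" "ck_on k S f" "ck_on k S g"
  shows "ck_on k S (\<lambda>x. f x + g x)"
  using assms(2,3)
proof (induction k arbitrary: f g)
  case 0
  then show ?case by (simp add: continuous_on_add)
next
  case (Suc k)
  show ?case
  proof (rule ck_on_SucI[OF assms(1)])
    show "((\<lambda>x. f x + g x) has_derivative (\<lambda>v. ddir f x v + ddir g x v)) (at x)" if "x \<in> S" for x
      using Suc.prems that by (intro has_derivative_add ck_on_Suc_derivative)
    show "ck_on k S (\<lambda>x. ddir f x v + ddir g x v)" for v
      using Suc.prems by (intro Suc.IH) auto
  qed
qed

lemma ck_on_sum:
  assumes "open S" "\<And>i. i \<in> I \<Longrightarrow> ck_on k S (f i)"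
  shows "ck_on k S (\<lambda>x. \<Sum>i\<in>I. f i x)"
  using assms(2)
proof (induction I rule: infinite_finite_induct)
  case (insert i I)
  then show ?case using ck_on_add[OF assms(1), of k "f i"] by simp
qed (simp_all add: ck_on_const[OF assms(1)])

lemma ck_on_bilinear:
  assumes B: "bounded_bilinear B" and "open S" "ck_on k S f" "ck_on k S g"
  shows "ck_on k S (\<lambda>x. B (f x) (g x))"
  using assms(3,4)
proof (induction k arbitrary: f g)
  case 0
  then show ?case using bounded_bilinear.continuous_on[OF B] by auto
next
  case (Suc k)
  show ?case
  proof (rule ck_on_SucI[OF assms(2)])
    show "((\<lambda>x. B (f x) (g x)) has_derivative (\<lambda>v. B (f x) (ddir g x v) + B (ddir f x v) (g x))) (at x)"
      if "x \<in> S" for x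
      using Suc.prems that by (intro bounded_bilinear.FDERIV[OF B] ck_on_Suc_derivative)
    show "ck_on k S (\<lambda>x. B (f x) (ddir g x v) + B (ddir f x v) (g x))" for v
      using Suc.prems ck_on_SucD[OF Suc.prems(1)] ck_on_SucD[OF Suc.prems(2)]
      by (intro ck_on_add Suc.IH assms) auto
  qed
qed

text \<open>The chain rule differentiates \<open>f\<close> in a direction that varies with
  \<open>x\<close>, whereas \<open>ck_on\<close> speaks of fixed directions. Expanding the direction
  in the basis of the domain of \<open>f\<close> makes the induction hypothesis applicable.\<close>

lemma ck_on_compose:
  fixes f :: "'b::euclidean_space \<Rightarrow> 'c::real_normed_vector"
  assumes "open S" "open T" "g ` S \<subseteq> T" "ck_on k T f" "ck_on k S g"
  shows "ck_on k S (\<lambda>x. f (g x))"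
  using assms(4,5)
proof (induction k arbitrary: f)
  case 0
  then show ?case using continuous_on_compose2[of T f S g] assms(3) by auto
next
  case (Suc k)
  show ?case
  proof (rule ck_on_SucI[OF assms(1)])
    fix x assume x: "x \<in> S"
    have "((\<lambda>x. f (g x)) has_derivative (\<lambda>v. ddir f (g x) (ddir g x v))) (at x)"
      using diff_chain_at[OF ck_on_Suc_derivative[OF Suc.prems(2) x] ck_on_Suc_derivative[OF Suc.prems(1)]]
        x assms(3) by (auto simp: o_def)
    moreover have "ddir f (g x) (ddir g x v) = (\<Sum>b\<in>Basis. (ddir g x v \<bullet> b) *\<^sub>R ddir f (g x) b)" for v
    proof -
      have l: "linear (ddir f (g x))"
        using ck_on_Suc_derivative[OF Suc.prems(1), of "g x"] x assms(3)
        by (auto intro: has_derivative_linear)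
      show ?thesis
        by (subst euclidean_representation[of "ddir g x v", symmetric])
           (simp only: linear_sum[OF l] linear_cmul[OF l])
    qed
    ultimately show "((\<lambda>x. f (g x)) has_derivative (\<lambda>v. \<Sum>b\<in>Basis. (ddir g x v \<bullet> b) *\<^sub>R ddir f (g x) b)) (at x)"
      by simp
  next
    show "ck_on k S (\<lambda>x. \<Sum>b\<in>Basis. (ddir g x v \<bullet> b) *\<^sub>R ddir f (g x) b)" for v
    proof (intro ck_on_sum ck_on_bilinear[OF bounded_bilinear_scaleR] assms(1))
      fix b :: 'b
      show "ck_on k S (\<lambda>x. ddir g x v \<bullet> b)"
        using Suc.prems by (intro ck_on_linear[OF bounded_linear_inner_left assms(1)]) auto
      show "ck_on k S (\<lambda>x. ddir f (g x) b)"
        using Suc.prems by (intro Suc.IH ck_on_SucD[OF Suc.prems(2)]) auto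
    qed
  qed
qed

lemma ck_on_inverse:
  fixes f :: "'b::real_normed_vector \<Rightarrow> real"
  assumes "open S" "ck_on k S f" "\<And>x. x \<in> S \<Longrightarrow> f x \<noteq> 0"
  shows "ck_on k S (\<lambda>x. inverse (f x))"
  using assms(2)
proof (induction k)
  case 0
  then show ?case using assms(3) by (simp add: continuous_on_inverse)
next
  case (Suc k)
  show ?case
  proof (rule ck_on_SucI[OF assms(1)])
    show "((\<lambda>x. inverse (f x)) has_derivative (\<lambda>v. - (inverse (f x) * ddir f x v * inverse (f x)))) (at x)"
      if "x \<in> S" for x
      using Suc.prems that assms(3) by (intro Deriv.has_derivative_inverse ck_on_Suc_derivative)
    have i: "ck_on k S (\<lambda>x. inverse (f x))" using Suc.IH ck_on_SucD[OF Suc.prems] by blast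
    show "ck_on k S (\<lambda>x. - (inverse (f x) * ddir f x v * inverse (f x)))" for v
      using Suc.prems
      by (intro ck_on_linear[OF bounded_linear_minus[OF bounded_linear_ident]]
          ck_on_bilinear[OF bounded_bilinear_mult] i assms(1)) auto
  qed
qed

lemma smooth_on_cong: "open S \<Longrightarrow> (\<And>y. y \<in> S \<Longrightarrow> f y = g y) \<Longrightarrow> smooth_on S f \<Longrightarrow> smooth_on S g"
  unfolding smooth_on_def by (metis ck_on_cong)

lemma smooth_on_subset: "smooth_on S f \<Longrightarrow> T \<subseteq> S \<Longrightarrow> smooth_on T f"
  unfolding smooth_on_def by (metis ck_on_subset)

lemma smooth_on_local:
  assumes "\<And>x. x \<in> S \<Longrightarrow> \<exists>T. open T \<and> x \<in> T \<and> smooth_on T f"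
  shows "smooth_on S f"
  unfolding smooth_on_def
proof (intro allI ck_on_local)
  show "\<exists>T. open T \<and> x \<in> T \<and> ck_on k T f" if "x \<in> S" for k x
    using assms[OF that] by (auto simp: smooth_on_def)
qed

lemma smooth_on_ddir: "smooth_on S f \<Longrightarrow> smooth_on S (\<lambda>x. ddir f x v)"
  unfolding smooth_on_def by (metis ck_on.simps(2))

lemma smooth_on_has_derivative: "smooth_on S f \<Longrightarrow> x \<in> S \<Longrightarrow> (f has_derivative ddir f x) (at x)"
  unfolding smooth_on_def by (meson ck_on_Suc_derivative)

lemma smooth_on_differentiable: "smooth_on S f \<Longrightarrow> x \<in> S \<Longrightarrow> f differentiable (at x)"
  using smooth_on_has_derivative differentiable_def by blast

lemma smooth_on_linear_ddir: "smooth_on S f \<Longrightarrow> x \<in> S \<Longrightarrow> linear (ddir f x)"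
  using smooth_on_has_derivative has_derivative_linear by blast

lemma smooth_on_continuous: "smooth_on S f \<Longrightarrow> continuous_on S f"
  unfolding smooth_on_def by (metis ck_on_imp_continuous)

lemma smooth_on_const: "open S \<Longrightarrow> smooth_on S (\<lambda>x. c)"
  unfolding smooth_on_def by (metis ck_on_const)

lemma smooth_on_id: "open S \<Longrightarrow> smooth_on S (\<lambda>x. x)"
  unfolding smooth_on_def
proof
  fix k assume "open S"
  then show "ck_on k S (\<lambda>x. x)"
    by (cases k) (simp, metis ck_on_SucI[where f'="\<lambda>x v. v"] ck_on_const has_derivative_ident)
qed

lemma smooth_on_linear: "bounded_linear L \<Longrightarrow> open S \<Longrightarrow> smooth_on S f \<Longrightarrow> smooth_on S (\<lambda>x. L (f x))"
  unfolding smooth_on_def by (metis ck_on_linear)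

lemma smooth_on_add: "open S \<Longrightarrow> smooth_on S f \<Longrightarrow> smooth_on S g \<Longrightarrow> smooth_on S (\<lambda>x. f x + g x)"
  unfolding smooth_on_def by (metis ck_on_add)

lemma smooth_on_minus: "open S \<Longrightarrow> smooth_on S f \<Longrightarrow> smooth_on S (\<lambda>x. - f x)"
  by (rule smooth_on_linear[OF bounded_linear_minus[OF bounded_linear_ident]])

lemma smooth_on_diff: "open S \<Longrightarrow> smooth_on S f \<Longrightarrow> smooth_on S g \<Longrightarrow> smooth_on S (\<lambda>x. f x - g x)"
  using smooth_on_add[of S f "\<lambda>x. - g x"] smooth_on_minus[of S g] by simp

lemma smooth_on_sum:
  "open S \<Longrightarrow> (\<And>i. i \<in> I \<Longrightarrow> smooth_on S (f i)) \<Longrightarrow> smooth_on S (\<lambda>x. \<Sum>i\<in>I. f i x)"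
  unfolding smooth_on_def by (metis ck_on_sum)

lemma smooth_on_scaleR:
  "open S \<Longrightarrow> smooth_on S f \<Longrightarrow> smooth_on S g \<Longrightarrow> smooth_on S (\<lambda>x. f x *\<^sub>R g x)"
  unfolding smooth_on_def by (metis ck_on_bilinear[OF bounded_bilinear_scaleR])

lemma smooth_on_mult:
  fixes f g :: "_ \<Rightarrow> real"
  shows "open S \<Longrightarrow> smooth_on S f \<Longrightarrow> smooth_on S g \<Longrightarrow> smooth_on S (\<lambda>x. f x * g x)"
  unfolding smooth_on_def by (metis ck_on_bilinear[OF bounded_bilinear_mult])

lemma smooth_on_inner:
  "open S \<Longrightarrow> smooth_on S f \<Longrightarrow> smooth_on S g \<Longrightarrow> smooth_on S (\<lambda>x. f x \<bullet> g x)"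
  unfolding smooth_on_def by (metis ck_on_bilinear[OF bounded_bilinear_inner])

lemma smooth_on_Pair:
  assumes "open S" "smooth_on S f" "smooth_on S g"
  shows "smooth_on S (\<lambda>x. (f x, g x))"
proof -
  have "bounded_linear (\<lambda>x. (x, 0))" "bounded_linear (\<lambda>x. (0, x))"
    by (intro bounded_linear_Pair bounded_linear_ident bounded_linear_zero)+
  from smooth_on_add[OF assms(1) smooth_on_linear[OF this(1) assms(1,2)]
      smooth_on_linear[OF this(2) assms(1,3)]] show ?thesis by simp
qed

lemma smooth_on_prod:
  fixes f :: "'i \<Rightarrow> 'b::real_normed_vector \<Rightarrow> real"
  assumes "open S" "\<And>i. i \<in> I \<Longrightarrow> smooth_on S (f i)"
  shows "smooth_on S (\<lambda>x. \<Prod>i\<in>I. f i x)"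
  using assms(2)
  by (induction I rule: infinite_finite_induct) (auto intro: smooth_on_mult smooth_on_const assms(1))

lemma smooth_on_inverse:
  fixes f :: "'b::real_normed_vector \<Rightarrow> real"
  shows "open S \<Longrightarrow> smooth_on S f \<Longrightarrow> (\<And>x. x \<in> S \<Longrightarrow> f x \<noteq> 0) \<Longrightarrow> smooth_on S (\<lambda>x. inverse (f x))"
  unfolding smooth_on_def by (metis ck_on_inverse)

lemma smooth_on_compose:
  fixes f :: "'b::euclidean_space \<Rightarrow> 'c::real_normed_vector"
  shows "open S \<Longrightarrow> open T \<Longrightarrow> g ` S \<subseteq> T \<Longrightarrow> smooth_on T f \<Longrightarrow> smooth_on S g \<Longrightarrow> smooth_on S (\<lambda>x. f (g x))"
  unfolding smooth_on_def by (metis ck_on_compose)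

section \<open>Point-dependent linear and bilinear maps\<close>

lemma linear_basis_expand:
  fixes v :: "'b::euclidean_space"
  assumes "linear L" shows "L v = (\<Sum>b\<in>Basis. (v \<bullet> b) *\<^sub>R L b)"
  by (subst euclidean_representation[of v, symmetric]) (simp only: linear_sum[OF assms] linear_cmul[OF assms])

text \<open>A tensor field in coordinates. In finite dimension, smoothness on fixed arguments is
  smoothness as a map into the space of bilinear maps, without a norm on that space.\<close>

definition smooth_bilinear_on ::
  "'b::euclidean_space set \<Rightarrow> ('b \<Rightarrow> 'c::euclidean_space \<Rightarrow> 'd::euclidean_space \<Rightarrow> 'e::real_normed_vector) \<Rightarrow> bool" where
  "smooth_bilinear_on S B \<longleftrightarrow> (\<forall>x\<in>S. bilinear (B x)) \<and> (\<forall>u v. smooth_on S (\<lambda>x. B x u v))"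

definition smooth_linear_on ::
  "'b::euclidean_space set \<Rightarrow> ('b \<Rightarrow> 'c::euclidean_space \<Rightarrow> 'e::real_normed_vector) \<Rightarrow> bool" where
  "smooth_linear_on S L \<longleftrightarrow> (\<forall>x\<in>S. linear (L x)) \<and> (\<forall>u. smooth_on S (\<lambda>x. L x u))"

lemma bilinear_expand:
  fixes u :: "'b::euclidean_space" and v :: "'c::euclidean_space"
  assumes "bilinear B"
  shows "B u v = (\<Sum>b\<in>Basis. \<Sum>c\<in>Basis. ((u \<bullet> b) * (v \<bullet> c)) *\<^sub>R B b c)"
proof -
  have l1: "linear (\<lambda>u. B u v)" and l2: "linear (B b)" for b v
    using assms by (auto simp: bilinear_def)
  show ?thesis
    by (subst linear_basis_expand[OF l1]) (simp add: linear_basis_expand[OF l2, where v=v] scaleR_sum_right)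
qed

lemma smooth_bilinear_onD:
  assumes "smooth_bilinear_on S B"
  shows "x \<in> S \<Longrightarrow> bilinear (B x)" "smooth_on S (\<lambda>x. B x u v)"
    "x \<in> S \<Longrightarrow> linear (B x u)" "x \<in> S \<Longrightarrow> linear (\<lambda>u. B x u v)"
  using assms by (auto simp: smooth_bilinear_on_def bilinear_def)

lemma smooth_linear_onD:
  assumes "smooth_linear_on S L"
  shows "x \<in> S \<Longrightarrow> linear (L x)" "smooth_on S (\<lambda>x. L x u)"
  using assms by (auto simp: smooth_linear_on_def)

lemma smooth_bilinear_on_apply:
  assumes "open S" "smooth_bilinear_on S B" "smooth_on S a" "smooth_on S b"
  shows "smooth_on S (\<lambda>x. B x (a x) (b x))"
proof (rule smooth_on_cong[OF assms(1)])
  show "smooth_on S (\<lambda>x. \<Sum>i\<in>Basis. \<Sum>j\<in>Basis. ((a x \<bullet> i) * (b x \<bullet> j)) *\<^sub>R B x i j)"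
    using assms smooth_bilinear_onD(2)[OF assms(2)]
    by (intro smooth_on_sum smooth_on_scaleR smooth_on_mult smooth_on_inner smooth_on_const)
  show "(\<Sum>i\<in>Basis. \<Sum>j\<in>Basis. ((a y \<bullet> i) * (b y \<bullet> j)) *\<^sub>R B y i j) = B y (a y) (b y)" if "y \<in> S" for y
    using bilinear_expand[OF smooth_bilinear_onD(1)[OF assms(2) that]] by metis
qed

lemma smooth_linear_on_apply:
  assumes "open S" "smooth_linear_on S L" "smooth_on S a"
  shows "smooth_on S (\<lambda>x. L x (a x))"
proof (rule smooth_on_cong[OF assms(1)])
  show "smooth_on S (\<lambda>x. \<Sum>i\<in>Basis. (a x \<bullet> i) *\<^sub>R L x i)"
    using assms smooth_linear_onD(2)[OF assms(2)]
    by (intro smooth_on_sum smooth_on_scaleR smooth_on_inner smooth_on_const)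
  show "(\<Sum>i\<in>Basis. (a y \<bullet> i) *\<^sub>R L y i) = L y (a y)" if "y \<in> S" for y
    using linear_basis_expand[OF smooth_linear_onD(1)[OF assms(2) that]] by metis
qed

text \<open>Leibniz rule for three factors, read off from the basis expansion of both arguments. The
  first term differentiates the tensor with its arguments frozen at their values in
  \<open>x\<close>.\<close>

lemma smooth_bilinear_on_has_derivative:
  assumes "open S" "smooth_bilinear_on S B" "x \<in> S"
    and a: "(a has_derivative a') (at x)" and b: "(b has_derivative b') (at x)"
  shows "((\<lambda>y. B y (a y) (b y)) has_derivative
     (\<lambda>h. ddir (\<lambda>y. B y (a x) (b x)) x h + B x (a' h) (b x) + B x (a x) (b' h))) (at x)"
proof -
  have B: "((\<lambda>y. B y i j) has_derivative ddir (\<lambda>y. B y i j) x) (at x)" for i j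
    by (rule smooth_on_has_derivative[OF smooth_bilinear_onD(2)[OF assms(2)] assms(3)])
  note bx = bilinear_expand[OF smooth_bilinear_onD(1)[OF assms(2)]]
  have eq: "\<And>u v. ((\<lambda>y. B y u v) has_derivative (\<lambda>h. \<Sum>i\<in>Basis. \<Sum>j\<in>Basis. ((u \<bullet> i) * (v \<bullet> j)) *\<^sub>R ddir (\<lambda>y. B y i j) x h)) (at x)"
    by (rule has_derivative_transform_within_open[OF _ assms(1,3) bx[symmetric]])
       (auto intro!: derivative_eq_intros B)
  have d: "ddir (\<lambda>y. B y (a x) (b x)) x = (\<lambda>h. \<Sum>i\<in>Basis. \<Sum>j\<in>Basis. ((a x \<bullet> i) * (b x \<bullet> j)) *\<^sub>R ddir (\<lambda>y. B y i j) x h)"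
    by (rule ddir_eqI[OF eq])
  have "((\<lambda>y. B y (a y) (b y)) has_derivative (\<lambda>h. \<Sum>i\<in>Basis. \<Sum>j\<in>Basis.
      ((a x \<bullet> i) * (b x \<bullet> j)) *\<^sub>R ddir (\<lambda>y. B y i j) x h
      + ((a' h \<bullet> i) * (b x \<bullet> j) + (a x \<bullet> i) * (b' h \<bullet> j)) *\<^sub>R B x i j)) (at x)"
    by (rule has_derivative_transform_within_open[OF _ assms(1,3) bx[symmetric]])
       (auto intro!: derivative_eq_intros B a b ext sum.cong simp: algebra_simps)
  also have "(\<lambda>h. \<Sum>i\<in>Basis. \<Sum>j\<in>Basis.
      ((a x \<bullet> i) * (b x \<bullet> j)) *\<^sub>R ddir (\<lambda>y. B y i j) x h
      + ((a' h \<bullet> i) * (b x \<bullet> j) + (a x \<bullet> i) * (b' h \<bullet> j)) *\<^sub>R B x i j) =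
     (\<lambda>h. ddir (\<lambda>y. B y (a x) (b x)) x h + B x (a' h) (b x) + B x (a x) (b' h))"
    by (simp add: d bx[OF assms(3), of "a' _"] bx[OF assms(3), of "a x" "b' _"] sum.distrib scaleR_add_left add.assoc)
  finally show ?thesis .
qed

lemma smooth_linear_on_has_derivative:
  assumes "open S" "smooth_linear_on S L" "x \<in> S" and a: "(a has_derivative a') (at x)"
  shows "((\<lambda>y. L y (a y)) has_derivative (\<lambda>h. ddir (\<lambda>y. L y (a x)) x h + L x (a' h))) (at x)"
proof -
  \<comment> \<open>A linear field is a bilinear one with an auxiliary real first argument, which is
    then held at 1.\<close>
  have "smooth_bilinear_on S (\<lambda>x (u::real) v. u *\<^sub>R L x v)"
    unfolding smooth_bilinear_on_def
  proof safe
    fix y assume "y \<in> S"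
    then have "linear (L y)" using smooth_linear_onD(1)[OF assms(2)] by blast
    then show "bilinear (\<lambda>(u::real) v. u *\<^sub>R L y v)"
      by (auto simp: bilinear_def linear_iff algebra_simps)
  next
    fix u v show "smooth_on S (\<lambda>x. u *\<^sub>R L x v)"
      using assms(1) smooth_linear_onD(2)[OF assms(2)] by (intro smooth_on_scaleR smooth_on_const)
  qed
  from smooth_bilinear_on_has_derivative[OF assms(1) this assms(3) has_derivative_const[of 1] a]
  show ?thesis by simp
qed

text \<open>Both mixed derivatives are limits of the same second difference quotient.\<close>

lemma ddir_commute_real:
  fixes f :: "'b::real_normed_vector \<Rightarrow> real"
  assumes S: "open S" "x \<in> S" and f: "smooth_on S f"
  shows "ddir (\<lambda>y. ddir f y u) x v = ddir (\<lambda>y. ddir f y v) x u"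
proof -
  obtain e where e: "e > 0" "ball x e \<subseteq> S" using S openE by blast
  \<comment> \<open>For coefficients bounded by s, displacements in the span of u and v have norm at
    most s K; the summand 1 keeps K positive when u = v = 0.\<close>
  define K where "K = norm u + norm v + 1"
  have K: "K > 0" unfolding K_def by (simp add: add_nonneg_pos)
  have inS: "x + a *\<^sub>R u + b *\<^sub>R v \<in> S" if "\<bar>a\<bar> \<le> s" "\<bar>b\<bar> \<le> s" "s * K < e" for a b s
  proof -
    have "norm (a *\<^sub>R u + b *\<^sub>R v) \<le> \<bar>a\<bar> * norm u + \<bar>b\<bar> * norm v"
      by (metis norm_scaleR norm_triangle_ineq)
    also have "\<dots> \<le> s * norm u + s * norm v"
      using that by (intro add_mono mult_right_mono) auto
    also have "\<dots> \<le> s * K" using that by (auto simp: K_def algebra_simps)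
    also have "\<dots> < e" by fact
    finally have "dist x (x + a *\<^sub>R u + b *\<^sub>R v) < e"
      by (simp add: dist_norm norm_minus_commute add.assoc add.commute)
    then show ?thesis using e by auto
  qed
  define \<Delta> where "\<Delta> s = f (x + s *\<^sub>R u + s *\<^sub>R v) - f (x + s *\<^sub>R u) - f (x + s *\<^sub>R v) + f x" for s
  \<comment> \<open>Mean value theorem twice, along \<open>p\<close> for the difference in direction
    \<open>q\<close> and then along \<open>q\<close>. Since \<Delta> is symmetric in u and v, both
    orders evaluate the same quantity.\<close>
  have main: "\<exists>a b. \<bar>a\<bar> \<le> s \<and> \<bar>b\<bar> \<le> s \<and> \<Delta> s = s * (s * ddir (\<lambda>y. ddir f y p) (x + a *\<^sub>R p + b *\<^sub>R q) q)"
    if s: "s > 0" "s * K < e" and pq: "p = u \<and> q = v \<or> p = v \<and> q = u" for s p q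
  proof -
    have inS': "x + a *\<^sub>R p + b *\<^sub>R q \<in> S" if "\<bar>a\<bar> \<le> s" "\<bar>b\<bar> \<le> s" for a b
      using inS[of a s b] inS[of b s a] that s pq by (auto simp: algebra_simps)
    define h where "h \<tau> = f (x + \<tau> *\<^sub>R p + s *\<^sub>R q) - f (x + \<tau> *\<^sub>R p)" for \<tau>
    have D: "((\<lambda>\<tau>. F (x + \<tau> *\<^sub>R p + c)) has_real_derivative ddir F (x + \<tau> *\<^sub>R p + c) p) (at \<tau>)"
      if "smooth_on S F" "x + \<tau> *\<^sub>R p + c \<in> S" for \<tau> c p and F :: "'b \<Rightarrow> real"
    proof -
      have "((\<lambda>\<tau>. F (x + \<tau> *\<^sub>R p + c)) has_derivative (\<lambda>t. ddir F (x + \<tau> *\<^sub>R p + c) (t *\<^sub>R p))) (at \<tau>)"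
        by (rule has_derivative_compose[where f="\<lambda>\<tau>. x + \<tau> *\<^sub>R p + c" and f'="\<lambda>t. t *\<^sub>R p",
              OF _ smooth_on_has_derivative[OF that]])
           (auto intro!: derivative_eq_intros)
      then show ?thesis
        unfolding has_field_derivative_def
        by (simp add: linear_cmul[OF smooth_on_linear_ddir[OF that]] mult.commute[of _ "ddir F _ _"])
    qed
    have "\<exists>z>0. z < s \<and> h s - h 0 = (s - 0) * (ddir f (x + z *\<^sub>R p + s *\<^sub>R q) p - ddir f (x + z *\<^sub>R p + 0) p)"
    proof (rule MVT2[OF s(1)])
      fix z assume "0 \<le> z" "z \<le> s"
      then show "(h has_real_derivative (ddir f (x + z *\<^sub>R p + s *\<^sub>R q) p - ddir f (x + z *\<^sub>R p + 0) p)) (at z)"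
        unfolding h_def
        using DERIV_diff[OF D[OF f, of z p "s *\<^sub>R q"] D[OF f, of z p 0]] inS'[of z s] inS'[of z 0] s by simp
    qed
    then obtain z where z: "0 < z" "z < s"
      "h s - h 0 = s * (ddir f (x + z *\<^sub>R p + s *\<^sub>R q) p - ddir f (x + z *\<^sub>R p) p)" by auto
    have "\<exists>w>0. w < s \<and> ddir f (x + s *\<^sub>R q + z *\<^sub>R p) p - ddir f (x + 0 *\<^sub>R q + z *\<^sub>R p) p
        = (s - 0) * ddir (\<lambda>y. ddir f y p) (x + w *\<^sub>R q + z *\<^sub>R p) q"
    proof (rule MVT2[OF s(1)])
      fix w assume "0 \<le> w" "w \<le> s"
      then show "((\<lambda>w. ddir f (x + w *\<^sub>R q + z *\<^sub>R p) p) has_real_derivative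
          ddir (\<lambda>y. ddir f y p) (x + w *\<^sub>R q + z *\<^sub>R p) q) (at w)"
        using inS'[of z w] z by (intro D smooth_on_ddir f) (auto simp: algebra_simps)
    qed
    then obtain w where w: "0 < w" "w < s" "ddir f (x + s *\<^sub>R q + z *\<^sub>R p) p - ddir f (x + 0 *\<^sub>R q + z *\<^sub>R p) p
        = s * ddir (\<lambda>y. ddir f y p) (x + w *\<^sub>R q + z *\<^sub>R p) q" by auto
    have "\<Delta> s = h s - h 0" using pq by (auto simp: \<Delta>_def h_def algebra_simps)
    with z(3) w(3) have "\<Delta> s = s * (s * ddir (\<lambda>y. ddir f y p) (x + z *\<^sub>R p + w *\<^sub>R q) q)"
      by (simp add: algebra_simps)
    then show ?thesis using z w by (intro exI[of _ z] exI[of _ w]) auto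
  qed
  have lim: "\<exists>d>0. \<forall>s. 0 < s \<longrightarrow> s < d \<longrightarrow> \<bar>\<Delta> s / (s * s) - ddir (\<lambda>y. ddir f y p) x q\<bar> < \<epsilon>"
    if \<epsilon>: "\<epsilon> > 0" and pq: "p = u \<and> q = v \<or> p = v \<and> q = u" for p q \<epsilon>
  proof -
    have "isCont (\<lambda>y. ddir (\<lambda>y. ddir f y p) y q) x"
      using smooth_on_continuous[OF smooth_on_ddir[OF smooth_on_ddir[OF f]]] S
      by (metis continuous_on_eq_continuous_at)
    then obtain d where d: "d > 0" "\<And>y. dist y x < d \<Longrightarrow>
        \<bar>ddir (\<lambda>y. ddir f y p) y q - ddir (\<lambda>y. ddir f y p) x q\<bar> < \<epsilon>"
      unfolding continuous_at_eps_delta dist_real_def using \<epsilon> by blast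
    show ?thesis
    proof (intro exI[of _ "min d e / K"] conjI allI impI)
      show "0 < min d e / K" using d e K by simp
      fix s assume s: "0 < s" "s < min d e / K"
      then have sK: "s * K < e" "s * K < d" using K by (auto simp: field_simps)
      from main[OF s(1) sK(1) pq] obtain a b where ab: "\<bar>a\<bar> \<le> s" "\<bar>b\<bar> \<le> s"
        "\<Delta> s = s * (s * ddir (\<lambda>y. ddir f y p) (x + a *\<^sub>R p + b *\<^sub>R q) q)" by auto
      have "norm (a *\<^sub>R p + b *\<^sub>R q) \<le> \<bar>a\<bar> * norm p + \<bar>b\<bar> * norm q"
        by (metis norm_scaleR norm_triangle_ineq)
      also have "\<dots> \<le> s * norm p + s * norm q"
        using ab by (intro add_mono mult_right_mono) auto
      also have "\<dots> \<le> s * K" using s pq by (auto simp: K_def algebra_simps)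
      finally have "dist (x + a *\<^sub>R p + b *\<^sub>R q) x < d" using sK
        by (simp add: dist_norm add.assoc)
      from d(2)[OF this] show "\<bar>\<Delta> s / (s * s) - ddir (\<lambda>y. ddir f y p) x q\<bar> < \<epsilon>"
        using s(1) by (simp add: ab(3))
    qed
  qed
  show ?thesis
  proof (rule ccontr)
    assume ne: "\<not> ?thesis"
    define \<epsilon> where "\<epsilon> = \<bar>ddir (\<lambda>y. ddir f y u) x v - ddir (\<lambda>y. ddir f y v) x u\<bar> / 2"
    have "\<epsilon> > 0" using ne by (simp add: \<epsilon>_def)
    with lim[of \<epsilon> u v] lim[of \<epsilon> v u] obtain d d' where d: "d > 0" "d' > 0"
      "\<And>s. 0 < s \<Longrightarrow> s < d \<Longrightarrow> \<bar>\<Delta> s / (s * s) - ddir (\<lambda>y. ddir f y u) x v\<bar> < \<epsilon>"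
      "\<And>s. 0 < s \<Longrightarrow> s < d' \<Longrightarrow> \<bar>\<Delta> s / (s * s) - ddir (\<lambda>y. ddir f y v) x u\<bar> < \<epsilon>" by metis
    define s where "s = min d d' / 2"
    have "0 < s" "s < d" "s < d'" using d by (auto simp: s_def)
    with d(3,4)[of s] show False unfolding \<epsilon>_def by argo
  qed
qed

lemma ddir_commute:
  fixes f :: "'b::real_normed_vector \<Rightarrow> 'c::euclidean_space"
  assumes S: "open S" "x \<in> S" and f: "smooth_on S f"
  shows "ddir (\<lambda>y. ddir f y u) x v = ddir (\<lambda>y. ddir f y v) x u"
proof (rule euclidean_eqI)
  fix b :: 'c assume "b \<in> Basis"
  have 1: "ddir (\<lambda>y. g y \<bullet> b) y w = ddir g y w \<bullet> b" if "smooth_on S g" "y \<in> S" for g :: "'b \<Rightarrow> 'c" and y w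
    using ddir_eqI[OF has_derivative_inner_left[OF smooth_on_has_derivative[OF that], of b]] by simp
  have 2: "ddir (\<lambda>y. ddir f y p) x q \<bullet> b = ddir (\<lambda>y. ddir (\<lambda>y. f y \<bullet> b) y p) x q" for p q
  proof -
    have "ddir (\<lambda>y. ddir f y p \<bullet> b) x = ddir (\<lambda>y. ddir (\<lambda>y. f y \<bullet> b) y p) x"
      by (rule ddir_cong[OF S]) (simp add: 1[OF f])
    with 1[OF smooth_on_ddir[OF f] S(2), of p q] show ?thesis by simp
  qed
  show "ddir (\<lambda>y. ddir f y u) x v \<bullet> b = ddir (\<lambda>y. ddir f y v) x u \<bullet> b"
    unfolding 2 by (rule ddir_commute_real[OF S])
      (intro smooth_on_inner smooth_on_const f S)
qed

section \<open>Linear systems of Frobenius type\<close>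

lemma bilinear_norm_le:
  fixes u :: "'b::euclidean_space" and v :: "'c::euclidean_space"
  assumes "bilinear B"
  shows "norm (B u v) \<le> (\<Sum>b\<in>Basis. \<Sum>c\<in>Basis. norm (B b c)) * norm u * norm v"
proof -
  have "norm (B u v) \<le> (\<Sum>b\<in>Basis. \<Sum>c\<in>Basis. norm (((u \<bullet> b) * (v \<bullet> c)) *\<^sub>R B b c))"
    by (subst bilinear_expand[OF assms], rule order_trans[OF norm_sum], rule sum_mono, rule norm_sum)
  also have "\<dots> \<le> (\<Sum>b\<in>Basis. \<Sum>c\<in>Basis. (norm u * norm v) * norm (B b c))"
    unfolding norm_scaleR abs_mult
    by (intro sum_mono mult_right_mono mult_mono) (auto intro: Basis_le_norm)
  also have "\<dots> = (\<Sum>b\<in>Basis. \<Sum>c\<in>Basis. norm (B b c)) * norm u * norm v"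
    by (simp add: sum_distrib_left mult_ac)
  finally show ?thesis .
qed

lemma bilinear_basis_sum:
  fixes f :: "'b::euclidean_space \<Rightarrow> 'c::euclidean_space \<Rightarrow> 'd::real_vector"
  shows "bilinear (\<lambda>u v. \<Sum>b\<in>Basis. \<Sum>c\<in>Basis. ((u \<bullet> b) * (v \<bullet> c)) *\<^sub>R f b c)"
  unfolding bilinear_def linear_iff
  by (intro conjI allI)
     (simp_all add: inner_add_left distrib_right distrib_left scaleR_add_left sum.distrib scaleR_sum_right mult.left_commute mult.assoc)

lemma ddir_bilinear:
  assumes "open S" "smooth_bilinear_on S B" "x \<in> S"
  shows "bilinear (\<lambda>u v. ddir (\<lambda>y. B y u v) x h)"
proof -
  have B: "((\<lambda>y. B y i j) has_derivative ddir (\<lambda>y. B y i j) x) (at x)" for i j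
    by (rule smooth_on_has_derivative[OF smooth_bilinear_onD(2)[OF assms(2)] assms(3)])
  note bx = bilinear_expand[OF smooth_bilinear_onD(1)[OF assms(2)]]
  have "((\<lambda>y. B y u v) has_derivative (\<lambda>h. \<Sum>i\<in>Basis. \<Sum>j\<in>Basis. ((u \<bullet> i) * (v \<bullet> j)) *\<^sub>R ddir (\<lambda>y. B y i j) x h)) (at x)" for u v
    by (rule has_derivative_transform_within_open[OF _ assms(1,3) bx[symmetric]])
       (auto intro!: derivative_eq_intros B)
  then have eq: "(\<lambda>u v. ddir (\<lambda>y. B y u v) x h) =
      (\<lambda>u v. \<Sum>i\<in>Basis. \<Sum>j\<in>Basis. ((u \<bullet> i) * (v \<bullet> j)) *\<^sub>R ddir (\<lambda>y. B y i j) x h)"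
    by (intro ext) (rule fun_cong[OF ddir_eqI])
  show ?thesis by (subst eq) (rule bilinear_basis_sum)
qed

text \<open>Only the finitely many values on basis vectors need bounding, and each is continuous on
  a compact set.\<close>

lemma bilinear_field_bound:
  fixes B :: "'z::topological_space \<Rightarrow> 'b::euclidean_space \<Rightarrow> 'c::euclidean_space \<Rightarrow> 'd::real_normed_vector"
  assumes "compact K" "\<And>x. x \<in> K \<Longrightarrow> bilinear (B x)" "\<And>u v. continuous_on K (\<lambda>x. B x u v)"
  obtains C where "C > 0" "\<And>x u v. x \<in> K \<Longrightarrow> norm (B x u v) \<le> C * norm u * norm v"
proof -
  let ?h = "\<lambda>x. \<Sum>b\<in>Basis. \<Sum>c\<in>Basis. norm (B x b c)"
  have "continuous_on K ?h"
    by (intro continuous_on_sum continuous_on_norm assms)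
  then have "bounded (?h ` K)" using assms(1) compact_continuous_image compact_imp_bounded by blast
  then obtain C where C: "C > 0" "\<And>x. x \<in> K \<Longrightarrow> norm (?h x) \<le> C" unfolding bounded_pos by auto
  have "norm (B x u v) \<le> C * norm u * norm v" if "x \<in> K" for x u v
  proof -
    have "?h x \<le> C" using C(2)[OF that] by auto
    then have "?h x * norm u * norm v \<le> C * norm u * norm v"
      by (intro mult_right_mono) auto
    with bilinear_norm_le[OF assms(2)[OF that], of u v] show ?thesis by linarith
  qed
  with C(1) show ?thesis using that by blast
qed

lemma continuous_on_bilinear_field:
  fixes B :: "'z::topological_space \<Rightarrow> 'b::euclidean_space \<Rightarrow> 'c::euclidean_space \<Rightarrow> 'd::real_normed_vector"
  assumes "\<And>x. x \<in> K \<Longrightarrow> bilinear (B x)" "\<And>u v. continuous_on K (\<lambda>x. B x u v)"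
    and "continuous_on U p" "p ` U \<subseteq> K" "continuous_on U a" "continuous_on U b"
  shows "continuous_on U (\<lambda>z. B (p z) (a z) (b z))"
proof -
  have "continuous_on U (\<lambda>z. \<Sum>i\<in>Basis. \<Sum>j\<in>Basis. ((a z \<bullet> i) * (b z \<bullet> j)) *\<^sub>R B (p z) i j)"
    using assms
    by (intro continuous_on_sum continuous_on_scaleR continuous_on_mult continuous_on_inner
        continuous_on_const continuous_on_compose2[OF assms(2) assms(3)]) auto
  moreover have "B (p z) (a z) (b z) = (\<Sum>i\<in>Basis. \<Sum>j\<in>Basis. ((a z \<bullet> i) * (b z \<bullet> j)) *\<^sub>R B (p z) i j)"
    if "z \<in> U" for z
    using assms(1,4) that by (intro bilinear_expand) auto
  ultimately show ?thesis by (simp cong: continuous_on_cong)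
qed

text \<open>A first order Taylor estimate with one d for all base points; this uniformity is what
  allows its use simultaneously at all points t x and t y of two rays. Convexity keeps the segments
  inside K.\<close>

lemma bilinear_field_linearization:
  fixes A :: "'a::euclidean_space \<Rightarrow> 'b::euclidean_space \<Rightarrow> 'c::euclidean_space \<Rightarrow> 'd::euclidean_space"
  assumes S: "open S" "smooth_bilinear_on S A" and K: "compact K" "convex K" "K \<subseteq> S" and "\<epsilon> > 0"
  obtains d where "d > 0"
    "\<And>x y w e. x \<in> K \<Longrightarrow> y \<in> K \<Longrightarrow> norm (y - x) < d \<Longrightarrow>
       norm (A y w e - A x w e - ddir (\<lambda>x. A x w e) x (y - x)) \<le> \<epsilon> * norm (y - x) * norm w * norm e"
proof -
  let ?A' = "\<lambda>x v w e. ddir (\<lambda>x. A x w e) x v"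
  have sm: "smooth_on S (\<lambda>x. A x w e)" for w e using smooth_bilinear_onD(2)[OF S(2)] .
  have cont: "continuous_on K (\<lambda>x. ?A' x v w e)" for v w e
    by (rule continuous_on_subset[OF smooth_on_continuous[OF smooth_on_ddir[OF sm]] K(3)])
  let ?q = "\<lambda>z. \<Sum>v\<in>Basis. \<Sum>b\<in>Basis. \<Sum>c\<in>Basis. norm (?A' (snd z) v b c - ?A' (fst z) v b c)"
  have "continuous_on (K \<times> K) ?q"
    by (intro continuous_on_sum continuous_on_norm continuous_on_diff
        continuous_on_compose2[OF cont continuous_on_snd[OF continuous_on_id]]
        continuous_on_compose2[OF cont continuous_on_fst[OF continuous_on_id]]) auto
  then have "uniformly_continuous_on (K \<times> K) ?q"
    by (intro compact_uniformly_continuous compact_Times K)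
  then obtain d where d: "d > 0"
    "\<And>z z'. z \<in> K \<times> K \<Longrightarrow> z' \<in> K \<times> K \<Longrightarrow> dist z' z < d \<Longrightarrow> dist (?q z') (?q z) < \<epsilon>"
    by (rule uniformly_continuous_onE[OF _ \<open>\<epsilon> > 0\<close>]) blast
  \<comment> \<open>\<open>?q\<close> vanishes on the diagonal, so uniform continuity is applied to
    (x, y) and the diagonal point (x, x).\<close>
  have q: "?q (x, y) < \<epsilon>" if "x \<in> K" "y \<in> K" "norm (y - x) < d" for x y
    using d(2)[of "(x, x)" "(x, y)"] that by (simp add: dist_Pair_Pair dist_norm norm_minus_commute)
  have "norm (A y w e - A x w e - ?A' x (y - x) w e) \<le> \<epsilon> * norm (y - x) * norm w * norm e"
    if xy: "x \<in> K" "y \<in> K" "norm (y - x) < d" for x y w e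
  proof -
    have "norm (A y w e - A x w e - ?A' x (y - x) w e) \<le> norm (y - x) * (\<epsilon> * norm w * norm e)"
    proof (rule differentiable_bound_linearization[where f'="\<lambda>x v. ?A' x v w e" and S="K \<inter> ball x d"])
      fix t :: real assume t: "t \<in> {0..1}"
      have "x + t *\<^sub>R (y - x) = (1 - t) *\<^sub>R x + t *\<^sub>R y" by (simp add: algebra_simps)
      then have "x + t *\<^sub>R (y - x) \<in> K" using K(2) t xy by (simp add: convex_alt)
      moreover have "dist x (x + t *\<^sub>R (y - x)) < d"
        using t xy mult_right_mono[of t 1 "norm (y - x)"] by (simp add: dist_norm)
      ultimately show "x + t *\<^sub>R (y - x) \<in> K \<inter> ball x d" by simp
    next
      show "x \<in> K \<inter> ball x d" using xy d by simp
    next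
      fix x' assume "x' \<in> K \<inter> ball x d"
      then show "((\<lambda>x. A x w e) has_derivative (\<lambda>v. ?A' x' v w e)) (at x' within K \<inter> ball x d)"
        using smooth_on_has_derivative[OF sm, of x' w e] K(3) has_derivative_at_withinI by blast
    next
      fix x' assume x': "x' \<in> K \<inter> ball x d"
      have "norm ((?A' x' v w e - ?A' x v w e)) \<le> (\<epsilon> * norm w * norm e) * norm v" for v
      proof -
        let ?T = "\<lambda>v w e. ?A' x' v w e - ?A' x v w e"
        have inS: "x' \<in> S" "x \<in> S" using x' xy K by auto
        have lin: "linear (\<lambda>v. ?T v w e)" for w e
          using smooth_on_linear_ddir[OF sm] inS by (intro linear_compose_sub) auto
        have bil: "bilinear (\<lambda>w e. ?T v w e)" for v
        proof -
          have "bilinear (\<lambda>w e. ?A' x' v w e)" "bilinear (\<lambda>w e. ?A' x v w e)"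
            using ddir_bilinear[OF S] inS by auto
          then show ?thesis unfolding bilinear_def
            by (intro conjI allI linear_compose_sub) auto
        qed
        have "norm (?T v w e) \<le> (\<Sum>b\<in>Basis. norm ((v \<bullet> b) *\<^sub>R ?T b w e))"
          by (subst linear_basis_expand[OF lin]) (rule norm_sum)
        also have "\<dots> \<le> (\<Sum>b\<in>Basis. norm v * ((\<Sum>c\<in>Basis. \<Sum>d\<in>Basis. norm (?T b c d)) * norm w * norm e))"
          unfolding norm_scaleR
          by (intro sum_mono mult_mono bilinear_norm_le[OF bil]) (auto intro: Basis_le_norm)
        also have "\<dots> = ?q (x, x') * (norm v * norm w * norm e)"
          by (simp add: sum_distrib_left sum_distrib_right mult_ac)
        also have "\<dots> \<le> \<epsilon> * (norm v * norm w * norm e)"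
          using q[of x x'] x' xy by (intro mult_right_mono) (auto simp: dist_norm norm_minus_commute)
        finally show ?thesis by (simp add: mult_ac)
      qed
      then show "onorm ((\<lambda>v. ?A' x' v w e) - (\<lambda>v. ?A' x v w e)) \<le> \<epsilon> * norm w * norm e"
        by (intro onorm_le) (simp add: fun_diff_def)
    qed
    then show ?thesis by (simp add: mult_ac)
  qed
  with d(1) show ?thesis using that by blast
qed

text \<open>\<open>\<Psi>\<close> is the fixed point of the contraction sending f to
  \<open>x \<mapsto> e0 + \<integral> A (t x) x (f (t x)) dt\<close>, t from 0 to 1; precomposing with the projection to the ball makes this
  an operator on bounded continuous functions on the whole space.\<close>

lemma radial_solution:
  fixes A :: "'a::euclidean_space \<Rightarrow> 'a \<Rightarrow> 'e::euclidean_space \<Rightarrow> 'e"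
  assumes r: "r > 0" and bil: "\<And>x. x \<in> cball 0 r \<Longrightarrow> bilinear (A x)"
    and cont: "\<And>u e. continuous_on (cball 0 r) (\<lambda>x. A x u e)"
    and half: "\<And>x y e. x \<in> cball 0 r \<Longrightarrow> y \<in> cball 0 r \<Longrightarrow> norm (A x y e) \<le> norm e / 2"
  obtains \<Psi> M where "\<Psi> 0 = e0" "\<And>x. norm (\<Psi> x) \<le> M"
    "\<And>x t. x \<in> cball 0 r \<Longrightarrow> t \<in> {0..1} \<Longrightarrow>
      ((\<lambda>t. \<Psi> (t *\<^sub>R x)) has_vector_derivative A (t *\<^sub>R x) x (\<Psi> (t *\<^sub>R x))) (at t within {0..1})"
proof -
  define \<pi> where "\<pi> = closest_point (cball (0::'a) r)"
  have \<pi>: "\<pi> x \<in> cball 0 r" for x unfolding \<pi>_def using r by (intro closest_point_in_set) auto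
  have \<pi>_id: "\<pi> x = x" if "x \<in> cball 0 r" for x unfolding \<pi>_def by (rule closest_point_self[OF that])
  have c\<pi>: "continuous_on U \<pi>" for U unfolding \<pi>_def using r by (intro continuous_on_closest_point) auto
  have scale: "t *\<^sub>R x \<in> cball 0 r" if "t \<in> {0..1}" "x \<in> cball 0 r" for t :: real and x :: 'a
    using that mult_mono[of "\<bar>t\<bar>" 1 "norm x" r] r by simp
  define h where "h f x t = A (t *\<^sub>R \<pi> x) (\<pi> x) (apply_bcontfun f (t *\<^sub>R \<pi> x))"
    for f :: "'a \<Rightarrow>\<^sub>C 'e" and x and t :: real
  have ch2: "continuous_on (UNIV \<times> cbox 0 1) (\<lambda>(x, t). h f x t)" for f
    unfolding h_def split_beta
  proof (rule continuous_on_bilinear_field[OF bil cont])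
    have p: "continuous_on (UNIV \<times> cbox 0 1) (\<lambda>z::'a\<times>real. snd z *\<^sub>R \<pi> (fst z))"
      by (intro continuous_on_scaleR continuous_on_snd continuous_on_id
          continuous_on_compose2[OF c\<pi>[of UNIV]] continuous_on_fst) auto
    then show "continuous_on (UNIV \<times> cbox 0 1) (\<lambda>z::'a\<times>real. snd z *\<^sub>R \<pi> (fst z))" .
    show "(\<lambda>z::'a\<times>real. snd z *\<^sub>R \<pi> (fst z)) ` (UNIV \<times> cbox 0 1) \<subseteq> cball 0 r"
      using scale[OF _ \<pi>] by auto
    show "continuous_on (UNIV \<times> cbox 0 1) (\<lambda>z::'a\<times>real. \<pi> (fst z))"
      by (intro continuous_on_compose2[OF c\<pi>[of UNIV]] continuous_on_fst continuous_on_id) auto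
    show "continuous_on (UNIV \<times> cbox 0 1) (\<lambda>z::'a\<times>real. apply_bcontfun f (snd z *\<^sub>R \<pi> (fst z)))"
      by (rule continuous_on_compose2[OF continuous_on_apply_bcontfun[of UNIV] p]) auto
  qed
  have ch: "continuous_on {0..1} (h f x)" for f x
    using continuous_on_compose2[OF ch2[of f], of "{0..1}" "\<lambda>t. (x, t)"]
    by (simp add: continuous_on_Pair continuous_on_id image_subset_iff)
  define T0 where "T0 f x = e0 + integral {0..1} (h f x)" for f x
  have hbound: "norm (h f x t) \<le> norm f / 2" if "t \<in> {0..1}" for f x t
    using half[OF scale[OF that \<pi>] \<pi>, of x x "apply_bcontfun f (t *\<^sub>R \<pi> x)"] norm_bounded[of f "t *\<^sub>R \<pi> x"]
    unfolding h_def by linarith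
  have T0: "T0 f \<in> bcontfun" for f
  proof (rule bcontfun_normI)
    show "continuous_on UNIV (T0 f)"
      unfolding T0_def using integral_continuous_on_param[OF ch2[of f]]
      by (intro continuous_on_add continuous_on_const) simp
    fix x show "norm (T0 f x) \<le> norm e0 + norm f / 2"
      using integral_bound[OF _ ch[of f x] hbound] unfolding T0_def
      by (intro norm_triangle_le) simp
  qed
  define T where "T f = Bcontfun (T0 f)" for f
  have Tapp: "apply_bcontfun (T f) = T0 f" for f unfolding T_def by (rule Bcontfun_inverse[OF T0])
  \<comment> \<open>The contraction constant 1/2 is the bound \<open>half\<close>: linearity in the
    last slot turns a difference of two values of the integrand into a single value.\<close>
  have "\<exists>!f. T f = f"
  proof (rule banach_fix_type[of "1/2"], safe)
    fix f g :: "'a \<Rightarrow>\<^sub>C 'e"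
    show "dist (T f) (T g) \<le> 1 / 2 * dist f g"
    proof (rule dist_bound)
      fix x
      have "dist (T f x) (T g x) = norm (integral {0..1} (\<lambda>t. h f x t - h g x t))"
        unfolding Tapp T0_def dist_norm
        by (subst integral_diff) (auto intro!: integrable_continuous_real ch)
      also have "\<dots> \<le> (1 / 2 * dist f g) * (1 - 0)"
      proof (rule integral_bound)
        show "continuous_on {0..1} (\<lambda>t. h f x t - h g x t)" by (intro continuous_on_diff ch)
        fix t :: real assume t: "t \<in> {0..1}"
        have lin: "linear (A (t *\<^sub>R \<pi> x) (\<pi> x))"
          using bil[OF scale[OF t \<pi>]] by (simp add: bilinear_def)
        show "norm (h f x t - h g x t) \<le> 1 / 2 * dist f g"
          using half[OF scale[OF t \<pi>] \<pi>, of x x "apply_bcontfun f (t *\<^sub>R \<pi> x) - apply_bcontfun g (t *\<^sub>R \<pi> x)"]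
            dist_bounded[of f "t *\<^sub>R \<pi> x" g]
          unfolding h_def linear_diff[OF lin, symmetric] dist_norm by linarith
      qed simp
      finally show "dist (T f x) (T g x) \<le> 1 / 2 * dist f g" by simp
    qed
  qed auto
  then obtain f where "T f = f" by auto
  then have fixp: "apply_bcontfun f x = T0 f x" for x using Tapp by metis
  show ?thesis
  proof (rule that[of "apply_bcontfun f" "norm f"])
    have "h f 0 t = 0" if "t \<in> {0..1}" for t
    proof -
      have "0 \<in> cball (0::'a) r" using r by simp
      with bil[OF this] \<pi>_id[OF this] show ?thesis unfolding h_def by (simp add: bilinear_lzero)
    qed
    then have "integral {0..1} (h f 0) = integral {0..1} (\<lambda>t::real. 0::'e)"
      by (rule integral_cong)
    then show "apply_bcontfun f 0 = e0" using fixp[of 0] by (simp add: T0_def)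
    show "norm (apply_bcontfun f x) \<le> norm f" for x by (rule norm_bounded)
    fix x :: 'a and t :: real assume x: "x \<in> cball 0 r" and t: "t \<in> {0..1}"
    define H where "H t = integral {0..t} (h f x)" for t
    have H: "(H has_vector_derivative h f x s) (at s within {0..1})" if "s \<in> {0..1}" for s
      unfolding H_def by (rule integral_has_vector_derivative[OF ch that])
    \<comment> \<open>The substitution s to t s turns the integral that defines the fixed point at t
      x into the integral of \<open>h f x\<close> over [0, t]. Differentiating in t then yields the
      radial equation.\<close>
    have eq: "apply_bcontfun f (t *\<^sub>R x) = e0 + H t" if t: "t \<in> {0..1}" for t
    proof -
      have "((\<lambda>s. t *\<^sub>R h f x (t * s)) has_integral (H (t * 1) - H (t * 0))) {0..1}"
      proof (rule fundamental_theorem_of_calculus)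
        fix s :: real assume s: "s \<in> {0..1}"
        have im: "(*) t ` {0..1} \<subseteq> {0..1}" using t by (auto simp: mult_le_one)
        have "((H \<circ> (*) t) has_vector_derivative (t *\<^sub>R h f x (t * s))) (at s within {0..1})"
        proof (rule vector_diff_chain_within)
          show "((*) t has_vector_derivative t) (at s within {0..1})"
            by (auto intro!: derivative_eq_intros simp: has_vector_derivative_def)
          have "t * s \<in> {0..1}" using im s by blast
          from has_vector_derivative_within_subset[OF H[OF this] im]
          show "(H has_vector_derivative h f x (t * s)) (at (t * s) within (*) t ` {0..1})" .
        qed
        then show "((\<lambda>a. H (t * a)) has_vector_derivative t *\<^sub>R h f x (t * s)) (at s within {0..1})"
          by (simp add: o_def)
      qed simp
      moreover have "t *\<^sub>R h f x (t * s) = h f (t *\<^sub>R x) s" if s: "s \<in> {0..1}" for s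
      proof -
        have "s *\<^sub>R t *\<^sub>R x \<in> cball 0 r" using scale s t x by blast
        then have "bilinear (A (s *\<^sub>R t *\<^sub>R x))" by (rule bil)
        then show ?thesis unfolding h_def \<pi>_id[OF x] \<pi>_id[OF scale[OF t x]]
          by (simp add: bilinear_lmul mult.commute)
      qed
      ultimately have "((\<lambda>s. h f (t *\<^sub>R x) s) has_integral (H (t * 1) - H (t * 0))) {0..1}"
        by (rule has_integral_eq[rotated])
      then have "((\<lambda>s. h f (t *\<^sub>R x) s) has_integral (H t - H 0)) {0..1}" by simp
      moreover have "H 0 = 0" by (simp add: H_def)
      ultimately have "integral {0..1} (h f (t *\<^sub>R x)) = H t" by (simp add: integral_unique)
      then show ?thesis using fixp[of "t *\<^sub>R x"] by (simp add: T0_def)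
    qed
    have "((\<lambda>t. e0 + H t) has_vector_derivative h f x t) (at t within {0..1})"
      using has_vector_derivative_add[OF has_vector_derivative_const H[OF t], of e0] by simp
    then have "((\<lambda>t. apply_bcontfun f (t *\<^sub>R x)) has_vector_derivative h f x t) (at t within {0..1})"
      by (rule has_vector_derivative_transform[OF t _, rotated]) (simp add: eq)
    then show "((\<lambda>t. apply_bcontfun f (t *\<^sub>R x)) has_vector_derivative
        A (t *\<^sub>R x) x (apply_bcontfun f (t *\<^sub>R x))) (at t within {0..1})"
      by (simp add: h_def \<pi>_id[OF x])
  qed
qed


text \<open>The integrability condition is exactly what makes the first order terms of
  \<open>d t = \<Psi> (t y) - \<Psi> (t x) - t A (t x) (y - x) (\<Psi> (t x))\<close> satisfy a homogeneous equation,
  so that \<open>d 1\<close> is of smaller order than \<open>y - x\<close>.\<close>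

lemma frobenius_origin:
  fixes A :: "'a::euclidean_space \<Rightarrow> 'a \<Rightarrow> 'e::euclidean_space \<Rightarrow> 'e"
  assumes S: "open S" "0 \<in> S" "smooth_bilinear_on S A"
    and integ: "\<And>x u v e. x \<in> S \<Longrightarrow>
      ddir (\<lambda>x. A x u e) x v + A x u (A x v e) = ddir (\<lambda>x. A x v e) x u + A x v (A x u e)"
  obtains r \<Psi> where "r > 0" "ball 0 r \<subseteq> S" "\<Psi> 0 = e0"
    "\<And>x. x \<in> ball 0 r \<Longrightarrow> (\<Psi> has_derivative (\<lambda>v. A x v (\<Psi> x))) (at x)"
proof -
  let ?A' = "\<lambda>x v w e. ddir (\<lambda>x. A x w e) x v"
  have sm: "smooth_on S (\<lambda>x. A x w e)" for w e using smooth_bilinear_onD(2)[OF S(3)] .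
  obtain R where R: "R > 0" "cball 0 R \<subseteq> S" using S open_contains_cball by blast
  have bilR: "\<And>x. x \<in> cball 0 R \<Longrightarrow> bilinear (A x)" using smooth_bilinear_onD(1)[OF S(3)] R by blast
  have contR: "continuous_on (cball 0 R) (\<lambda>x. A x u e)" for u e
    by (rule continuous_on_subset[OF smooth_on_continuous[OF sm] R(2)])
  have contR': "continuous_on (cball 0 R) (\<lambda>x. ?A' x v u e)" for u v e
    by (rule continuous_on_subset[OF smooth_on_continuous[OF smooth_on_ddir[OF sm]] R(2)])
  obtain C where C: "C > 0" "\<And>x u e. x \<in> cball 0 R \<Longrightarrow> norm (A x u e) \<le> C * norm u * norm e"
    using bilinear_field_bound[OF compact_cball bilR contR] by metis
  \<comment> \<open>The compactness bound is first obtained for each fixed direction v; summing over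
    basis directions makes it linear in the norm of v.\<close>
  have "\<exists>L. L > 0 \<and> (\<forall>x\<in>cball 0 R. \<forall>v w e. norm (?A' x v w e) \<le> L * norm v * norm w * norm e)"
  proof -
    have "\<exists>L>0. \<forall>x\<in>cball 0 R. \<forall>w e. norm (?A' x v w e) \<le> L * norm w * norm e" for v
    proof -
      have b: "\<And>x. x \<in> cball 0 R \<Longrightarrow> bilinear (\<lambda>w e. ?A' x v w e)"
        using ddir_bilinear[OF S(1,3)] R by blast
      obtain L where "L > 0" "\<And>x w e. x \<in> cball 0 R \<Longrightarrow> norm (?A' x v w e) \<le> L * norm w * norm e"
        using bilinear_field_bound[OF compact_cball b contR'] by metis
      then show ?thesis by blast
    qed
    then obtain L where L: "\<And>v. L v > 0" "\<And>v x w e. x \<in> cball 0 R \<Longrightarrow> norm (?A' x v w e) \<le> L v * norm w * norm e"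
      by metis
    show ?thesis
    proof (intro exI conjI ballI allI)
      show "(\<Sum>b\<in>Basis. L b) > 0" by (rule sum_pos) (auto simp: L)
      fix x v w e assume x: "x \<in> cball (0::'a) R"
      then have lin: "linear (\<lambda>v. ?A' x v w e)" using smooth_on_linear_ddir[OF sm] R by auto
      have "norm (?A' x v w e) \<le> (\<Sum>b\<in>Basis. norm ((v \<bullet> b) *\<^sub>R ?A' x b w e))"
        by (subst linear_basis_expand[OF lin]) (rule norm_sum)
      also have "\<dots> \<le> (\<Sum>b\<in>Basis. norm v * (L b * norm w * norm e))"
        unfolding norm_scaleR
        by (intro sum_mono mult_mono L x) (auto intro: Basis_le_norm)
      also have "\<dots> = (\<Sum>b\<in>Basis. L b) * norm v * norm w * norm e"
        by (simp add: sum_distrib_left sum_distrib_right mult_ac)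
      finally show "norm (?A' x v w e) \<le> (\<Sum>b\<in>Basis. L b) * norm v * norm w * norm e" .
    qed
  qed
  then obtain L where L: "L > 0" "\<And>x v w e. x \<in> cball 0 R \<Longrightarrow> norm (?A' x v w e) \<le> L * norm v * norm w * norm e"
    by blast
  \<comment> \<open>The choice of 1 / (2 C) makes C r at most 1/2, which gives the contraction here
    and the absorption of the homogeneous term in the error estimate below.\<close>
  define r where "r = min R (1 / (2 * C))"
  have r: "r > 0" "r \<le> R" "C * r \<le> 1 / 2" using R C by (auto simp: r_def min_def field_simps)
  have sub: "cball (0::'a) r \<subseteq> cball 0 R" using r by auto
  have half: "norm (A x y e) \<le> norm e / 2" if "x \<in> cball 0 r" "y \<in> cball 0 r" for x y e
  proof -
    have "norm (A x y e) \<le> C * norm y * norm e" using C(2) that sub by blast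
    also have "\<dots> \<le> (C * r) * norm e" using that C by (intro mult_right_mono mult_left_mono) auto
    also have "\<dots> \<le> (1/2) * norm e" using r by (intro mult_right_mono) auto
    finally show ?thesis by simp
  qed
  obtain \<Psi> M where \<Psi>: "\<Psi> 0 = e0" "\<And>x. norm (\<Psi> x) \<le> M"
    "\<And>x t. x \<in> cball 0 r \<Longrightarrow> t \<in> {0..1} \<Longrightarrow>
      ((\<lambda>t. \<Psi> (t *\<^sub>R x)) has_vector_derivative A (t *\<^sub>R x) x (\<Psi> (t *\<^sub>R x))) (at t within {0..1})"
    using radial_solution[OF r(1) bilR[OF subsetD[OF sub]] continuous_on_subset[OF contR sub] half] by blast
  have M: "M \<ge> 0" using \<Psi>(2)[of 0] norm_ge_zero order_trans by blast
  have scale: "t *\<^sub>R x \<in> cball 0 r" if "t \<in> {0..1}" "x \<in> cball 0 r" for t :: real and x :: 'a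
    using that mult_mono[of "\<bar>t\<bar>" 1 "norm x" r] r by simp
  \<comment> \<open>Collects the constants of the four error terms of \<open>D'\<close>; the summand
    r carries the Taylor error \<epsilon>, the others the terms quadratic in z.\<close>
  define Q where "Q = M * (r + L + L * r * C + C * C)"
  have Q: "Q \<ge> 0" unfolding Q_def using M r L C by simp
  have main: "norm (\<Psi> y - \<Psi> x - A x (y - x) (\<Psi> x)) \<le> 2 * (Q * (\<epsilon> + norm (y - x)) * norm (y - x))"
    if x: "x \<in> cball 0 r" and y: "y \<in> cball 0 r" and "\<epsilon> > 0" and d: "norm (y - x) < d"
      and lin: "\<And>x y w e. x \<in> cball 0 r \<Longrightarrow> y \<in> cball 0 r \<Longrightarrow> norm (y - x) < d \<Longrightarrow>
       norm (A y w e - A x w e - ?A' x (y - x) w e) \<le> \<epsilon> * norm (y - x) * norm w * norm e"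
    for x y \<epsilon> d
  proof -
    define z where "z = y - x"
    define q where "q = Q * (\<epsilon> + norm z) * norm z"
    define D where "D t = \<Psi> (t *\<^sub>R y) - \<Psi> (t *\<^sub>R x) - t *\<^sub>R A (t *\<^sub>R x) z (\<Psi> (t *\<^sub>R x))" for t
    define D' where "D' t = A (t *\<^sub>R y) y (\<Psi> (t *\<^sub>R y)) - A (t *\<^sub>R x) x (\<Psi> (t *\<^sub>R x))
       - (t *\<^sub>R (?A' (t *\<^sub>R x) x z (\<Psi> (t *\<^sub>R x)) + A (t *\<^sub>R x) z (A (t *\<^sub>R x) x (\<Psi> (t *\<^sub>R x))))
          + A (t *\<^sub>R x) z (\<Psi> (t *\<^sub>R x)))" for t
    have derD: "(D has_vector_derivative D' t) (at t within {0..1})" if t: "t \<in> {0..1}" for t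
    proof -
      have tx: "t *\<^sub>R x \<in> S" using scale[OF t x] sub R by blast
      have "((\<lambda>t. A (t *\<^sub>R x) z e) has_vector_derivative ?A' (t *\<^sub>R x) x z e) (at t within {0..1})" for e
      proof -
        have "((\<lambda>t. A (t *\<^sub>R x) z e) has_derivative (\<lambda>s. ?A' (t *\<^sub>R x) (s *\<^sub>R x) z e)) (at t within {0..1})"
          by (rule has_derivative_compose[where f="\<lambda>t. t *\<^sub>R x" and f'="\<lambda>s. s *\<^sub>R x",
              OF _ smooth_on_has_derivative[OF sm tx]])
            (auto intro!: derivative_eq_intros)
        then show ?thesis
          by (simp add: has_vector_derivative_def linear_cmul[OF smooth_on_linear_ddir[OF sm tx]])
      qed
      note dA = this
      have "((\<lambda>t. \<Sum>c\<in>Basis. (\<Psi> (t *\<^sub>R x) \<bullet> c) *\<^sub>R A (t *\<^sub>R x) z c) has_vector_derivative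
        (\<Sum>c\<in>Basis. (\<Psi> (t *\<^sub>R x) \<bullet> c) *\<^sub>R ?A' (t *\<^sub>R x) x z c
          + (A (t *\<^sub>R x) x (\<Psi> (t *\<^sub>R x)) \<bullet> c) *\<^sub>R A (t *\<^sub>R x) z c)) (at t within {0..1})"
      proof (intro has_vector_derivative_sum has_vector_derivative_scaleR dA)
        fix c show "((\<lambda>t. \<Psi> (t *\<^sub>R x) \<bullet> c) has_real_derivative A (t *\<^sub>R x) x (\<Psi> (t *\<^sub>R x)) \<bullet> c) (at t within {0..1})"
          using bounded_linear.has_vector_derivative[OF bounded_linear_inner_left \<Psi>(3)[OF x t], of c]
          by (simp add: has_real_derivative_iff_has_vector_derivative)
      qed
      moreover have "(\<Sum>c\<in>Basis. (\<Psi> (t *\<^sub>R x) \<bullet> c) *\<^sub>R ?A' (t *\<^sub>R x) x z c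
          + (A (t *\<^sub>R x) x (\<Psi> (t *\<^sub>R x)) \<bullet> c) *\<^sub>R A (t *\<^sub>R x) z c) =
         ?A' (t *\<^sub>R x) x z (\<Psi> (t *\<^sub>R x)) + A (t *\<^sub>R x) z (A (t *\<^sub>R x) x (\<Psi> (t *\<^sub>R x)))"
      proof -
        have "linear (\<lambda>e. ?A' (t *\<^sub>R x) x z e)" "linear (A (t *\<^sub>R x) z)"
          using ddir_bilinear[OF S(1,3) tx] smooth_bilinear_onD(1)[OF S(3) tx] by (auto simp: bilinear_def)
        from linear_basis_expand[OF this(1), of "\<Psi> (t *\<^sub>R x)"]
          linear_basis_expand[OF this(2), of "A (t *\<^sub>R x) x (\<Psi> (t *\<^sub>R x))"]
        show ?thesis by (simp add: sum.distrib)
      qed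
      moreover have "A (s *\<^sub>R x) z (\<Psi> (s *\<^sub>R x)) = (\<Sum>c\<in>Basis. (\<Psi> (s *\<^sub>R x) \<bullet> c) *\<^sub>R A (s *\<^sub>R x) z c)"
        if "s \<in> {0..1}" for s
        using bilR[OF subsetD[OF sub scale[OF that x]]] by (intro linear_basis_expand) (simp add: bilinear_def)
      ultimately have dAP: "((\<lambda>t. A (t *\<^sub>R x) z (\<Psi> (t *\<^sub>R x))) has_vector_derivative
         (?A' (t *\<^sub>R x) x z (\<Psi> (t *\<^sub>R x)) + A (t *\<^sub>R x) z (A (t *\<^sub>R x) x (\<Psi> (t *\<^sub>R x))))) (at t within {0..1})"
        using has_vector_derivative_transform[OF t] by (metis (no_types, lifting))
      have "((\<lambda>t. t *\<^sub>R A (t *\<^sub>R x) z (\<Psi> (t *\<^sub>R x))) has_vector_derivative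
          (t *\<^sub>R (?A' (t *\<^sub>R x) x z (\<Psi> (t *\<^sub>R x)) + A (t *\<^sub>R x) z (A (t *\<^sub>R x) x (\<Psi> (t *\<^sub>R x))))
          + 1 *\<^sub>R A (t *\<^sub>R x) z (\<Psi> (t *\<^sub>R x)))) (at t within {0..1})"
        by (rule has_vector_derivative_scaleR[OF DERIV_ident dAP])
      from has_vector_derivative_diff[OF has_vector_derivative_diff[OF \<Psi>(3)[OF y t] \<Psi>(3)[OF x t]] this]
      show ?thesis unfolding D_def D'_def by simp
    qed
    have D': "norm (D' t) \<le> norm (D t) / 2 + q" if t: "t \<in> {0..1}" for t
    proof -
      define xt yt P where "xt = t *\<^sub>R x" and "yt = t *\<^sub>R y" and "P = \<Psi> xt"
      have in_r: "xt \<in> cball 0 r" "yt \<in> cball 0 r" unfolding xt_def yt_def using scale[OF t] x y by auto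
      then have in_R: "xt \<in> cball 0 R" "yt \<in> cball 0 R" "xt \<in> S" "yt \<in> S" using sub R by blast+
      note bx = smooth_bilinear_onD(1)[OF S(3) in_R(3)] and by' = smooth_bilinear_onD(1)[OF S(3) in_R(4)]
      note simps = bilinear_ladd[OF bx] bilinear_radd[OF bx] bilinear_ladd[OF by'] bilinear_radd[OF by']
         bilinear_lmul[OF bx] bilinear_rmul[OF bx] bilinear_lmul[OF by'] bilinear_rmul[OF by']
         bilinear_rsub[OF bx] bilinear_rsub[OF by']
      note bl = bilinear_ladd[OF ddir_bilinear[OF S(1,3) in_R(3)]]
      have linx: "linear (\<lambda>v. ?A' xt v w e)" for w e by (rule smooth_on_linear_ddir[OF sm in_R(3)])
      have tz: "yt - xt = t *\<^sub>R z" "y = x + z" by (simp_all add: xt_def yt_def z_def scaleR_diff_right)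
      have ntz: "norm (yt - xt) \<le> norm z" unfolding tz using t by (simp add: mult_left_le_one_le)
      define F where "F w e = A yt w e - A xt w e - ?A' xt (yt - xt) w e" for w e
      have F: "norm (F w e) \<le> \<epsilon> * norm z * norm w * norm e" for w e
      proof -
        have "norm (F w e) \<le> \<epsilon> * norm (yt - xt) * norm w * norm e"
          unfolding F_def using d ntz by (intro lin in_r) (simp add: z_def)
        also have "\<dots> \<le> \<epsilon> * norm z * norm w * norm e"
          using ntz \<open>\<epsilon> > 0\<close> by (intro mult_right_mono mult_left_mono) auto
        finally show ?thesis .
      qed
      have P: "norm P \<le> M" unfolding P_def by (rule \<Psi>(2))
      have ny: "norm y \<le> r" using y by simp
      have PsiY: "\<Psi> yt = D t + P + t *\<^sub>R A xt z P"
        unfolding D_def P_def xt_def yt_def by simp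
      define G where "G = A xt z P"
      have G: "norm G \<le> C * norm z * M"
      proof -
        have "norm G \<le> C * norm z * norm P" unfolding G_def by (rule C(2)[OF in_R(1)])
        also have "\<dots> \<le> C * norm z * M" using P C by (intro mult_left_mono) auto
        finally show ?thesis .
      qed
      define H where "H = A yt y G - A xt y G"
      have H: "norm H \<le> L * norm z * r * (C * norm z * M)"
      proof -
        have seg: "norm ((\<lambda>x. A x y G) yt - (\<lambda>x. A x y G) xt) \<le> (L * norm y * norm G) * norm (yt - xt)"
        proof (rule differentiable_bound[where S="cball 0 R" and f'="\<lambda>x v. ?A' x v y G"])
          fix p assume p: "p \<in> cball (0::'a) R"
          then show "((\<lambda>x. A x y G) has_derivative (\<lambda>v. ?A' p v y G)) (at p within cball 0 R)"
            using smooth_on_has_derivative[OF sm, of p] R(2) has_derivative_at_withinI by blast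
          show "onorm (\<lambda>v. ?A' p v y G) \<le> L * norm y * norm G"
          proof (rule onorm_le)
            show "norm (?A' p v y G) \<le> L * norm y * norm G * norm v" for v
              using L(2)[OF p, where v=v and w=y and e=G] by (simp only: mult_ac)
          qed
        qed (use in_R in auto)
        also have "\<dots> \<le> (L * r * (C * norm z * M)) * norm z"
          using seg ny G ntz L r C M by (intro mult_mono mult_nonneg_nonneg) auto
        finally show ?thesis unfolding H_def by (simp add: mult_ac)
      qed
      have split: "D' t = A yt y (D t) + F y P + t *\<^sub>R ?A' xt z z P + t *\<^sub>R H + t *\<^sub>R A xt z G"
      proof -
        \<comment> \<open>Integrability enters here. It exchanges the directions x and z in the term
          that comes from differentiating along the ray, so that this term cancels the linear part
          of A (t y) - A (t x). What is left beside the homogeneous term is of size \<epsilon> |z|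
          or |z|^2.\<close>
        have i: "?A' xt z x P + A xt x G = ?A' xt x z P + A xt z (A xt x P)"
          unfolding G_def by (rule integ[OF in_R(3)])
        have "D' t = A yt y (D t + P + t *\<^sub>R G) - A xt x P - (t *\<^sub>R (?A' xt x z P + A xt z (A xt x P)) + A xt z P)"
          unfolding D'_def PsiY[symmetric, folded G_def] xt_def[symmetric] yt_def[symmetric] P_def[symmetric]
          using PsiY unfolding G_def by simp
        also have "\<dots> = A yt y (D t) + A yt y P + t *\<^sub>R A yt y G - A xt x P - (t *\<^sub>R (?A' xt z x P + A xt x G) + A xt z P)"
          unfolding i by (simp add: simps)
        also have "\<dots> = A yt y (D t) + (A yt y P - A xt y P) - t *\<^sub>R ?A' xt z x P + t *\<^sub>R (A yt y G - A xt x G)"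
          by (simp add: tz(2) simps algebra_simps)
        also have "A yt y P - A xt y P = F y P + t *\<^sub>R ?A' xt z x P + t *\<^sub>R ?A' xt z z P"
          unfolding F_def tz(1) linear_cmul[OF linx] by (simp add: tz(2) bl algebra_simps)
        also have "A yt y G - A xt x G = H + A xt z G"
          unfolding H_def by (simp add: tz(2) simps)
        finally show ?thesis by (simp add: algebra_simps)
      qed
      have b1: "norm (A yt y (D t)) \<le> norm (D t) / 2" by (rule half[OF in_r(2) y])
      have b2: "norm (F y P) \<le> \<epsilon> * norm z * r * M"
      proof -
        have "norm (F y P) \<le> \<epsilon> * norm z * norm y * norm P" by (rule F)
        also have "\<dots> \<le> \<epsilon> * norm z * r * M" using ny P \<open>\<epsilon> > 0\<close> r by (intro mult_mono) auto
        finally show ?thesis .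
      qed
      have tle: "norm (t *\<^sub>R v) \<le> norm v" for v :: 'e using t by (simp add: mult_left_le_one_le)
      have b3: "norm (t *\<^sub>R ?A' xt z z P) \<le> L * norm z * norm z * M"
      proof -
        have "norm (?A' xt z z P) \<le> L * norm z * norm z * norm P" by (rule L(2)[OF in_R(1)])
        also have "\<dots> \<le> L * norm z * norm z * M" using P L by (intro mult_left_mono) auto
        finally show ?thesis using tle order_trans by blast
      qed
      have b4: "norm (t *\<^sub>R H) \<le> L * norm z * r * (C * norm z * M)" using tle H order_trans by blast
      have b5: "norm (t *\<^sub>R A xt z G) \<le> C * norm z * (C * norm z * M)"
      proof -
        have "norm (A xt z G) \<le> C * norm z * norm G" by (rule C(2)[OF in_R(1)])
        also have "\<dots> \<le> C * norm z * (C * norm z * M)" using G C by (intro mult_left_mono) auto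
        finally show ?thesis using tle order_trans by blast
      qed
      have "norm (D' t) \<le> norm (A yt y (D t)) + norm (F y P) + norm (t *\<^sub>R ?A' xt z z P) + norm (t *\<^sub>R H) + norm (t *\<^sub>R A xt z G)"
        unfolding split by (intro norm_triangle_le add_right_mono) simp
      also have "\<dots> \<le> norm (D t) / 2 + (\<epsilon> * norm z * r * M + L * norm z * norm z * M
          + L * norm z * r * (C * norm z * M) + C * norm z * (C * norm z * M))"
        using b1 b2 b3 b4 b5 by linarith
      also have "\<epsilon> * norm z * r * M + L * norm z * norm z * M
          + L * norm z * r * (C * norm z * M) + C * norm z * (C * norm z * M)
          = M * norm z * (r * \<epsilon> + (L + L * r * C + C * C) * norm z)"
        by (simp add: algebra_simps)
      also have "\<dots> \<le> M * norm z * ((r + L + L * r * C + C * C) * (\<epsilon> + norm z))"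
      proof -
        have "0 \<le> (L + L * r * C + C * C) * \<epsilon>" "0 \<le> r * norm z"
          using L C r \<open>\<epsilon> > 0\<close> by simp_all
        then show ?thesis using M by (intro mult_left_mono) (simp_all add: algebra_simps)
      qed
      also have "\<dots> = q" by (simp add: q_def Q_def mult_ac)
      finally show ?thesis by simp
    qed
    \<comment> \<open>In place of Gronwall: D starts at 0, so on the unit interval its largest norm
      m satisfies m <= m / 2 + q, hence m <= 2 q.\<close>
    have "continuous_on {0..1} (\<lambda>t. norm (D t))"
      by (intro continuous_on_norm continuous_on_vector_derivative[OF derD])
    then obtain t0 where t0: "t0 \<in> {0..1}" "\<And>t. t \<in> {0..1} \<Longrightarrow> norm (D t) \<le> norm (D t0)"
      using continuous_attains_sup[of "{0..1::real}" "\<lambda>t. norm (D t)"] by auto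
    have q0: "q \<ge> 0" unfolding q_def using Q \<open>\<epsilon> > 0\<close> by simp
    have "norm (D t0 - D 0) \<le> (norm (D t0) / 2 + q) * norm (t0 - 0)"
    proof (rule differentiable_bound[where S="{0..1}" and f'="\<lambda>t h. h *\<^sub>R D' t"])
      fix t :: real assume t: "t \<in> {0..1}"
      then show "(D has_derivative (\<lambda>h. h *\<^sub>R D' t)) (at t within {0..1})"
        using derD by (simp add: has_vector_derivative_def)
      have "norm (D' t) \<le> norm (D t0) / 2 + q" using D'[OF t] t0(2)[OF t] by linarith
      then show "onorm (\<lambda>h. h *\<^sub>R D' t) \<le> norm (D t0) / 2 + q"
        by (intro onorm_le) (simp add: mult.commute mult_left_mono)
    qed (use t0 in auto)
    also have "\<dots> \<le> norm (D t0) / 2 + q"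
      using t0(1) q0 by (simp add: mult_left_le)
    finally have "norm (D t0) \<le> norm (D t0) / 2 + q" by (simp add: D_def)
    then have "norm (D 1) \<le> 2 * q" using t0(2)[of 1] by simp
    then show ?thesis by (simp add: D_def q_def z_def)
  qed
  show ?thesis
  proof (rule that[of r \<Psi>, OF r(1) _ \<Psi>(1)])
    have KS: "cball (0::'a) r \<subseteq> S" using sub R by blast
    then show "ball 0 r \<subseteq> S" using ball_subset_cball by blast
    fix x :: 'a assume xb: "x \<in> ball 0 r"
    then have x: "x \<in> cball 0 r" by simp
    then have xS: "x \<in> S" using KS by blast
    show "(\<Psi> has_derivative (\<lambda>v. A x v (\<Psi> x))) (at x)"
      unfolding has_derivative_at_alt
    proof (intro conjI allI impI)
      have "linear (\<lambda>v. A x v (\<Psi> x))" using smooth_bilinear_onD(4)[OF S(3) xS] .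
      then show "bounded_linear (\<lambda>v. A x v (\<Psi> x))" by (rule linear_conv_bounded_linear[THEN iffD1])
      fix e :: real assume e: "e > 0"
      \<comment> \<open>With |y - x| < \<epsilon> the bound of \<open>main\<close> is at most 4 Q
        \<epsilon> |y - x|; the 1 added to Q avoids division by zero.\<close>
      define \<epsilon> where "\<epsilon> = e / (4 * (Q + 1))"
      have \<epsilon>: "\<epsilon> > 0" unfolding \<epsilon>_def using e Q by simp
      obtain d where d: "d > 0"
        "\<And>x y w e. x \<in> cball 0 r \<Longrightarrow> y \<in> cball 0 r \<Longrightarrow> norm (y - x) < d \<Longrightarrow>
          norm (A y w e - A x w e - ?A' x (y - x) w e) \<le> \<epsilon> * norm (y - x) * norm w * norm e"
        using bilinear_field_linearization[OF S(1,3) compact_cball convex_cball KS \<epsilon>] by metis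
      show "\<exists>d>0. \<forall>y. norm (y - x) < d \<longrightarrow> norm (\<Psi> y - \<Psi> x - A x (y - x) (\<Psi> x)) \<le> e * norm (y - x)"
      proof (intro exI conjI allI impI)
        show "min d (min \<epsilon> (r - norm x)) > 0" using d \<epsilon> xb by simp
        fix y assume y: "norm (y - x) < min d (min \<epsilon> (r - norm x))"
        have "norm y \<le> norm x + norm (y - x)" by (metis add.commute diff_add_cancel norm_triangle_ineq)
        then have "y \<in> cball 0 r" using y by simp
        have "norm (y - x) < d" using y by simp
        from main[OF x \<open>y \<in> cball 0 r\<close> \<epsilon> this d(2)]
        have "norm (\<Psi> y - \<Psi> x - A x (y - x) (\<Psi> x)) \<le> (2 * Q * (\<epsilon> + norm (y - x))) * norm (y - x)" by (simp add: algebra_simps)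
        also have "\<dots> \<le> (2 * Q * (2 * \<epsilon>)) * norm (y - x)"
          using y Q by (intro mult_right_mono mult_left_mono) auto
        also have "\<dots> \<le> e * norm (y - x)"
          using e Q by (intro mult_right_mono) (auto simp: \<epsilon>_def field_simps)
        finally show "norm (\<Psi> y - \<Psi> x - A x (y - x) (\<Psi> x)) \<le> e * norm (y - x)" .
      qed
    qed
  qed
qed

lemma ddir_translate:
  assumes "smooth_on S f" "x0 + x \<in> S"
  shows "ddir (\<lambda>x. f (x0 + x)) x = ddir f (x0 + x)"
proof -
  have "((\<lambda>x. f (x0 + x)) has_derivative (\<lambda>v. ddir f (x0 + x) v)) (at x)"
    by (rule has_derivative_compose[where f="\<lambda>x. x0 + x" and f'="\<lambda>v. v", OF _ smooth_on_has_derivative[OF assms]])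
      (auto intro!: derivative_eq_intros)
  then show ?thesis by (rule ddir_eqI)
qed

text \<open>\<open>integ\<close> is the equality of mixed second derivatives of a prospective
  solution, demanded for every value \<open>e\<close> and not only along one solution. The base
  point is moved to the origin by translation.\<close>

theorem frobenius_linear:
  fixes A :: "'a::euclidean_space \<Rightarrow> 'a \<Rightarrow> 'e::euclidean_space \<Rightarrow> 'e"
  assumes S: "open S" "x0 \<in> S" "smooth_bilinear_on S A"
    and integ: "\<And>x u v e. x \<in> S \<Longrightarrow>
      ddir (\<lambda>x. A x u e) x v + A x u (A x v e) = ddir (\<lambda>x. A x v e) x u + A x v (A x u e)"
  obtains r \<Psi> where "r > 0" "ball x0 r \<subseteq> S" "\<Psi> x0 = e0" "smooth_on (ball x0 r) \<Psi>"
    "\<And>x. x \<in> ball x0 r \<Longrightarrow> (\<Psi> has_derivative (\<lambda>v. A x v (\<Psi> x))) (at x)"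
proof -
  define S' where "S' = (\<lambda>x. x - x0) ` S"
  have S': "x \<in> S' \<longleftrightarrow> x0 + x \<in> S" for x unfolding S'_def by (auto simp: image_iff algebra_simps)
  have oS': "open S'" unfolding S'_def using open_translation[OF S(1), of "- x0"] by simp
  have sm: "smooth_on S (\<lambda>x. A x u e)" for u e using smooth_bilinear_onD(2)[OF S(3)] .
  have sb: "smooth_bilinear_on S' (\<lambda>x. A (x0 + x))"
    unfolding smooth_bilinear_on_def
  proof (intro conjI ballI allI)
    show "bilinear (A (x0 + x))" if "x \<in> S'" for x using smooth_bilinear_onD(1)[OF S(3)] that S' by blast
    show "smooth_on S' (\<lambda>x. A (x0 + x) u v)" for u v
      using S' by (intro smooth_on_compose[OF oS' S(1) _ sm] smooth_on_add smooth_on_const smooth_on_id oS') auto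
  qed
  obtain r \<Psi> where *: "r > 0" "ball 0 r \<subseteq> S'" "\<Psi> 0 = e0"
    "\<And>x. x \<in> ball 0 r \<Longrightarrow> (\<Psi> has_derivative (\<lambda>v. A (x0 + x) v (\<Psi> x))) (at x)"
  proof (rule frobenius_origin[OF oS' _ sb])
    show "0 \<in> S'" using S S' by simp
    show "ddir (\<lambda>x. A (x0 + x) u e) x v + A (x0 + x) u (A (x0 + x) v e) =
       ddir (\<lambda>x. A (x0 + x) v e) x u + A (x0 + x) v (A (x0 + x) u e)" if "x \<in> S'" for x u v e
      using integ[of "x0 + x" u e v] that S' by (simp add: ddir_translate[OF sm])
  qed blast
  define \<Phi> where "\<Phi> x = \<Psi> (x - x0)" for x
  have sub: "ball x0 r \<subseteq> S"
  proof
    fix x assume "x \<in> ball x0 r"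
    then have "x - x0 \<in> ball 0 r" by (simp add: dist_norm norm_minus_commute)
    then have "x0 + (x - x0) \<in> S" using *(2) S' by blast
    then show "x \<in> S" by simp
  qed
  have der: "(\<Phi> has_derivative (\<lambda>v. A x v (\<Phi> x))) (at x)" if "x \<in> ball x0 r" for x
  proof -
    have "x - x0 \<in> ball 0 r" using that by (simp add: dist_norm norm_minus_commute)
    from *(4)[OF this] have "(\<Psi> has_derivative (\<lambda>v. A x v (\<Psi> (x - x0)))) (at (x - x0))" by simp
    then show ?thesis unfolding \<Phi>_def
      by (rule has_derivative_compose[where f="\<lambda>x. x - x0" and f'="\<lambda>v. v", rotated])
        (auto intro!: derivative_eq_intros)
  qed
  \<comment> \<open>Bootstrapping: the equation expresses the derivative of \<Phi> by \<Phi> itself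
    with smooth coefficients, so each order of smoothness gives the next.\<close>
  have "ck_on k (ball x0 r) \<Phi>" for k
  proof (induction k)
    case 0
    have "\<Phi> differentiable (at x)" if "x \<in> ball x0 r" for x using der[OF that] differentiable_def by blast
    then show ?case
      by (simp add: continuous_at_imp_continuous_on differentiable_imp_continuous_within)
  next
    case (Suc k)
    show ?case
    proof (rule ck_on_SucI[OF open_ball der])
      fix v
      have "ck_on k (ball x0 r) (\<lambda>x. \<Sum>b\<in>Basis. (\<Phi> x \<bullet> b) *\<^sub>R A x v b)"
      proof (intro ck_on_sum ck_on_bilinear[OF bounded_bilinear_scaleR] open_ball
          ck_on_linear[OF bounded_linear_inner_left] Suc.IH)
        show "ck_on k (ball x0 r) (\<lambda>x. A x v b)" for b
          using smooth_on_subset[OF sm sub] by (simp add: smooth_on_def)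
      qed
      then show "ck_on k (ball x0 r) (\<lambda>x. A x v (\<Phi> x))"
      proof (rule ck_on_cong[OF open_ball, rotated])
        fix x assume "x \<in> ball x0 r"
        then have "linear (A x v)" using smooth_bilinear_onD(3)[OF S(3)] sub by blast
        then show "(\<Sum>b\<in>Basis. (\<Phi> x \<bullet> b) *\<^sub>R A x v b) = A x v (\<Phi> x)"
          by (rule linear_basis_expand[symmetric])
      qed
    qed
  qed
  then have "smooth_on (ball x0 r) \<Phi>" by (simp add: smooth_on_def)
  moreover have "\<Phi> x0 = e0" using *(3) by (simp add: \<Phi>_def)
  ultimately show ?thesis using that[OF *(1) sub] der by blast
qed

section \<open>Cutoff functions, curvature and determinants in coordinates\<close>

text \<open>With these powers of 1/t included, the derivatives of exp (-1/t) stay in the family.\<close>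

definition flat_exp :: "nat \<Rightarrow> real \<Rightarrow> real" where
  "flat_exp n t = (if t > 0 then (1 / t) ^ n * exp (- (1 / t)) else 0)"

text \<open>From s / m <= exp (s / m), raised to the power m.\<close>

lemma power_exp_bound:
  assumes "s \<ge> (0::real)" shows "s ^ m * exp (- s) \<le> real m ^ m"
proof (cases "m = 0")
  case False
  have "s / real m \<le> exp (s / real m)" using exp_ge_add_one_self[of "s / real m"] by linarith
  then have "(s / real m) ^ m \<le> exp (s / real m) ^ m" using assms by (intro power_mono) auto
  also have "\<dots> = exp s" using False by (simp add: exp_divide_power_eq)
  finally show ?thesis using False by (simp add: power_divide exp_minus field_simps)
qed (use assms in simp)

text \<open>The exponent n + 2 in the previous bound leaves a factor t^2, which forces the
  derivative at 0 to vanish.\<close>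

lemma flat_exp_bound: "\<bar>flat_exp n t\<bar> \<le> real (n + 2) ^ (n + 2) * t\<^sup>2"
proof (cases "t > 0")
  case True
  have "(1 / t) ^ (n + 2) * exp (- (1 / t)) \<le> real (n + 2) ^ (n + 2)"
    using True by (intro power_exp_bound) simp
  then have "(1 / t) ^ (n + 2) * exp (- (1 / t)) * t\<^sup>2 \<le> real (n + 2) ^ (n + 2) * t\<^sup>2"
    by (rule mult_right_mono) simp
  moreover have "(1 / t) ^ (n + 2) * exp (- (1 / t)) * t\<^sup>2 = flat_exp n t"
    using True by (simp add: flat_exp_def power_add power_divide power2_eq_square field_simps)
  moreover have "flat_exp n t \<ge> 0" using True by (simp add: flat_exp_def)
  ultimately show ?thesis by simp
qed (simp add: flat_exp_def)

lemma flat_exp_deriv: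
  "(flat_exp n has_real_derivative flat_exp (n + 2) t - real n * flat_exp (n + 1) t) (at t)"
proof -
  consider "t > 0" | "t < 0" | "t = 0" by linarith
  then show ?thesis
  proof cases
    case 1
    have d: "((\<lambda>t. (1 / t) ^ n * exp (- (1 / t))) has_real_derivative
        flat_exp (n + 2) t - real n * flat_exp (n + 1) t) (at t)"
    proof -
      have e: "((\<lambda>t. exp (- (1 / t))) has_real_derivative exp (- (1 / t)) * (1 / t) ^ 2) (at t)"
        using 1 by (auto intro!: derivative_eq_intros simp: power2_eq_square)
      have p: "((\<lambda>t. (1 / t) ^ n) has_real_derivative - (real n * (1 / t) ^ (n + 1))) (at t)"
      proof (cases n)
        case (Suc m)
        have "((\<lambda>t. 1 / t) has_real_derivative - (1 / t)\<^sup>2) (at t)"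
          using 1 by (auto intro!: derivative_eq_intros simp: power2_eq_square)
        from DERIV_power[OF this, of "Suc m"] show ?thesis
          by (simp add: Suc power2_eq_square mult_ac)
      qed simp
      from DERIV_mult[OF p e] show ?thesis
        using 1 by (simp add: flat_exp_def algebra_simps power_add power2_eq_square)
    qed
    show ?thesis
      by (rule has_field_derivative_transform_within_open[OF d, of "{0<..}"])
        (use 1 in \<open>auto simp: flat_exp_def\<close>)
  next
    case 2
    have "((\<lambda>t. 0) has_real_derivative flat_exp (n + 2) t - real n * flat_exp (n + 1) t) (at t)"
      using 2 by (simp add: flat_exp_def)
    then show ?thesis
      by (rule has_field_derivative_transform_within_open[of _ _ _ "{..<0}"])
        (use 2 in \<open>auto simp: flat_exp_def\<close>)
  next
    case 3
    define C where "C = real (n + 2) ^ (n + 2)"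
    have C: "C > 0" unfolding C_def by (rule zero_less_power) simp
    have "(flat_exp n has_derivative (\<lambda>h. 0)) (at 0)"
      unfolding has_derivative_at_alt
    proof (intro conjI allI impI)
      fix e :: real assume e: "e > 0"
      \<comment> \<open>Within distance e / C of 0, the quadratic bound C y^2 is at most e
        |y|.\<close>
      show "\<exists>d>0. \<forall>y. norm (y - 0) < d \<longrightarrow> norm (flat_exp n y - flat_exp n 0 - 0) \<le> e * norm (y - 0)"
      proof (intro exI[of _ "e / C"] conjI allI impI)
        fix y :: real assume y: "norm (y - 0) < e / C"
        have "\<bar>flat_exp n y\<bar> \<le> (C * \<bar>y\<bar>) * \<bar>y\<bar>"
          using flat_exp_bound[of n y] by (simp add: C_def power2_eq_square mult.assoc)
        also have "\<dots> \<le> e * \<bar>y\<bar>" using y C by (intro mult_right_mono) (auto simp: field_simps)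
        finally show "norm (flat_exp n y - flat_exp n 0 - 0) \<le> e * norm (y - 0)"
          by (simp add: flat_exp_def)
      qed (use e C in simp)
    qed simp
    moreover have "(*) 0 = (\<lambda>h::real. 0::real)" by auto
    ultimately show ?thesis using 3 by (simp add: has_field_derivative_def flat_exp_def)
  qed
qed

lemma flat_exp_smooth: "smooth_on UNIV (flat_exp n)"
proof -
  have "ck_on k UNIV (flat_exp n)" for k n
  proof (induction k arbitrary: n)
    case 0
    show ?case using DERIV_isCont[OF flat_exp_deriv[of n]] by (simp add: continuous_at_imp_continuous_on)
  next
    case (Suc k)
    show ?case
    proof (rule ck_on_SucI[OF open_UNIV])
      show "(flat_exp n has_derivative (\<lambda>v. flat_exp (n + 2) t * v + (- real n * v) * flat_exp (n + 1) t)) (at t)" for t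
        by (rule has_derivative_eq_rhs[OF flat_exp_deriv[unfolded has_field_derivative_def]])
          (simp add: fun_eq_iff algebra_simps)
      show "ck_on k UNIV (\<lambda>t. flat_exp (n + 2) t * v + (- real n * v) * flat_exp (n + 1) t)" for v
        by (intro ck_on_add ck_on_bilinear[OF bounded_bilinear_mult] ck_on_const open_UNIV Suc.IH)
    qed
  qed
  then show ?thesis by (simp add: smooth_on_def)
qed

lemma bump_exists:
  fixes x0 :: "'b::euclidean_space"
  assumes r: "r > 0"
  obtains h :: "'b \<Rightarrow> real" where "smooth_on UNIV h"
    "\<And>x. x \<in> ball x0 (r / 2) \<Longrightarrow> h x = 1" "\<And>x. x \<notin> ball x0 r \<Longrightarrow> h x = 0"
proof -
  let ?f = "flat_exp 0" and ?s = "\<lambda>x. (x - x0) \<bullet> (x - x0)"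
  have f: "?f t > 0 \<longleftrightarrow> t > 0" "?f t \<ge> 0" "t \<le> 0 \<Longrightarrow> ?f t = 0" for t by (auto simp: flat_exp_def)
  \<comment> \<open>The usual quotient for a plateau function. Its denominator is positive because
    r^2 - s and s - (r/2)^2 are never both nonpositive; the second summand vanishes on the inner
    ball, the numerator outside the outer one.\<close>
  define h where "h x = ?f (r\<^sup>2 - ?s x) * inverse (?f (r\<^sup>2 - ?s x) + ?f (?s x - (r / 2)\<^sup>2))" for x
  have s: "smooth_on UNIV ?s"
    by (intro smooth_on_inner smooth_on_diff smooth_on_id smooth_on_const open_UNIV)
  have 1: "smooth_on UNIV (\<lambda>x. ?f (r\<^sup>2 - ?s x))" "smooth_on UNIV (\<lambda>x. ?f (?s x - (r / 2)\<^sup>2))"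
    by (intro smooth_on_compose[OF _ _ _ flat_exp_smooth] smooth_on_diff smooth_on_const s open_UNIV subset_UNIV)+
  have "(r / 2)\<^sup>2 < r\<^sup>2" using r by (intro power_strict_mono) auto
  then have ne: "?f (r\<^sup>2 - ?s x) + ?f (?s x - (r / 2)\<^sup>2) \<noteq> 0" for x
    using f(1,2)[of "r\<^sup>2 - ?s x"] f(1,2)[of "?s x - (r / 2)\<^sup>2"]
    by (cases "?s x < r\<^sup>2") (auto simp: add_nonneg_eq_0_iff)
  show ?thesis
  proof (rule that[of h])
    show "smooth_on UNIV h" unfolding h_def
      by (intro smooth_on_mult smooth_on_inverse smooth_on_add 1 ne open_UNIV)
    have n: "?s x = (norm (x - x0))\<^sup>2" for x by (simp add: power2_norm_eq_inner)
    fix x :: 'b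
    show "h x = 1" if "x \<in> ball x0 (r / 2)"
    proof -
      have "norm (x - x0) < r / 2" using that by (simp add: dist_norm norm_minus_commute)
      then have "?s x \<le> (r / 2)\<^sup>2" unfolding n by (intro power_mono) auto
      then have "?f (?s x - (r / 2)\<^sup>2) = 0" by (intro f(3)) simp
      then show ?thesis using ne[of x] by (simp add: h_def)
    qed
    show "h x = 0" if "x \<notin> ball x0 r"
    proof -
      have "r \<le> norm (x - x0)" using that by (simp add: dist_norm norm_minus_commute)
      then have "r\<^sup>2 \<le> ?s x" unfolding n using r by (intro power_mono) auto
      then show ?thesis using f(3)[of "r\<^sup>2 - ?s x"] by (simp add: h_def)
    qed
  qed
qed

section \<open>Curvature in coordinates and its behaviour under projective change\<close>

text \<open>Curvature evaluated on constant coordinate fields; these commute, hence the absence of a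
  bracket term.\<close>

definition riem :: "('a::euclidean_space \<Rightarrow> 'a \<Rightarrow> 'a \<Rightarrow> 'a) \<Rightarrow> 'a \<Rightarrow> 'a \<Rightarrow> 'a \<Rightarrow> 'a \<Rightarrow> 'a" where
  "riem \<Gamma> x u v w = ddir (\<lambda>y. \<Gamma> y v w) x u - ddir (\<lambda>y. \<Gamma> y u w) x v + \<Gamma> x u (\<Gamma> x v w) - \<Gamma> x v (\<Gamma> x u w)"

text \<open>\<open>P = \<nabla>\<rho> - \<rho> \<otimes> \<rho>\<close>. The connection \<open>\<nabla> + \<rho> \<otimes> id + id \<otimes> \<rho>\<close> is flat iff
  \<open>R(u, v)w = P(v, w)u - P(u, w)v\<close>.\<close>

definition proj_tensor :: "('a::euclidean_space \<Rightarrow> 'a \<Rightarrow> 'a \<Rightarrow> 'a) \<Rightarrow> ('a \<Rightarrow> 'a \<Rightarrow> real) \<Rightarrow> 'a \<Rightarrow> 'a \<Rightarrow> 'a \<Rightarrow> real" where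
  "proj_tensor \<Gamma> \<rho> x u w = ddir (\<lambda>y. \<rho> y w) x u - \<rho> x (\<Gamma> x u w) - \<rho> x u * \<rho> x w"

text \<open>Closedness of \<rho> kills the term d\<rho>(u, v) w, and symmetry of \<Gamma> kills the
  term in \<rho>(w). The remaining new terms assemble into P.\<close>

lemma riem_projective:
  fixes \<Gamma> :: "'a::euclidean_space \<Rightarrow> 'a \<Rightarrow> 'a \<Rightarrow> 'a"
  assumes S: "open S" "x \<in> S" and G: "smooth_bilinear_on S \<Gamma>" "\<And>u v. \<Gamma> x u v = \<Gamma> x v u"
    and \<rho>: "smooth_linear_on S \<rho>" "\<And>u v. ddir (\<lambda>y. \<rho> y v) x u = ddir (\<lambda>y. \<rho> y u) x v"
    and G': "\<And>y u v. y \<in> S \<Longrightarrow> \<Gamma>' y u v = \<Gamma> y u v + \<rho> y u *\<^sub>R v + \<rho> y v *\<^sub>R u"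
  shows "riem \<Gamma>' x u v w = riem \<Gamma> x u v w + proj_tensor \<Gamma> \<rho> x u w *\<^sub>R v - proj_tensor \<Gamma> \<rho> x v w *\<^sub>R u"
proof -
  have d: "ddir (\<lambda>y. \<Gamma>' y v w) x u = ddir (\<lambda>y. \<Gamma> y v w) x u + ddir (\<lambda>y. \<rho> y v) x u *\<^sub>R w + ddir (\<lambda>y. \<rho> y w) x u *\<^sub>R v"
    for u v w
  proof -
    have "((\<lambda>y. \<Gamma> y v w + \<rho> y v *\<^sub>R w + \<rho> y w *\<^sub>R v) has_derivative
       (\<lambda>u. ddir (\<lambda>y. \<Gamma> y v w) x u + ddir (\<lambda>y. \<rho> y v) x u *\<^sub>R w + ddir (\<lambda>y. \<rho> y w) x u *\<^sub>R v)) (at x)"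
      by (intro has_derivative_add has_derivative_scaleR_left
          smooth_on_has_derivative[OF smooth_bilinear_onD(2)[OF G(1)] S(2)]
          smooth_on_has_derivative[OF smooth_linear_onD(2)[OF \<rho>(1)] S(2)])
    then have "((\<lambda>y. \<Gamma>' y v w) has_derivative
       (\<lambda>u. ddir (\<lambda>y. \<Gamma> y v w) x u + ddir (\<lambda>y. \<rho> y v) x u *\<^sub>R w + ddir (\<lambda>y. \<rho> y w) x u *\<^sub>R v)) (at x)"
      by (rule has_derivative_transform_within_open[OF _ S]) (simp add: G')
    then show ?thesis by (simp add: ddir_eqI)
  qed
  note b = smooth_bilinear_onD(1)[OF G(1) S(2)] and l = smooth_linear_onD(1)[OF \<rho>(1) S(2)]
  have A: "\<Gamma>' x u (\<Gamma>' x v w) = \<Gamma> x u (\<Gamma> x v w) + \<rho> x v *\<^sub>R \<Gamma> x u w + \<rho> x w *\<^sub>R \<Gamma> x u v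
      + \<rho> x u *\<^sub>R \<Gamma> x v w + (\<rho> x u * \<rho> x v) *\<^sub>R w + (\<rho> x u * \<rho> x w) *\<^sub>R v
      + (\<rho> x (\<Gamma> x v w) + \<rho> x v * \<rho> x w + \<rho> x v * \<rho> x w) *\<^sub>R u" for u v w
    unfolding G'[OF S(2)]
    by (simp add: bilinear_radd[OF b] bilinear_rmul[OF b] linear_add[OF l] linear_cmul[OF l]
        scaleR_add_right scaleR_add_left mult.commute)
  have two: "(2 * a) *\<^sub>R z = a *\<^sub>R z + a *\<^sub>R z" for a and z :: 'a
    by (simp only: mult_2 scaleR_add_left)
  show ?thesis
    unfolding riem_def d proj_tensor_def A \<rho>(2)[of u v] G(2)[of v u]
    by (simp add: scaleR_add_left scaleR_diff_left mult.commute[of "\<rho> x v" "\<rho> x u"] two)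
qed

text \<open>If d v were nonzero, every u would be a multiple of v. This serves three times: for
  d\<lambda>, for the difference of P and \<lambda> g, and for the uniqueness of the curvature value
  at a point.\<close>

lemma proportional_zero:
  fixes d :: "'a::euclidean_space \<Rightarrow> real"
  assumes "DIM('a) \<ge> 2" "\<And>u v. d v *\<^sub>R u = d u *\<^sub>R v"
  shows "d v = 0"
proof (rule ccontr)
  assume nz: "d v \<noteq> 0"
  have "u \<in> span {v}" for u
  proof -
    have "u = (d u / d v) *\<^sub>R v" using assms(2)[of v u] nz
      by (metis divide_inverse_commute divideR_right scaleR_scaleR)
    then show ?thesis by (metis span_mul span_base singletonI)
  qed
  then have "span {v} = UNIV" by auto
  then have "DIM('a) \<le> 1" using dim_le_card[of "{v}" "{v}"] by (metis card.empty card_insert_disjoint dim_UNIV dim_span empty_iff finite.emptyI finite_insert One_nat_def span_superset)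
  with assms(1) show False by simp
qed

text \<open>Differentiating \<open>\<nabla>\<rho> = \<rho> \<otimes> \<rho> + \<lambda> g\<close> once more and skew-symmetrizing leaves only \<open>d\<lambda>\<close>.\<close>

lemma schur:
  fixes \<Gamma> :: "'a::euclidean_space \<Rightarrow> 'a \<Rightarrow> 'a \<Rightarrow> 'a"
  assumes S: "open S" "x \<in> S" and \<Gamma>: "smooth_bilinear_on S \<Gamma>" "\<And>u v. \<Gamma> x u v = \<Gamma> x v u"
    and G: "smooth_bilinear_on S G" "\<And>v. (\<forall>w. G x v w = 0) \<Longrightarrow> v = 0"
      "\<And>u v. G x u v = G x v u"
    and cod: "\<And>u v w. ddir (\<lambda>y. G y u w) x v - G x u (\<Gamma> x v w) = ddir (\<lambda>y. G y v w) x u - G x v (\<Gamma> x u w)"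
    and \<rho>: "smooth_linear_on S \<rho>" "\<And>u v. ddir (\<lambda>y. \<rho> y v) x u = ddir (\<lambda>y. \<rho> y u) x v"
    and P: "\<And>y u w. y \<in> S \<Longrightarrow> proj_tensor \<Gamma> \<rho> y u w = l y * G y u w"
    and R: "\<And>u v w. riem \<Gamma> x u v w = l x *\<^sub>R (G x v w *\<^sub>R u - G x u w *\<^sub>R v)"
    and l: "l differentiable (at x)" and dim: "DIM('a) \<ge> 2"
  shows "ddir l x v = 0"
proof (rule proportional_zero[OF dim])
  fix u v
  have dl: "(l has_derivative ddir l x) (at x)" using l frechet_derivative_works by blast
  have dG: "((\<lambda>y. G y u w) has_derivative ddir (\<lambda>y. G y u w) x) (at x)" for u w
    by (rule smooth_on_has_derivative[OF smooth_bilinear_onD(2)[OF G(1)] S(2)])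
  have d\<Gamma>: "((\<lambda>y. \<Gamma> y u w) has_derivative ddir (\<lambda>y. \<Gamma> y u w) x) (at x)" for u w
    by (rule smooth_on_has_derivative[OF smooth_bilinear_onD(2)[OF \<Gamma>(1)] S(2)])
  have d\<rho>: "((\<lambda>y. \<rho> y w) has_derivative ddir (\<lambda>y. \<rho> y w) x) (at x)" for w
    by (rule smooth_on_has_derivative[OF smooth_linear_onD(2)[OF \<rho>(1)] S(2)])
  have e1: "ddir (\<lambda>y. \<rho> y w) y u = \<rho> y (\<Gamma> y u w) + \<rho> y u * \<rho> y w + l y * G y u w" if "y \<in> S" for y u w
    using P[OF that, of u w] by (simp add: proj_tensor_def)
  have e2: "ddir (\<lambda>y. ddir (\<lambda>y. \<rho> y w) y u) x v =
     ddir (\<lambda>y. \<rho> y (\<Gamma> x u w)) x v + \<rho> x (ddir (\<lambda>y. \<Gamma> y u w) x v)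
      + (ddir (\<lambda>y. \<rho> y u) x v * \<rho> x w + \<rho> x u * ddir (\<lambda>y. \<rho> y w) x v)
      + (ddir l x v * G x u w + l x * ddir (\<lambda>y. G y u w) x v)" for u v w
  proof -
    have "((\<lambda>y. \<rho> y (\<Gamma> y u w) + \<rho> y u * \<rho> y w + l y * G y u w) has_derivative
      (\<lambda>v. ddir (\<lambda>y. \<rho> y (\<Gamma> x u w)) x v + \<rho> x (ddir (\<lambda>y. \<Gamma> y u w) x v)
        + (\<rho> x u * ddir (\<lambda>y. \<rho> y w) x v + ddir (\<lambda>y. \<rho> y u) x v * \<rho> x w)
        + (l x * ddir (\<lambda>y. G y u w) x v + ddir l x v * G x u w))) (at x)"
      by (intro has_derivative_add has_derivative_mult d\<rho> dl dG
          smooth_linear_on_has_derivative[OF S(1) \<rho>(1) S(2) d\<Gamma>])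
    from ddir_eqI[OF this] ddir_cong[OF S, of "\<lambda>y. ddir (\<lambda>y. \<rho> y w) y u"] e1
    show ?thesis by (simp add: add_ac)
  qed
  \<comment> \<open>The Ricci identity for \<rho>: symmetry of its second derivatives
    (\<open>E\<close>), \<rho> applied to the curvature (\<open>F\<close>), and \<lambda> times the
    Codazzi equation (\<open>C\<close>). The curvature contribution cancels the products of \<rho>
    with \<lambda> g that come from differentiating \<rho> \<otimes> \<rho>.\<close>
  have key: "ddir l x v * G x u w = ddir l x u * G x v w" for w
  proof -
    have "ddir (\<lambda>y. ddir (\<lambda>y. \<rho> y w) y u) x v = ddir (\<lambda>y. ddir (\<lambda>y. \<rho> y w) y v) x u"
      by (rule ddir_commute[OF S smooth_linear_onD(2)[OF \<rho>(1)]])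
    note E = this[unfolded e2 e1[OF S(2)]]
    have "\<rho> x (riem \<Gamma> x v u w) = l x * (G x u w * \<rho> x v - G x v w * \<rho> x u)"
      using smooth_linear_onD(1)[OF \<rho>(1) S(2)]
      by (simp add: R linear_diff linear_cmul)
    then have F: "\<rho> x (ddir (\<lambda>y. \<Gamma> y u w) x v) - \<rho> x (ddir (\<lambda>y. \<Gamma> y v w) x u) + \<rho> x (\<Gamma> x v (\<Gamma> x u w)) - \<rho> x (\<Gamma> x u (\<Gamma> x v w))
        = l x * (G x u w * \<rho> x v - G x v w * \<rho> x u)"
      using smooth_linear_onD(1)[OF \<rho>(1) S(2)]
      by (simp add: riem_def linear_diff linear_add)
    have C: "l x * (ddir (\<lambda>y. G y u w) x v - G x u (\<Gamma> x v w)) = l x * (ddir (\<lambda>y. G y v w) x u - G x v (\<Gamma> x u w))"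
      by (simp only: cod[of u w v])
    show ?thesis using E F C by (simp add: \<Gamma>(2)[of v u] G(3)[of v u] algebra_simps)
  qed
  have "G x (ddir l x v *\<^sub>R u - ddir l x u *\<^sub>R v) w = 0" for w
    using key[of w] smooth_bilinear_onD(1)[OF G(1) S(2)] by (simp add: bilinear_lsub bilinear_lmul)
  from G(2)[OF allI[OF this]] show "ddir l x v *\<^sub>R u = ddir l x u *\<^sub>R v" by simp
qed

section \<open>Traces and determinants\<close>

lemma trace_matrix: "trace (matrix f) = (\<Sum>i\<in>UNIV. f (axis i 1) $ i)"
  by (simp add: trace_def matrix_def)

lemma trace_matrix_compose:
  fixes f g :: "real ^ 'n \<Rightarrow> real ^ 'n"
  assumes "linear f" "linear g"
  shows "trace (matrix (\<lambda>v. f (g v))) = trace (matrix (\<lambda>v. g (f v)))"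
  using matrix_compose[OF assms(2,1)] matrix_compose[OF assms] trace_mul_sym[of "matrix f" "matrix g"]
  by (simp add: o_def)

lemma trace_matrix_rank_one:
  assumes "linear f" shows "trace (matrix (\<lambda>v. f v *\<^sub>R y)) = f (y :: real ^ 'n)"
proof -
  have "f y = (\<Sum>i\<in>UNIV. y $ i * f (axis i 1))"
    by (subst basis_expansion[symmetric]) (simp add: linear_sum[OF assms] scalar_mult_eq_scaleR linear_cmul[OF assms])
  then show ?thesis by (simp add: trace_matrix mult.commute)
qed

lemma trace_matrix_linear:
  "trace (matrix (\<lambda>v. f v - h v)) = trace (matrix f) - trace (matrix h)"
  "trace (matrix (\<lambda>v. f v + h v)) = trace (matrix f) + trace (matrix h)"
  "trace (matrix (\<lambda>v. c *\<^sub>R f v)) = c * trace (matrix f)"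
  "trace (matrix (\<lambda>v::real^'n. v)) = real CARD('n)"
  for f h :: "real ^ 'n \<Rightarrow> real ^ 'n"
  by (simp_all add: trace_matrix sum_subtractf sum.distrib sum_distrib_left)

text \<open>With Q the endomorphism g^{-1} P, duality forces
  \<open>R' u v z = g v z *\<^sub>R Q u - g u z *\<^sub>R Q v\<close>. Its trace in u contains the
  same -P as the trace of \<open>R\<close>, and after cancellation n P = (tr Q) g remains.\<close>

lemma ricci_symmetric_proportional:
  fixes g P :: "real ^ 'n \<Rightarrow> real ^ 'n \<Rightarrow> real"
  assumes g: "bilinear g" "\<And>u v. g u v = g v u" "\<And>v. (\<forall>w. g v w = 0) \<Longrightarrow> v = 0"
    and P: "bilinear P" "\<And>u v. P u v = P v u"
    and R: "\<And>u v w. R u v w = P v w *\<^sub>R u - P u w *\<^sub>R v"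
    and R': "\<And>u v w z. g (R u v w) z = - g w (R' u v z)"
    and Ric: "\<And>y z. trace (matrix (\<lambda>v. R v y z)) = trace (matrix (\<lambda>v. R' v y z))"
  shows "\<exists>l. \<forall>u v. P u v = l * g u v"
proof -
  \<comment> \<open>\<open>J\<close> lowers an index, with covectors stored as vectors of
    components. Nondegeneracy makes it injective, hence surjective, so the covector P x has a
    preimage \<open>Q x\<close>.\<close>
  define J where "J v = (\<chi> i. g v (axis i 1))" for v
  have gl: "linear (\<lambda>u. g u v)" "linear (g u)" and Pl: "linear (\<lambda>u. P u v)" "linear (P u)" for u v
    using g(1) P(1) by (auto simp: bilinear_def)
  have Jl: "linear J" unfolding J_def linear_iff
    by (simp add: vec_eq_iff linear_add[OF gl(1)] linear_cmul[OF gl(1)])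
  have gJ: "g v w = J v \<bullet> w" for v w
    by (subst basis_expansion[of w, symmetric])
      (simp add: linear_sum[OF gl(2)] scalar_mult_eq_scaleR linear_cmul[OF gl(2)] inner_vec_def J_def mult.commute
        inner_sum_right)
  have "inj J"
  proof (rule linear_injective_0[THEN iffD2, OF Jl], safe)
    fix v assume "J v = 0" then show "v = 0" using g(3) by (simp add: gJ)
  qed
  then have "surj J" using linear_inj_imp_surj[OF Jl] by blast
  define Q where "Q x = inv J (\<chi> i. P x (axis i 1))" for x
  have JQ: "J (Q x) = (\<chi> i. P x (axis i 1))" for x
    unfolding Q_def using \<open>surj J\<close> by (simp add: surj_f_inv_f)
  have gQ: "g (Q x) z = P x z" for x z
    unfolding gJ JQ
    by (subst (2) basis_expansion[of z, symmetric])
      (simp add: linear_sum[OF Pl(2)] scalar_mult_eq_scaleR linear_cmul[OF Pl(2)] inner_vec_def mult.commute)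
  have R'Q: "R' u v z = g v z *\<^sub>R Q u - g u z *\<^sub>R Q v" for u v z
  proof -
    have "g (R' u v z - (g v z *\<^sub>R Q u - g u z *\<^sub>R Q v)) w = 0" for w
    proof -
      have "g (R' u v z) w = - (P v w * g u z - P u w * g v z)"
        using R'[of u v w z] unfolding R
        by (simp add: g(2)[of w] linear_diff[OF gl(1)] linear_cmul[OF gl(1)])
      then show ?thesis
        by (simp add: linear_diff[OF gl(1)] linear_cmul[OF gl(1)] gQ)
    qed
    from g(3)[OF allI[OF this]] show ?thesis by simp
  qed
  have "real CARD('n) * P y z = g y z * trace (matrix Q)" for y z
  proof -
    have "trace (matrix (\<lambda>v. P y z *\<^sub>R v - P v z *\<^sub>R y)) = trace (matrix (\<lambda>v. g y z *\<^sub>R Q v - g v z *\<^sub>R Q y))"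
      using Ric[of y z] unfolding R R'Q .
    then show ?thesis
      unfolding trace_matrix_linear trace_matrix_rank_one[OF Pl(1)] trace_matrix_rank_one[OF gl(1)]
      by (simp add: gQ mult.commute)
  qed
  note nP = this
  have "P y z = trace (matrix Q) / real CARD('n) * g y z" for y z
  proof -
    have "P y z = real CARD('n) * P y z / real CARD('n)" by simp
    also have "\<dots> = g y z * trace (matrix Q) / real CARD('n)" by (simp only: nP)
    finally show ?thesis by simp
  qed
  then show ?thesis by blast
qed

text \<open>Product rule in the Leibniz formula; regrouping by the differentiated factor replaces
  one row at a time.\<close>

lemma det_has_derivative:
  fixes Y :: "'n::finite \<Rightarrow> 'a::real_normed_vector \<Rightarrow> real ^ 'n"
  assumes "\<And>i. (Y i has_derivative Y' i) (at x)"
  shows "((\<lambda>x. det (\<chi> i. Y i x)) has_derivative (\<lambda>h. \<Sum>j\<in>UNIV. det (\<chi> i. if i = j then Y' i h else Y i x))) (at x)"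
proof -
  have c: "((\<lambda>x. Y i x $ k) has_derivative (\<lambda>h. Y' i h $ k)) (at x)" for i k
    using bounded_linear.has_derivative[OF bounded_linear_vec_nth assms] .
  have "((\<lambda>x. \<Sum>p | p permutes UNIV. of_int (sign p) * (\<Prod>i\<in>UNIV. Y i x $ p i)) has_derivative
     (\<lambda>h. \<Sum>p | p permutes UNIV. of_int (sign p) * (\<Sum>j\<in>UNIV. Y' j h $ p j * (\<Prod>i\<in>UNIV - {j}. Y i x $ p i)))) (at x)"
    by (intro has_derivative_sum has_derivative_mult_right has_derivative_prod c)
  moreover have "(\<Sum>p | p permutes UNIV. of_int (sign p) * (\<Sum>j\<in>UNIV. Y' j h $ p j * (\<Prod>i\<in>UNIV - {j}. Y i x $ p i))) =
     (\<Sum>j\<in>UNIV. det (\<chi> i. if i = j then Y' i h else Y i x))" for h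
  proof -
    have "Y' j h $ p j * (\<Prod>i\<in>UNIV - {j}. Y i x $ p i) = (\<Prod>i\<in>UNIV. (if i = j then Y' i h else Y i x) $ p i)" for p j
      by (subst prod.remove[of UNIV j]) (auto intro!: prod.cong)
    then show ?thesis
      unfolding det_def by (simp add: sum_distrib_left) (rule sum.swap)
  qed
  ultimately show ?thesis by (simp add: det_def)
qed

text \<open>Both sides are the derivative at t = 0 of det (y (1 + t B)) = det y * det (1 + t B). The
  case of the standard basis identifies the second factor's derivative as the trace.\<close>

lemma sum_det_apply:
  fixes B :: "real ^ 'n \<Rightarrow> real ^ 'n"
  assumes B: "linear B"
  shows "(\<Sum>j\<in>UNIV. det (\<chi> i. if i = j then B (y i) else y i)) = trace (matrix B) * det (\<chi> i. y i)"
proof -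
  have Bv: "B v = (\<Sum>k\<in>UNIV. v $ k *\<^sub>R B (axis k 1))" for v
    by (subst basis_expansion[of v, symmetric])
      (simp add: linear_sum[OF B] scalar_mult_eq_scaleR linear_cmul[OF B])
  have d1: "((\<lambda>t. det (\<chi> i. y i + t *\<^sub>R B (y i))) has_derivative
     (\<lambda>h. \<Sum>j\<in>UNIV. det (\<chi> i. if i = j then h *\<^sub>R B (y i) else y i + 0 *\<^sub>R B (y i)))) (at (0::real))"
    by (rule det_has_derivative) (auto intro!: derivative_eq_intros)
  have d2: "((\<lambda>t. det (\<chi> i. axis i 1 + t *\<^sub>R B (axis i 1))) has_derivative
     (\<lambda>h. \<Sum>j\<in>UNIV. det (\<chi> i. if i = j then h *\<^sub>R B (axis i 1) else axis i 1 + 0 *\<^sub>R B (axis i 1)))) (at (0::real))"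
    by (rule det_has_derivative) (auto intro!: derivative_eq_intros)
  have "(\<chi> i. y i + t *\<^sub>R B (y i)) = (\<chi> i. y i) ** (\<chi> i. axis i 1 + t *\<^sub>R B (axis i 1))" for t
  proof -
    have "y i $ j + t * B (y i) $ j = (\<Sum>k\<in>UNIV. y i $ k * (axis k 1 $ j + t * B (axis k 1) $ j))" for i j
    proof -
      have "y i $ j = (\<Sum>k\<in>UNIV. y i $ k * axis k 1 $ j)"
        by (subst basis_expansion[of "y i", symmetric]) (simp add: sum_component)
      moreover have "B (y i) $ j = (\<Sum>k\<in>UNIV. y i $ k * B (axis k 1) $ j)"
        by (subst Bv) (simp add: sum_component)
      ultimately show ?thesis by (simp add: sum.distrib algebra_simps sum_distrib_left)
    qed
    then show ?thesis by (simp add: matrix_matrix_mult_def vec_eq_iff)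
  qed
  then have "(\<lambda>t. det (\<chi> i. y i + t *\<^sub>R B (y i))) = (\<lambda>t. det (\<chi> i. y i) * det (\<chi> i. axis i 1 + t *\<^sub>R B (axis i 1)))"
    by (simp add: det_mul)
  from has_derivative_unique[OF d1[unfolded this] has_derivative_mult_right[OF d2]]
  have eq: "(\<Sum>j\<in>UNIV. det (\<chi> i. if i = j then B (y i) else y i))
     = det (\<chi> i. y i) * (\<Sum>j\<in>UNIV. det (\<chi> i. if i = j then B (axis i 1) else axis i 1))"
    by (auto dest!: fun_cong[of _ _ 1] cong: if_cong)
  have a: "det (\<chi> i. if i = j then c else axis i 1) = c $ j" for c :: "real ^ 'n" and j
  proof -
    have r: "row i (mat 1 :: real^'n^'n) = axis i 1" for i
      by (simp add: row_def mat_def axis_def vec_eq_iff)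
    have "(\<chi> i. if i = j then c else axis i 1) =
       (\<chi> i. if i = j then sum (\<lambda>i. c $ i *s row i (mat 1 :: real^'n^'n)) UNIV else row i (mat 1))"
      unfolding r basis_expansion by simp
    then show ?thesis using cramer_lemma_transpose[of j c "mat 1"] by simp
  qed
  have "det (\<chi> i. if i = j then B (axis i 1) else axis i 1) = B (axis j 1) $ j" for j
  proof -
    have e: "(\<chi> i. if i = j then B (axis i 1) else axis i 1) = (\<chi> i. if i = j then B (axis j 1) else axis i 1)"
      by (simp add: vec_eq_iff)
    show ?thesis unfolding e by (rule a)
  qed
  then show ?thesis unfolding eq by (simp add: trace_matrix)
qed

section \<open>Two integrable systems\<close>

text \<open>The Hessian equation \<open>\<nabla>d\<phi> = - k \<phi> g\<close>, written as a linear first order system for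
  \<open>(\<phi>, d\<phi>)\<close>, is integrable if \<open>\<nabla>\<close> has constant curvature \<open>k\<close>; then \<open>\<rho> = - d\<phi> / \<phi>\<close>.\<close>

lemma local_projective:
  fixes \<Gamma> :: "'a::euclidean_space \<Rightarrow> 'a \<Rightarrow> 'a \<Rightarrow> 'a"
  assumes S: "open S" "x0 \<in> S" and \<Gamma>: "smooth_bilinear_on S \<Gamma>" "\<And>x u v. x \<in> S \<Longrightarrow> \<Gamma> x u v = \<Gamma> x v u"
    and G: "smooth_bilinear_on S G" "\<And>x u v. x \<in> S \<Longrightarrow> G x u v = G x v u"
    and cod: "\<And>x u v w. x \<in> S \<Longrightarrow>
      ddir (\<lambda>y. G y u w) x v - G x u (\<Gamma> x v w) = ddir (\<lambda>y. G y v w) x u - G x v (\<Gamma> x u w)"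
    and R: "\<And>x u v w. x \<in> S \<Longrightarrow> riem \<Gamma> x u v w = k *\<^sub>R (G x v w *\<^sub>R u - G x u w *\<^sub>R v)"
  obtains r \<rho> where "r > 0" "ball x0 r \<subseteq> S" "smooth_linear_on (ball x0 r) \<rho>"
    "\<And>x u v. x \<in> ball x0 r \<Longrightarrow> ddir (\<lambda>y. \<rho> y v) x u = ddir (\<lambda>y. \<rho> y u) x v"
    "\<And>x u w. x \<in> ball x0 r \<Longrightarrow> proj_tensor \<Gamma> \<rho> x u w = k * G x u w"
proof -
  \<comment> \<open>The unknown e is the pair (\<phi>, d\<phi>), with the covector d\<phi> stored as
    a vector through the inner product. The second component says that the derivative of d\<phi>(w)
    along u is d\<phi>(\<Gamma>(u, w)) - k \<phi> g(u, w).\<close>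
  define A where "A x u e = (snd e \<bullet> u, \<Sum>b\<in>Basis. (snd e \<bullet> \<Gamma> x u b - k * fst e * G x u b) *\<^sub>R b)"
    for x u and e :: "real \<times> 'a"
  note \<Gamma>l = smooth_bilinear_onD(3)[OF \<Gamma>(1)] and Gl = smooth_bilinear_onD(3)[OF G(1)]
  note \<Gamma>l' = smooth_bilinear_onD(4)[OF \<Gamma>(1)] and Gl' = smooth_bilinear_onD(4)[OF G(1)]
  note \<Gamma>s = smooth_bilinear_onD(2)[OF \<Gamma>(1)] and Gs = smooth_bilinear_onD(2)[OF G(1)]
  have fstA: "fst (A x u e) = snd e \<bullet> u" for x u e by (simp add: A_def)
  have sndA: "snd (A x u e) \<bullet> w = snd e \<bullet> \<Gamma> x u w - k * fst e * G x u w" if "x \<in> S" for x u e w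
  proof -
    have "snd (A x u e) \<bullet> w = (\<Sum>b\<in>Basis. (snd e \<bullet> \<Gamma> x u b - k * fst e * G x u b) * (w \<bullet> b))"
      by (simp add: A_def inner_sum_left inner_commute[of w])
    also have "\<dots> = snd e \<bullet> (\<Sum>b\<in>Basis. (w \<bullet> b) *\<^sub>R \<Gamma> x u b) - k * fst e * (\<Sum>b\<in>Basis. (w \<bullet> b) *\<^sub>R G x u b)"
      by (simp add: inner_sum_right sum_subtractf sum_distrib_left algebra_simps)
    also have "\<dots> = snd e \<bullet> \<Gamma> x u w - k * fst e * G x u w"
      using linear_basis_expand[OF \<Gamma>l[OF that], of u w] linear_basis_expand[OF Gl[OF that], of u w] by simp
    finally show ?thesis .
  qed
  have pair_eqI: "e = e'" if "fst e = fst e'" "\<And>w. snd e \<bullet> w = snd e' \<bullet> w" for e e' :: "real \<times> 'a"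
    using that by (metis prod_eqI vector_eq_rdot)
  have smA: "smooth_bilinear_on S A"
    unfolding smooth_bilinear_on_def
  proof (intro conjI ballI allI)
    fix x assume x: "x \<in> S"
    note s = sndA[OF x] linear_add[OF \<Gamma>l[OF x]] linear_add[OF \<Gamma>l'[OF x]] linear_cmul[OF \<Gamma>l'[OF x]]
      linear_add[OF Gl'[OF x]] linear_cmul[OF Gl'[OF x]]
    show "bilinear (A x)"
      unfolding bilinear_def linear_iff
      by (intro conjI allI; rule pair_eqI)
        (simp_all add: fstA s inner_add_left inner_add_right algebra_simps)
  next
    fix u e
    show "smooth_on S (\<lambda>x. A x u e)" unfolding A_def
      by (intro smooth_on_Pair smooth_on_const smooth_on_sum smooth_on_scaleR smooth_on_diff smooth_on_mult
          smooth_on_inner S(1) \<Gamma>s Gs)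
  qed
  have dA: "ddir (\<lambda>x. A x u e) x v =
      (0, \<Sum>b\<in>Basis. (snd e \<bullet> ddir (\<lambda>y. \<Gamma> y u b) x v - k * fst e * ddir (\<lambda>y. G y u b) x v) *\<^sub>R b)"
    if x: "x \<in> S" for x u e v
  proof -
    have "((\<lambda>x. A x u e) has_derivative (\<lambda>v. (0, \<Sum>b\<in>Basis. (snd e \<bullet> ddir (\<lambda>y. \<Gamma> y u b) x v
        - k * fst e * ddir (\<lambda>y. G y u b) x v) *\<^sub>R b))) (at x)"
      unfolding A_def
      by (intro has_derivative_Pair has_derivative_const has_derivative_sum has_derivative_scaleR_left
          has_derivative_diff has_derivative_mult_right has_derivative_inner_right
          smooth_on_has_derivative[OF \<Gamma>s x] smooth_on_has_derivative[OF Gs x])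
    then show ?thesis by (simp add: ddir_eqI)
  qed
  have integ: "ddir (\<lambda>x. A x u e) x v + A x u (A x v e) = ddir (\<lambda>x. A x v e) x u + A x v (A x u e)"
    if x: "x \<in> S" for x u v e
  proof (rule prod_eqI)
    show "fst (ddir (\<lambda>x. A x u e) x v + A x u (A x v e)) = fst (ddir (\<lambda>x. A x v e) x u + A x v (A x u e))"
      by (simp add: dA[OF x] fstA sndA[OF x] \<Gamma>(2)[OF x, of u v] G(2)[OF x, of u v])
    show "snd (ddir (\<lambda>x. A x u e) x v + A x u (A x v e)) = snd (ddir (\<lambda>x. A x v e) x u + A x v (A x u e))"
    proof (rule euclidean_eqI)
      fix b :: 'a assume b: "b \<in> Basis"
      have d: "snd (ddir (\<lambda>x. A x u e) x v) \<bullet> b = snd e \<bullet> ddir (\<lambda>y. \<Gamma> y u b) x v - k * fst e * ddir (\<lambda>y. G y u b) x v" for u v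
        using b by (simp add: dA[OF x] inner_sum_left inner_Basis if_distrib cong: if_cong)
      \<comment> \<open>The first component of integrability was the symmetry of \<Gamma> and G. The
        second splits into the part in d\<phi>, which is the curvature condition, and the part in
        \<phi>, which is k \<phi> times the Codazzi equation.\<close>
      have "snd e \<bullet> riem \<Gamma> x v u b = k * (G x u b * (snd e \<bullet> v) - G x v b * (snd e \<bullet> u))"
        by (simp add: R[OF x] inner_diff_right)
      then have r: "snd e \<bullet> ddir (\<lambda>y. \<Gamma> y u b) x v - snd e \<bullet> ddir (\<lambda>y. \<Gamma> y v b) x u
          + snd e \<bullet> \<Gamma> x v (\<Gamma> x u b) - snd e \<bullet> \<Gamma> x u (\<Gamma> x v b) = k * (G x u b * (snd e \<bullet> v) - G x v b * (snd e \<bullet> u))"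
        by (simp add: riem_def inner_diff_right inner_add_right)
      have c: "k * fst e * (ddir (\<lambda>y. G y u b) x v - G x u (\<Gamma> x v b)) = k * fst e * (ddir (\<lambda>y. G y v b) x u - G x v (\<Gamma> x u b))"
        by (simp only: cod[OF x, of u b v])
      show "snd (ddir (\<lambda>x. A x u e) x v + A x u (A x v e)) \<bullet> b = snd (ddir (\<lambda>x. A x v e) x u + A x v (A x u e)) \<bullet> b"
        using r c by (simp add: inner_add_left d sndA[OF x] fstA algebra_simps)
    qed
  qed
  \<comment> \<open>The initial value \<phi> = 1, d\<phi> = 0 keeps \<phi> within distance 1 of 1,
    hence nonzero, on a smaller ball.\<close>
  obtain r0 \<Psi> where r0: "r0 > 0" "ball x0 r0 \<subseteq> S" and \<Psi>: "\<Psi> x0 = (1, 0)" "smooth_on (ball x0 r0) \<Psi>"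
    "\<And>x. x \<in> ball x0 r0 \<Longrightarrow> (\<Psi> has_derivative (\<lambda>v. A x v (\<Psi> x))) (at x)"
    using frobenius_linear[OF S smA integ] by blast
  define f a where "f x = fst (\<Psi> x)" and "a x = snd (\<Psi> x)" for x
  have sf: "smooth_on (ball x0 r0) f" and sa: "smooth_on (ball x0 r0) a"
    unfolding f_def a_def
    by (intro smooth_on_linear[OF bounded_linear_fst] smooth_on_linear[OF bounded_linear_snd] \<Psi> open_ball)+
  have "isCont f x0" using smooth_on_continuous[OF sf] r0(1) by (simp add: continuous_on_eq_continuous_at)
  moreover have "f x0 = 1" using \<Psi>(1) by (simp add: f_def)
  ultimately obtain d where d: "d > 0" "\<And>x. dist x x0 < d \<Longrightarrow> dist (f x) 1 < 1"
    unfolding continuous_at_eps_delta by (metis zero_less_one)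
  define r where "r = min r0 d"
  have r: "r > 0" and sub0: "ball x0 r \<subseteq> ball x0 r0" using r0 d by (auto simp: r_def)
  have nz: "f x \<noteq> 0" if "x \<in> ball x0 r" for x
    using d(2)[of x] that by (auto simp: r_def dist_commute dist_real_def)
  define \<rho> where "\<rho> x u = - (inverse (f x) * (a x \<bullet> u))" for x u
  have df: "(f has_derivative (\<lambda>v. a x \<bullet> v)) (at x)" if "x \<in> ball x0 r" for x
  proof -
    have "x \<in> ball x0 r0" using that sub0 by blast
    from bounded_linear.has_derivative[OF bounded_linear_fst \<Psi>(3)[OF this]]
    show ?thesis unfolding f_def a_def fstA .
  qed
  have da: "((\<lambda>x. a x \<bullet> w) has_derivative (\<lambda>v. a x \<bullet> \<Gamma> x v w - k * f x * G x v w)) (at x)"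
    if "x \<in> ball x0 r" for x w
  proof -
    have x: "x \<in> ball x0 r0" "x \<in> S" using that sub0 r0 by auto
    from has_derivative_inner_left[OF bounded_linear.has_derivative[OF bounded_linear_snd \<Psi>(3)[OF x(1)]], of w]
    show ?thesis unfolding f_def a_def sndA[OF x(2)] .
  qed
  \<comment> \<open>The quotient rule for - d\<phi> / \<phi>: the derivative of 1 / \<phi> produces
    \<rho> \<otimes> \<rho>, the Hessian equation produces k g.\<close>
  have d\<rho>: "ddir (\<lambda>y. \<rho> y w) x u = \<rho> x (\<Gamma> x u w) + k * G x u w + \<rho> x u * \<rho> x w" if x: "x \<in> ball x0 r" for x u w
  proof -
    have "((\<lambda>y. \<rho> y w) has_derivative (\<lambda>u. - (inverse (f x) * (a x \<bullet> \<Gamma> x u w - k * f x * G x u w)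
        + - (inverse (f x) * (a x \<bullet> u) * inverse (f x)) * (a x \<bullet> w)))) (at x)"
      unfolding \<rho>_def
      by (intro has_derivative_minus has_derivative_mult da[OF x] Deriv.has_derivative_inverse[OF nz[OF x] df[OF x]])
    from ddir_eqI[OF this] show ?thesis
      using nz[OF x] by (simp add: \<rho>_def algebra_simps)
  qed
  show ?thesis
  proof (rule that[of r \<rho>, OF r])
    show rS: "ball x0 r \<subseteq> S" using sub0 r0 by blast
    show "smooth_linear_on (ball x0 r) \<rho>"
      unfolding smooth_linear_on_def
    proof (intro conjI ballI allI)
      show "linear (\<rho> x)" for x unfolding \<rho>_def linear_iff by (simp add: inner_add_right algebra_simps)
      show "smooth_on (ball x0 r) (\<lambda>x. \<rho> x u)" for u unfolding \<rho>_def
        by (intro smooth_on_minus smooth_on_mult smooth_on_inverse smooth_on_inner smooth_on_const open_ball nz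
            smooth_on_subset[OF sf sub0] smooth_on_subset[OF sa sub0])
    qed
    fix x u w assume x: "x \<in> ball x0 r"
    then have xS: "x \<in> S" using rS by blast
    show "proj_tensor \<Gamma> \<rho> x u w = k * G x u w" by (simp add: proj_tensor_def d\<rho>[OF x])
    show "ddir (\<lambda>y. \<rho> y w) x u = ddir (\<lambda>y. \<rho> y u) x w"
      by (simp add: d\<rho>[OF x] \<Gamma>(2)[OF xS, of w u] G(2)[OF xS, of w u] mult.commute)
  qed
qed

text \<open>The solution f makes f dx1 ... dxn parallel. The trace is that of w \<mapsto> R(u, v)w,
  the curvature of the connection on top-degree forms up to sign: the quadratic parts cancel by
  tr(ab) = tr(ba), so its vanishing says that the form tr \<Gamma> is closed.\<close>

lemma local_parallel_density:
  fixes \<Gamma> :: "real ^ 'n \<Rightarrow> real ^ 'n \<Rightarrow> real ^ 'n \<Rightarrow> real ^ 'n"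
  assumes S: "open S" "x0 \<in> S" and \<Gamma>: "smooth_bilinear_on S \<Gamma>" "\<And>x u v. x \<in> S \<Longrightarrow> \<Gamma> x u v = \<Gamma> x v u"
    and tr: "\<And>x u v. x \<in> S \<Longrightarrow> trace (matrix (riem \<Gamma> x u v)) = 0"
  obtains r f where "r > 0" "ball x0 r \<subseteq> S" "smooth_on (ball x0 r) f" "\<And>x. x \<in> ball x0 r \<Longrightarrow> f x \<noteq> 0"
    "\<And>x. x \<in> ball x0 r \<Longrightarrow> (f has_derivative (\<lambda>v. trace (matrix (\<Gamma> x v)) * f x)) (at x)"
proof -
  define A where "A x u e = trace (matrix (\<Gamma> x u)) * e" for x u and e :: real
  note \<Gamma>s = smooth_bilinear_onD(2)[OF \<Gamma>(1)] and b = smooth_bilinear_onD(1)[OF \<Gamma>(1)]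
  have smA: "smooth_bilinear_on S A"
    unfolding smooth_bilinear_on_def
  proof (intro conjI ballI allI)
    fix x assume "x \<in> S"
    from b[OF this] have "trace (matrix (\<Gamma> x (u + v))) = trace (matrix (\<Gamma> x u)) + trace (matrix (\<Gamma> x v))"
      "trace (matrix (\<Gamma> x (c *\<^sub>R u))) = c * trace (matrix (\<Gamma> x u))" for u v c
      by (simp_all add: trace_matrix bilinear_ladd bilinear_lmul sum.distrib sum_distrib_left)
    then show "bilinear (A x)" by (simp add: bilinear_def linear_iff A_def algebra_simps)
  next
    show "smooth_on S (\<lambda>x. A x u e)" for u e unfolding A_def trace_matrix
      by (intro smooth_on_mult smooth_on_sum smooth_on_const smooth_on_linear[OF bounded_linear_vec_nth] S(1) \<Gamma>s)
  qed
  have dA: "ddir (\<lambda>x. A x u e) x v = trace (matrix (\<lambda>w. ddir (\<lambda>y. \<Gamma> y u w) x v)) * e" if x: "x \<in> S" for x u e v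
  proof -
    have "((\<lambda>x. A x u e) has_derivative (\<lambda>v. trace (matrix (\<lambda>w. ddir (\<lambda>y. \<Gamma> y u w) x v)) * e)) (at x)"
      unfolding A_def trace_matrix
      by (intro has_derivative_mult_left has_derivative_sum bounded_linear.has_derivative[OF bounded_linear_vec_nth]
          smooth_on_has_derivative[OF \<Gamma>s x])
    then show ?thesis by (simp add: ddir_eqI)
  qed
  have integ: "ddir (\<lambda>x. A x u e) x v + A x u (A x v e) = ddir (\<lambda>x. A x v e) x u + A x v (A x u e)"
    if x: "x \<in> S" for x u v e
  proof -
    have l: "linear (\<Gamma> x u)" for u using b[OF x] by (simp add: bilinear_def)
    have "riem \<Gamma> x v u = (\<lambda>w. ddir (\<lambda>y. \<Gamma> y u w) x v - ddir (\<lambda>y. \<Gamma> y v w) x u + \<Gamma> x v (\<Gamma> x u w) - \<Gamma> x u (\<Gamma> x v w))"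
      by (simp add: riem_def fun_eq_iff)
    then have "trace (matrix (\<lambda>w. ddir (\<lambda>y. \<Gamma> y u w) x v)) = trace (matrix (\<lambda>w. ddir (\<lambda>y. \<Gamma> y v w) x u))"
      using tr[OF x, of v u] trace_matrix_compose[OF l l, of u v] by (simp add: trace_matrix_linear)
    then show ?thesis unfolding dA[OF x] by (simp add: A_def mult.left_commute)
  qed
  obtain r0 f where r0: "r0 > 0" "ball x0 r0 \<subseteq> S" and f: "f x0 = 1" "smooth_on (ball x0 r0) f"
    "\<And>x. x \<in> ball x0 r0 \<Longrightarrow> (f has_derivative (\<lambda>v. A x v (f x))) (at x)"
    using frobenius_linear[OF S smA integ] by blast
  have "isCont f x0" using smooth_on_continuous[OF f(2)] r0(1) by (simp add: continuous_on_eq_continuous_at)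
  then obtain d where d: "d > 0" "\<And>x. dist x x0 < d \<Longrightarrow> dist (f x) 1 < 1"
    unfolding continuous_at_eps_delta f(1) by (metis zero_less_one)
  show ?thesis
  proof (rule that[of "min r0 d" f])
    have sub: "ball x0 (min r0 d) \<subseteq> ball x0 r0" by auto
    then show "smooth_on (ball x0 (min r0 d)) f" using smooth_on_subset[OF f(2)] by blast
    show "ball x0 (min r0 d) \<subseteq> S" using sub r0 by blast
    fix x assume x: "x \<in> ball x0 (min r0 d)"
    then show "f x \<noteq> 0" using d(2)[of x] by (auto simp: dist_commute dist_real_def)
    show "(f has_derivative (\<lambda>v. trace (matrix (\<Gamma> x v)) * f x)) (at x)"
      using f(3)[of x] x by (simp add: A_def)
  qed (use r0 d in simp)
qed

section \<open>Fields on a manifold in coordinates\<close>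

lemma smooth_linear_on_ddir:
  fixes f :: "'a::euclidean_space \<Rightarrow> 'b::real_normed_vector"
  assumes "smooth_on S f" shows "smooth_linear_on S (\<lambda>x v. ddir f x v)"
  unfolding smooth_linear_on_def
  by (intro conjI ballI allI smooth_on_linear_ddir[OF assms] smooth_on_ddir[OF assms])

abbreviation cimg :: "('a, 'n) chart \<Rightarrow> 'a set \<Rightarrow> (real ^ 'n) set" where
  "cimg c U \<equiv> snd c ` (fst c \<inter> U)"

locale smooth_atlas =
  fixes M :: "'a::{t2_space, second_countable_topology} set"
    and A :: "('a, 'n::finite) chart set"
  assumes smooth_manifold: "smooth_manifold M A"
begin

section \<open>Charts and transition maps\<close>

lemma is_chart: "c \<in> A \<Longrightarrow> is_chart c"
  using smooth_manifold by (auto simp: smooth_manifold_def)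

lemma open_chart: "c \<in> A \<Longrightarrow> open (fst c)"
  using is_chart by (auto simp: is_chart_def)

lemma chart_subset: "c \<in> A \<Longrightarrow> fst c \<subseteq> M"
  using smooth_manifold by (auto simp: smooth_manifold_def)

lemma open_M: "open M"
  using smooth_manifold open_chart by (auto simp: smooth_manifold_def)

lemma chart_inv [simp]: "c \<in> A \<Longrightarrow> p \<in> fst c \<Longrightarrow> chart_inv c (snd c p) = p"
  using is_chart[of c] by (auto simp: is_chart_def homeomorphism_def)

lemma cimgE:
  assumes "c \<in> A" "x \<in> cimg c U"
  obtains p where "p \<in> fst c" "p \<in> U" "x = snd c p" "chart_inv c x = p"
  using assms by auto

lemma open_cimg: assumes "c \<in> A" "open U" shows "open (cimg c U)"
proof -
  have "continuous_on (snd c ` fst c) (chart_inv c)" "open (snd c ` fst c)"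
    using is_chart[OF assms(1)] by (auto simp: is_chart_def homeomorphism_def)
  then have "open (chart_inv c -` U \<inter> snd c ` fst c)"
    using assms(2) by (metis continuous_on_open_vimage)
  moreover have "chart_inv c -` U \<inter> snd c ` fst c = cimg c U"
    using assms(1) by auto
  ultimately show ?thesis by simp
qed

lemma open_chart_vimage: assumes "c \<in> A" "open V" shows "open (fst c \<inter> snd c -` V)"
proof -
  have "continuous_on (fst c) (snd c)"
    using is_chart[OF assms(1)] by (auto simp: is_chart_def homeomorphism_def)
  then show ?thesis using assms open_chart
    by (metis Int_commute continuous_on_open_vimage)
qed

lemma chart_at:
  assumes "p \<in> M" shows chart_at_in: "chart_at A p \<in> A" and in_chart_at: "p \<in> fst (chart_at A p)"
proof -
  have "\<exists>c. c \<in> A \<and> p \<in> fst c" using assms smooth_manifold by (auto simp: smooth_manifold_def)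
  from someI_ex[OF this] show "chart_at A p \<in> A" "p \<in> fst (chart_at A p)"
    by (auto simp: chart_at_def)
qed

lemma transition_apply: "c \<in> A \<Longrightarrow> p \<in> fst c \<Longrightarrow> transition c d (snd c p) = snd d p"
  by (simp add: transition_def)

lemma smooth_transition: "c \<in> A \<Longrightarrow> d \<in> A \<Longrightarrow> smooth_on (cimg c (fst d)) (transition c d)"
  using smooth_manifold by (auto simp: smooth_manifold_def)

lemma transition_has_derivative:
  assumes "c \<in> A" "d \<in> A" "p \<in> fst c" "p \<in> fst d"
  shows "(transition c d has_derivative ddir (transition c d) (snd c p)) (at (snd c p))"
  using assms by (intro smooth_on_has_derivative[OF smooth_transition]) auto

lemma ddir_transition_compose:
  assumes "c \<in> A" "d \<in> A" "e \<in> A" "p \<in> fst c" "p \<in> fst d" "p \<in> fst e"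
  shows "ddir (transition c e) (snd c p) v = ddir (transition d e) (snd d p) (ddir (transition c d) (snd c p) v)"
proof -
  have "((\<lambda>x. transition d e (transition c d x)) has_derivative
      (\<lambda>v. ddir (transition d e) (snd d p) (ddir (transition c d) (snd c p) v))) (at (snd c p))"
    by (rule has_derivative_compose[OF transition_has_derivative])
      (use assms transition_has_derivative[of d e p] in \<open>simp_all add: transition_apply\<close>)
  then have "(transition c e has_derivative
      (\<lambda>v. ddir (transition d e) (snd d p) (ddir (transition c d) (snd c p) v))) (at (snd c p))"
    by (rule has_derivative_transform_within_open[OF _ open_cimg[of c "fst d \<inter> fst e"]])
      (use assms open_Int[OF open_chart[of d] open_chart[of e]] in \<open>auto simp: transition_apply\<close>)
  then show ?thesis by (simp add: ddir_eqI)
qed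

lemma ddir_transition_self:
  assumes "c \<in> A" "p \<in> fst c"
  shows "ddir (transition c c) (snd c p) v = v"
proof -
  have "(transition c c has_derivative (\<lambda>v. v)) (at (snd c p))"
    by (rule has_derivative_transform_within_open[OF has_derivative_ident open_cimg[of c UNIV]])
      (use assms in \<open>auto simp: transition_apply\<close>)
  then show ?thesis by (simp add: ddir_eqI)
qed

section \<open>Components of tangent vectors in an arbitrary chart\<close>

lemma coords_in_linear:
  assumes "c \<in> A" "p \<in> fst c" shows "linear (coords_in A c p)"
proof -
  have p: "p \<in> M" using assms chart_subset by blast
  show ?thesis unfolding coords_in_def
    by (rule has_derivative_linear[OF transition_has_derivative[OF chart_at_in[OF p] assms(1) in_chart_at[OF p] assms(2)]])
qed

lemma coords_in_change:
  assumes "c \<in> A" "d \<in> A" "p \<in> fst c" "p \<in> fst d"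
  shows "coords_in A d p v = ddir (transition c d) (snd c p) (coords_in A c p v)"
proof -
  have p: "p \<in> M" using assms chart_subset by blast
  show ?thesis unfolding coords_in_def
    using ddir_transition_compose[OF chart_at_in[OF p] assms(1,2) in_chart_at[OF p] assms(3,4)] .
qed

lemma coords_in_chart_at: "p \<in> M \<Longrightarrow> coords_in A (chart_at A p) p v = v"
  by (simp add: coords_in_def ddir_transition_self chart_at_in in_chart_at)

text \<open>The inverse of \<open>coords_in A c p\<close>. Since \<open>chart_at A p\<close> may
  jump with p, a smooth field cannot be specified by its raw values; it is specified by components
  in one fixed chart and transported with \<open>vec_of\<close>.\<close>

definition vec_of :: "('a, 'n) chart \<Rightarrow> 'a \<Rightarrow> real ^ 'n \<Rightarrow> real ^ 'n" where
  "vec_of c p w = ddir (transition c (chart_at A p)) (snd c p) w"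

lemma vec_of_linear:
  assumes "c \<in> A" "p \<in> fst c" shows "linear (vec_of c p)"
proof -
  have p: "p \<in> M" using assms chart_subset by blast
  show ?thesis unfolding vec_of_def
    by (rule has_derivative_linear[OF transition_has_derivative[OF assms(1) chart_at_in[OF p] assms(2) in_chart_at[OF p]]])
qed

lemma coords_vec_of [simp]:
  assumes "c \<in> A" "p \<in> fst c" shows "coords_in A c p (vec_of c p w) = w"
proof -
  have p: "p \<in> M" using assms chart_subset by blast
  show ?thesis unfolding coords_in_def vec_of_def
    using ddir_transition_compose[OF assms(1) chart_at_in[OF p] assms(1) assms(2) in_chart_at[OF p] assms(2)]
    by (simp add: ddir_transition_self assms)
qed

lemma vec_of_coords [simp]:
  assumes "c \<in> A" "p \<in> fst c" shows "vec_of c p (coords_in A c p v) = v"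
proof -
  have p: "p \<in> M" using assms chart_subset by blast
  show ?thesis unfolding coords_in_def vec_of_def
    using ddir_transition_compose[OF chart_at_in[OF p] assms(1) chart_at_in[OF p] in_chart_at[OF p] assms(2) in_chart_at[OF p]]
    by (simp add: ddir_transition_self chart_at_in in_chart_at p)
qed

lemma coords_inject:
  assumes "c \<in> A" "p \<in> fst c" "coords_in A c p v = coords_in A c p w" shows "v = w"
proof -
  have "v = vec_of c p (coords_in A c p v)" by (rule vec_of_coords[OF assms(1,2), symmetric])
  also have "\<dots> = w" unfolding assms(3) by (rule vec_of_coords[OF assms(1,2)])
  finally show ?thesis .
qed

lemma local_rep_apply: "c \<in> A \<Longrightarrow> p \<in> fst c \<Longrightarrow> local_rep A c X (snd c p) = coords_in A c p (X p)"
  by (simp add: local_rep_def)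

lemma local_rep_change:
  assumes "c \<in> A" "d \<in> A" "p \<in> fst c" "p \<in> fst d"
  shows "local_rep A d X (snd d p) = ddir (transition c d) (snd c p) (local_rep A c X (snd c p))"
  using assms coords_in_change[OF assms] by (simp add: local_rep_apply)

section \<open>Smooth functions and vector fields, tested locally\<close>

lemma vector_fieldD:
  "X \<in> vector_fields A U \<Longrightarrow> c \<in> A \<Longrightarrow> smooth_on (cimg c U) (local_rep A c X)"
  by (simp add: vector_fields_def)

lemma smooth_funD:
  "smooth_fun A U f \<Longrightarrow> c \<in> A \<Longrightarrow> smooth_on (cimg c U) (f \<circ> chart_inv c)"
  by (simp add: smooth_fun_def)

lemma vector_fields_subset:
  assumes "X \<in> vector_fields A U" "W \<subseteq> U" shows "X \<in> vector_fields A W"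
  unfolding vector_fields_def
proof (rule CollectI, rule ballI)
  fix c assume "c \<in> A"
  show "smooth_on (cimg c W) (local_rep A c X)"
    by (rule smooth_on_subset[OF vector_fieldD[OF assms(1) \<open>c \<in> A\<close>]]) (use assms(2) in blast)
qed

lemma smooth_fun_subset:
  assumes "smooth_fun A U f" "W \<subseteq> U" shows "smooth_fun A W f"
  unfolding smooth_fun_def
proof
  fix c assume "c \<in> A"
  show "smooth_on (cimg c W) (f \<circ> chart_inv c)"
    by (rule smooth_on_subset[OF smooth_funD[OF assms(1) \<open>c \<in> A\<close>]]) (use assms(2) in blast)
qed

text \<open>Replaces the test in every chart of the atlas by a test in one convenient chart near
  each point: local representatives transform by the derivative of the transition map, which is
  smooth.\<close>

lemma vector_field_local:
  assumes "\<And>p. p \<in> U \<Longrightarrow> \<exists>c\<in>A. \<exists>V. open V \<and> p \<in> V \<and> V \<subseteq> fst c \<and> smooth_on (snd c ` V) (local_rep A c X)"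
  shows "X \<in> vector_fields A U"
  unfolding vector_fields_def
proof (safe)
  fix d1 d2 assume dA: "(d1, d2) \<in> A"
  define d where "d = (d1, d2)"
  have d: "d \<in> A" using dA by (simp add: d_def)
  have "smooth_on (cimg d U) (local_rep A d X)"
  proof (rule smooth_on_local)
    fix y assume "y \<in> cimg d U"
    then obtain p where p: "p \<in> fst d" "p \<in> U" "y = snd d p" by auto
    obtain c V where c: "c \<in> A" "open V" "p \<in> V" "V \<subseteq> fst c" "smooth_on (snd c ` V) (local_rep A c X)"
      using assms[OF p(2)] by blast
    let ?T = "cimg d V" and ?T' = "cimg c (fst d \<inter> V)"
    have o: "open ?T" "open ?T'"
      using open_cimg[OF d c(2)] open_cimg[OF c(1) open_Int[OF open_chart[OF d] c(2)]] by auto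
    have 1: "smooth_on ?T' (\<lambda>x. ddir (transition c d) x (local_rep A c X x))"
      by (intro smooth_linear_on_apply[OF o(2) smooth_linear_on_ddir]
          smooth_on_subset[OF smooth_transition[OF c(1) d]] smooth_on_subset[OF c(5)]) (use c in auto)
    have "smooth_on ?T (\<lambda>y. ddir (transition c d) (transition d c y) (local_rep A c X (transition d c y)))"
      by (intro smooth_on_compose[OF o(1) o(2) _ 1] smooth_on_subset[OF smooth_transition[OF d c(1)]])
        (use c d in \<open>auto simp: transition_apply\<close>)
    then have "smooth_on ?T (local_rep A d X)"
      by (rule smooth_on_cong[OF o(1), rotated])
        (use c d in \<open>auto simp: transition_apply local_rep_change[of c d, symmetric]\<close>)
    then show "\<exists>T. open T \<and> y \<in> T \<and> smooth_on T (local_rep A d X)"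
      using o(1) p c by (intro exI[of _ ?T]) auto
  qed
  then show "smooth_on (cimg (d1, d2) U) (local_rep A (d1, d2) X)" by (simp add: d_def)
qed

lemma smooth_fun_local:
  assumes "\<And>p. p \<in> U \<Longrightarrow> \<exists>c\<in>A. \<exists>V. open V \<and> p \<in> V \<and> V \<subseteq> fst c \<and> smooth_on (snd c ` V) (f \<circ> chart_inv c)"
  shows "smooth_fun A U f"
  unfolding smooth_fun_def
proof
  fix d assume d: "d \<in> A"
  show "smooth_on (cimg d U) (f \<circ> chart_inv d)"
  proof (rule smooth_on_local)
    fix y assume "y \<in> cimg d U"
    then obtain p where p: "p \<in> fst d" "p \<in> U" "y = snd d p" by auto
    obtain c V where c: "c \<in> A" "open V" "p \<in> V" "V \<subseteq> fst c" "smooth_on (snd c ` V) (f \<circ> chart_inv c)"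
      using assms[OF p(2)] by blast
    let ?T = "cimg d V" and ?T' = "cimg c (fst d \<inter> V)"
    have o: "open ?T" "open ?T'"
      using open_cimg[OF d c(2)] open_cimg[OF c(1) open_Int[OF open_chart[OF d] c(2)]] by auto
    have 1: "smooth_on ?T' (f \<circ> chart_inv c)" by (rule smooth_on_subset[OF c(5)]) auto
    have "smooth_on ?T (\<lambda>y. (f \<circ> chart_inv c) (transition d c y))"
      by (intro smooth_on_compose[OF o(1) o(2) _ 1] smooth_on_subset[OF smooth_transition[OF d c(1)]])
        (use c d in \<open>auto simp: transition_apply\<close>)
    then have "smooth_on ?T (f \<circ> chart_inv d)"
      by (rule smooth_on_cong[OF o(1), rotated])
        (use c d in \<open>auto simp: transition_apply\<close>)
    then show "\<exists>T. open T \<and> y \<in> T \<and> smooth_on T (f \<circ> chart_inv d)"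
      using o(1) p c by (intro exI[of _ ?T]) auto
  qed
qed

lemma vector_field_chart:
  assumes "c \<in> A" "open U" "U \<subseteq> fst c" "smooth_on (snd c ` U) (local_rep A c X)"
  shows "X \<in> vector_fields A U"
proof (rule vector_field_local)
  fix p assume "p \<in> U"
  show "\<exists>c\<in>A. \<exists>V. open V \<and> p \<in> V \<and> V \<subseteq> fst c \<and> smooth_on (snd c ` V) (local_rep A c X)"
    by (intro bexI[of _ c] exI[of _ U] conjI assms \<open>p \<in> U\<close>)
qed

lemma smooth_fun_chart:
  assumes "c \<in> A" "open U" "U \<subseteq> fst c" "smooth_on (snd c ` U) (f \<circ> chart_inv c)"
  shows "smooth_fun A U f"
proof (rule smooth_fun_local)
  fix p assume "p \<in> U"
  show "\<exists>c\<in>A. \<exists>V. open V \<and> p \<in> V \<and> V \<subseteq> fst c \<and> smooth_on (snd c ` V) (f \<circ> chart_inv c)"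
    by (intro bexI[of _ c] exI[of _ U] conjI assms \<open>p \<in> U\<close>)
qed

section \<open>Directional derivative and bracket in an arbitrary chart\<close>

text \<open>Frees \<open>dir_deriv\<close> from the chart chosen at p, by the chain rule through the
  transition map.\<close>

lemma dir_deriv_chart:
  assumes c: "c \<in> A" "p \<in> fst c" and f: "(f \<circ> chart_inv c) differentiable (at (snd c p))"
  shows "dir_deriv A X f p = ddir (f \<circ> chart_inv c) (snd c p) (coords_in A c p (X p))"
proof -
  have p: "p \<in> M" using c chart_subset by blast
  let ?a = "chart_at A p"
  note a = chart_at_in[OF p] in_chart_at[OF p]
  have "((f \<circ> chart_inv c) has_derivative ddir (f \<circ> chart_inv c) (snd c p)) (at (transition ?a c (snd ?a p)))"
    using f by (simp add: transition_apply a frechet_derivative_works)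
  from has_derivative_compose[OF transition_has_derivative[OF a(1) c(1) a(2) c(2)] this]
  have "((\<lambda>x. (f \<circ> chart_inv c) (transition ?a c x)) has_derivative
      (\<lambda>v. ddir (f \<circ> chart_inv c) (snd c p) (ddir (transition ?a c) (snd ?a p) v))) (at (snd ?a p))" .
  then have "((f \<circ> chart_inv ?a) has_derivative
      (\<lambda>v. ddir (f \<circ> chart_inv c) (snd c p) (ddir (transition ?a c) (snd ?a p) v))) (at (snd ?a p))"
    by (rule has_derivative_transform_within_open[OF _ open_cimg[of ?a "fst c"]])
      (use a c open_chart[OF c(1)] in \<open>auto simp: transition_apply\<close>)
  then show ?thesis unfolding dir_deriv_def coords_in_def by (simp add: ddir_eqI)
qed

lemma dir_deriv_smooth:
  assumes "smooth_fun A U f" "c \<in> A" "p \<in> fst c" "p \<in> U"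
  shows "dir_deriv A X f p = ddir (f \<circ> chart_inv c) (snd c p) (coords_in A c p (X p))"
  using assms by (intro dir_deriv_chart smooth_on_differentiable[OF smooth_funD]) auto

text \<open>Differentiating the transformation law of a field produces the second derivative of the
  transition map at the two field values. It is symmetric, so it drops out of the bracket.\<close>

lemma coords_lie_bracket:
  assumes U: "open U" "p \<in> U" and c: "c \<in> A" "p \<in> fst c"
    and X: "X \<in> vector_fields A U" and Y: "Y \<in> vector_fields A U"
  shows "coords_in A c p (lie_bracket A X Y p) =
    ddir (local_rep A c Y) (snd c p) (coords_in A c p (X p)) - ddir (local_rep A c X) (snd c p) (coords_in A c p (Y p))"
proof -
  have p: "p \<in> M" using c chart_subset by blast
  let ?a = "chart_at A p"
  note a = chart_at_in[OF p] in_chart_at[OF p]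
  let ?\<tau> = "transition ?a c" and ?x = "snd ?a p" and ?S = "cimg ?a (fst c \<inter> U)"
  have S: "open ?S" "?x \<in> ?S" using open_cimg[OF a(1) open_Int[OF open_chart[OF c(1)] U(1)]] c a U by auto
  have sm\<tau>: "smooth_on ?S ?\<tau>" by (rule smooth_on_subset[OF smooth_transition[OF a(1) c(1)]]) auto
  \<comment> \<open>Two computations of one derivative: by the Leibniz rule in the chart at p, and
    by the chain rule through the chart c.\<close>
  have key: "ddir (local_rep A c Y) (snd c p) (ddir ?\<tau> ?x v) =
      ddir (\<lambda>y. ddir ?\<tau> y (Y p)) ?x v + ddir ?\<tau> ?x (ddir (local_rep A ?a Y) ?x v)"
    if Y: "Y \<in> vector_fields A U" for Y v
  proof -
    have sY: "smooth_on ?S (local_rep A ?a Y)" by (rule smooth_on_subset[OF vector_fieldD[OF Y a(1)]]) auto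
    have Yp: "local_rep A ?a Y ?x = Y p" using a coords_in_chart_at[OF p] by (simp add: local_rep_apply)
    from smooth_linear_on_has_derivative[OF S(1) smooth_linear_on_ddir[OF sm\<tau>] S(2) smooth_on_has_derivative[OF sY S(2)]]
    have 1: "((\<lambda>y. ddir ?\<tau> y (local_rep A ?a Y y)) has_derivative
       (\<lambda>h. ddir (\<lambda>y. ddir ?\<tau> y (Y p)) ?x h + ddir ?\<tau> ?x (ddir (local_rep A ?a Y) ?x h))) (at ?x)"
      unfolding Yp .
    have "(local_rep A c Y has_derivative ddir (local_rep A c Y) (snd c p)) (at (?\<tau> ?x))"
      using c U a by (simp add: transition_apply) (intro smooth_on_has_derivative[OF vector_fieldD[OF Y c(1)]], auto)
    from has_derivative_compose[OF transition_has_derivative[OF a(1) c(1) a(2) c(2)] this]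
    have "((\<lambda>y. ddir ?\<tau> y (local_rep A ?a Y y)) has_derivative
       (\<lambda>h. ddir (local_rep A c Y) (snd c p) (ddir ?\<tau> ?x h))) (at ?x)"
      by (rule has_derivative_transform_within_open[OF _ S])
        (use a c in \<open>auto simp: transition_apply local_rep_change[of ?a c]\<close>)
    from has_derivative_unique[OF this 1] show ?thesis by (rule fun_cong)
  qed
  have coords: "coords_in A c p v = ddir ?\<tau> ?x v" for v by (simp add: coords_in_def)
  have lin: "linear (ddir ?\<tau> ?x)" by (rule smooth_on_linear_ddir[OF sm\<tau> S(2)])
  show ?thesis
    unfolding coords key[OF X] key[OF Y] lie_bracket_def Let_def linear_diff[OF lin]
    by (simp add: ddir_commute[OF S sm\<tau>, of "X p" "Y p"])
qed

lemma lie_bracket_vector_field: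
  assumes U: "open U" "U \<subseteq> M" and X: "X \<in> vector_fields A U" and Y: "Y \<in> vector_fields A U"
  shows "lie_bracket A X Y \<in> vector_fields A U"
  unfolding vector_fields_def
proof safe
  fix c1 c2 assume cA: "(c1, c2) \<in> A"
  define c where "c = (c1, c2)"
  have c: "c \<in> A" using cA by (simp add: c_def)
  have "smooth_on (cimg c U) (\<lambda>x. ddir (local_rep A c Y) x (local_rep A c X x) - ddir (local_rep A c X) x (local_rep A c Y x))"
    using open_cimg[OF c U(1)]
    by (intro smooth_on_diff smooth_linear_on_apply[OF _ smooth_linear_on_ddir[OF vector_fieldD[OF _ c]]]
        vector_fieldD[OF _ c] X Y)
  then have "smooth_on (cimg c U) (local_rep A c (lie_bracket A X Y))"
    by (rule smooth_on_cong[OF open_cimg[OF c U(1)], rotated])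
      (use coords_lie_bracket[OF U(1) _ c _ X Y] c in \<open>auto simp: local_rep_apply\<close>)
  then show "smooth_on (cimg (c1, c2) U) (local_rep A (c1, c2) (lie_bracket A X Y))" by (simp add: c_def)
qed

lemma local_rep_scaled_vec_of:
  assumes "c \<in> A" "q \<in> fst c"
  shows "coords_in A c q (t *\<^sub>R vec_of c q w) = t *\<^sub>R w"
  using coords_in_linear[OF assms] assms by (simp add: linear_cmul)

section \<open>Extension of local data to global functions and fields\<close>

text \<open>Connections act on fields defined on a whole open set, so data given in a chart must be
  extended without change near p. Multiplication by one \<theta> does this for functions and fields
  alike.\<close>

lemma cutoff:
  assumes U: "open U" "U \<subseteq> M" and c: "c \<in> A" "p \<in> fst c" "p \<in> U"
  obtains \<theta> :: "'a \<Rightarrow> real" and V where "open V" "p \<in> V" "V \<subseteq> fst c \<inter> U" "\<And>q. q \<in> V \<Longrightarrow> \<theta> q = 1"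
    "\<And>h. smooth_on (cimg c U) h \<Longrightarrow> smooth_fun A M (\<lambda>q. if q \<in> fst c \<inter> U then \<theta> q * h (snd c q) else 0)"
    "\<And>H. smooth_on (cimg c U) H \<Longrightarrow>
       (\<lambda>q. if q \<in> fst c \<inter> U then \<theta> q *\<^sub>R vec_of c q (H (snd c q)) else 0) \<in> vector_fields A M"
proof -
  have oW: "open (cimg c U)" "snd c p \<in> cimg c U" using open_cimg U c by auto
  obtain r where r: "r > 0" "cball (snd c p) r \<subseteq> cimg c U" using oW open_contains_cball by blast
  obtain b :: "real ^ 'n \<Rightarrow> real" where b: "smooth_on UNIV b" "\<And>x. x \<in> ball (snd c p) (r / 2) \<Longrightarrow> b x = 1"
    "\<And>x. x \<notin> ball (snd c p) r \<Longrightarrow> b x = 0"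
    using bump_exists[OF r(1), of "snd c p"] by metis
  define \<theta> where "\<theta> q = b (snd c q)" for q
  define V where "V = fst c \<inter> snd c -` ball (snd c p) (r / 2)"
  define K where "K = chart_inv c ` cball (snd c p) r"
  have VU: "V \<subseteq> fst c \<inter> U"
  proof
    fix q assume q: "q \<in> V"
    then have "snd c q \<in> ball (snd c p) (r / 2)" "q \<in> fst c" by (auto simp: V_def)
    then have "snd c q \<in> cimg c U" using r by (auto intro!: subsetD[OF r(2)])
    then show "q \<in> fst c \<inter> U" using c(1) \<open>q \<in> fst c\<close> by (metis chart_inv cimgE IntI)
  qed
  have Ksub: "K \<subseteq> fst c \<inter> U"
  proof
    fix q assume "q \<in> K"
    then obtain x where "x \<in> cball (snd c p) r" "q = chart_inv c x" by (auto simp: K_def)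
    then show "q \<in> fst c \<inter> U" using r(2) c(1) by auto
  qed
  have "continuous_on (cimg c U) (chart_inv c)"
    using is_chart[OF c(1)] by (auto simp: is_chart_def homeomorphism_def elim!: continuous_on_subset)
  then have "compact K" unfolding K_def
    by (intro compact_continuous_image continuous_on_subset[OF _ r(2)]) auto
  \<comment> \<open>Compact sets are closed in a Hausdorff space. Hence the points outside the chart
    domain have a neighbourhood that misses the support, and extension by 0 is smooth there.\<close>
  then have K: "open (- K)" using compact_imp_closed by blast
  have zero: "\<theta> q = 0" if "q \<notin> K" "q \<in> fst c" for q
  proof -
    have "snd c q \<notin> ball (snd c p) r"
    proof
      assume "snd c q \<in> ball (snd c p) r"
      then have "chart_inv c (snd c q) \<in> K" unfolding K_def by (intro imageI) auto
      then show False using that c(1) by simp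
    qed
    then show ?thesis by (simp add: \<theta>_def b)
  qed
  have bW: "smooth_on (cimg c U) b" by (rule smooth_on_subset[OF b(1)]) auto
  show ?thesis
  proof (rule that[of V \<theta>])
    show "open V" unfolding V_def by (rule open_chart_vimage[OF c(1) open_ball])
    show "p \<in> V" using c r by (simp add: V_def)
    show "V \<subseteq> fst c \<inter> U" by (rule VU)
    show "\<theta> q = 1" if "q \<in> V" for q using that by (simp add: V_def \<theta>_def b)
  next
    fix h :: "real ^ 'n \<Rightarrow> real" assume h: "smooth_on (cimg c U) h"
    let ?f = "\<lambda>q. if q \<in> fst c \<inter> U then \<theta> q * h (snd c q) else 0"
    show "smooth_fun A M ?f"
    proof (rule smooth_fun_local)
      fix q assume q: "q \<in> M"
      show "\<exists>c\<in>A. \<exists>V. open V \<and> q \<in> V \<and> V \<subseteq> fst c \<and> smooth_on (snd c ` V) (?f \<circ> chart_inv c)"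
      proof (cases "q \<in> fst c \<inter> U")
        case True
        have "smooth_on (cimg c U) (\<lambda>x. b x * h x)" by (intro smooth_on_mult oW bW h)
        then have "smooth_on (cimg c U) (?f \<circ> chart_inv c)"
          by (rule smooth_on_cong[OF oW(1), rotated]) (use c in \<open>auto simp: \<theta>_def\<close>)
        then show ?thesis using True c open_Int[OF open_chart[OF c(1)] U(1)]
          by (intro bexI[of _ c] exI[of _ "fst c \<inter> U"]) auto
      next
        case False
        let ?d = "chart_at A q" and ?V = "fst (chart_at A q) \<inter> - K"
        note d = chart_at_in[OF q] in_chart_at[OF q]
        have o: "open (cimg ?d (- K))" by (rule open_cimg[OF d(1) K])
        have "smooth_on (cimg ?d (- K)) (?f \<circ> chart_inv ?d)"
          by (rule smooth_on_cong[OF o _ smooth_on_const[OF o, of 0]]) (use d zero in auto)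
        then show ?thesis using False Ksub d open_chart[OF d(1)] K
          by (intro bexI[of _ ?d] exI[of _ ?V]) auto
      qed
    qed
  next
    fix H :: "real ^ 'n \<Rightarrow> real ^ 'n" assume H: "smooth_on (cimg c U) H"
    let ?f = "\<lambda>q. if q \<in> fst c \<inter> U then \<theta> q *\<^sub>R vec_of c q (H (snd c q)) else 0"
    show "?f \<in> vector_fields A M"
    proof (rule vector_field_local)
      fix q assume q: "q \<in> M"
      show "\<exists>c\<in>A. \<exists>V. open V \<and> q \<in> V \<and> V \<subseteq> fst c \<and> smooth_on (snd c ` V) (local_rep A c ?f)"
      proof (cases "q \<in> fst c \<inter> U")
        case True
        have "smooth_on (cimg c U) (\<lambda>x. b x *\<^sub>R H x)" by (intro smooth_on_scaleR oW bW H)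
        then have "smooth_on (cimg c U) (local_rep A c ?f)"
          by (rule smooth_on_cong[OF oW(1), rotated])
            (use c in \<open>auto simp: \<theta>_def local_rep_apply local_rep_scaled_vec_of\<close>)
        then show ?thesis using True c open_Int[OF open_chart[OF c(1)] U(1)]
          by (intro bexI[of _ c] exI[of _ "fst c \<inter> U"]) auto
      next
        case False
        let ?d = "chart_at A q" and ?V = "fst (chart_at A q) \<inter> - K"
        note d = chart_at_in[OF q] in_chart_at[OF q]
        have o: "open (cimg ?d (- K))" by (rule open_cimg[OF d(1) K])
        have "smooth_on (cimg ?d (- K)) (local_rep A ?d ?f)"
          by (rule smooth_on_cong[OF o _ smooth_on_const[OF o, of 0]])
            (use d zero coords_in_linear[OF d(1)] in \<open>auto simp: local_rep_apply linear_0\<close>)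
        then show ?thesis using False Ksub d open_chart[OF d(1)] K
          by (intro bexI[of _ ?d] exI[of _ ?V]) auto
      qed
    qed
  qed
qed

lemma constant_field:
  assumes U: "open U" "U \<subseteq> M" and c: "c \<in> A" "p \<in> fst c" "p \<in> U"
  obtains X V where "X \<in> vector_fields A M" "open V" "p \<in> V" "V \<subseteq> fst c \<inter> U"
    "\<And>q. q \<in> V \<Longrightarrow> coords_in A c q (X q) = w"
proof -
  obtain \<theta> :: "'a \<Rightarrow> real" and V where *: "open V" "p \<in> V" "V \<subseteq> fst c \<inter> U" "\<And>q. q \<in> V \<Longrightarrow> \<theta> q = 1"
    "\<And>h. smooth_on (cimg c U) h \<Longrightarrow> smooth_fun A M (\<lambda>q. if q \<in> fst c \<inter> U then \<theta> q * h (snd c q) else 0)"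
    "\<And>H. smooth_on (cimg c U) H \<Longrightarrow>
       (\<lambda>q. if q \<in> fst c \<inter> U then \<theta> q *\<^sub>R vec_of c q (H (snd c q)) else 0) \<in> vector_fields A M"
    by (rule cutoff[OF U c]) (rule that; assumption)
  have "(\<lambda>q. if q \<in> fst c \<inter> U then \<theta> q *\<^sub>R vec_of c q w else 0) \<in> vector_fields A M"
    by (rule *(6)[OF smooth_on_const[OF open_cimg[OF c(1) U(1)]]])
  then show ?thesis
    by (rule that[OF _ *(1,2,3)]) (use * c in auto)
qed

lemma constant_field_deriv:
  assumes "open V" "p \<in> V" "V \<subseteq> fst c" "c \<in> A" "\<And>q. q \<in> V \<Longrightarrow> coords_in A c q (X q) = w"
  shows "ddir (local_rep A c X) (snd c p) v = 0"
proof -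
  have "ddir (local_rep A c X) (snd c p) = ddir (\<lambda>_. w) (snd c p)"
    by (rule ddir_cong[OF open_cimg[OF assms(4,1)]]) (use assms in \<open>auto simp: local_rep_apply\<close>)
  then show ?thesis by (simp add: ddir_eqI[OF has_derivative_const])
qed

text \<open>Shows that the choice behind the Ricci tensor has a witness: a field with constant
  components near p in the chart at p.\<close>

lemma field_through:
  assumes U: "open U" "U \<subseteq> M" and p: "p \<in> U"
  shows "field_through A U p v \<in> vector_fields A U" "field_through A U p v p = v"
proof -
  have pM: "p \<in> M" using p U by auto
  obtain X V where "X \<in> vector_fields A M" "p \<in> V" "\<And>q. q \<in> V \<Longrightarrow> coords_in A (chart_at A p) q (X q) = v"
    using constant_field[OF U chart_at_in[OF pM] in_chart_at[OF pM] p] by metis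
  then have "\<exists>X. X \<in> vector_fields A U \<and> X p = v"
    using vector_fields_subset[OF _ U(2)] coords_in_chart_at[OF pM] by metis
  from someI_ex[OF this] show "field_through A U p v \<in> vector_fields A U" "field_through A U p v p = v"
    by (auto simp: field_through_def)
qed

end

section \<open>Christoffel symbols\<close>

text \<open>The second derivatives of G(w, z) commute. Writing each of them with the duality
  relation applied twice, the mixed products of \<Gamma> and \<open>\<Gamma>s\<close> cancel and the
  two curvatures remain.\<close>

lemma riem_dual:
  assumes S: "open S" "x \<in> S" and \<Gamma>: "smooth_bilinear_on S \<Gamma>" and \<Gamma>s: "smooth_bilinear_on S \<Gamma>s"
    and G: "smooth_bilinear_on S G"
    and dual: "\<And>x u v w. x \<in> S \<Longrightarrow> ddir (\<lambda>y. G y v w) x u = G x (\<Gamma> x u v) w + G x v (\<Gamma>s x u w)"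
  shows "G x (riem \<Gamma> x u v w) z = - (G x w (riem \<Gamma>s x u v z) :: real)"
proof -
  note Gl = bilinear_ladd[OF smooth_bilinear_onD(1)[OF G S(2)]] bilinear_radd[OF smooth_bilinear_onD(1)[OF G S(2)]]
    bilinear_lsub[OF smooth_bilinear_onD(1)[OF G S(2)]] bilinear_rsub[OF smooth_bilinear_onD(1)[OF G S(2)]]
  have e: "ddir (\<lambda>y. ddir (\<lambda>y. G y w z) y v) x u =
      ddir (\<lambda>y. G y (\<Gamma> x v w) z) x u + G x (ddir (\<lambda>y. \<Gamma> y v w) x u) z
      + (ddir (\<lambda>y. G y w (\<Gamma>s x v z)) x u + G x w (ddir (\<lambda>y. \<Gamma>s y v z) x u))" for u v
  proof -
    have "((\<lambda>y. G y (\<Gamma> y v w) z + G y w (\<Gamma>s y v z)) has_derivative (\<lambda>u.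
      (ddir (\<lambda>y. G y (\<Gamma> x v w) z) x u + G x (ddir (\<lambda>y. \<Gamma> y v w) x u) z + G x (\<Gamma> x v w) 0)
      + (ddir (\<lambda>y. G y w (\<Gamma>s x v z)) x u + G x 0 (\<Gamma>s x v z) + G x w (ddir (\<lambda>y. \<Gamma>s y v z) x u)))) (at x)"
      by (intro has_derivative_add smooth_bilinear_on_has_derivative[OF S(1) G S(2)] has_derivative_const
          smooth_on_has_derivative[OF smooth_bilinear_onD(2)[OF \<Gamma>] S(2)]
          smooth_on_has_derivative[OF smooth_bilinear_onD(2)[OF \<Gamma>s] S(2)])
    from ddir_eqI[OF this] ddir_cong[OF S, of "\<lambda>y. ddir (\<lambda>y. G y w z) y v"] dual
    show ?thesis
      by (simp add: bilinear_lzero[OF smooth_bilinear_onD(1)[OF G S(2)]]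
          bilinear_rzero[OF smooth_bilinear_onD(1)[OF G S(2)]])
  qed
  have "ddir (\<lambda>y. ddir (\<lambda>y. G y w z) y v) x u = ddir (\<lambda>y. ddir (\<lambda>y. G y w z) y u) x v"
    by (rule ddir_commute[OF S smooth_bilinear_onD(2)[OF G]])
  then show ?thesis
    unfolding e dual[OF S(2)] riem_def Gl by simp
qed

lemma smooth_bilinear_on_expansion:
  fixes f :: "'b::euclidean_space \<Rightarrow> 'b \<Rightarrow> 'b \<Rightarrow> 'c::real_normed_vector"
  assumes "open S" "\<And>a b. smooth_on S (f a b)"
  shows "smooth_bilinear_on S (\<lambda>x u v. \<Sum>a\<in>Basis. \<Sum>b\<in>Basis. ((u \<bullet> a) * (v \<bullet> b)) *\<^sub>R f a b x)"
  unfolding smooth_bilinear_on_def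
  by (intro conjI ballI allI bilinear_basis_sum smooth_on_sum smooth_on_scaleR smooth_on_const assms)

lemma smooth_bilinear_on_local:
  fixes B :: "'b::euclidean_space \<Rightarrow> 'c::euclidean_space \<Rightarrow> 'd::euclidean_space \<Rightarrow> 'e::real_normed_vector"
  assumes "\<And>x. x \<in> S \<Longrightarrow> \<exists>T C. open T \<and> x \<in> T \<and> smooth_bilinear_on T C \<and> (\<forall>y\<in>T. B y = C y)"
  shows "smooth_bilinear_on S B"
  unfolding smooth_bilinear_on_def
proof (intro conjI ballI allI)
  fix x assume "x \<in> S"
  from assms[OF this] show "bilinear (B x)" using smooth_bilinear_onD(1) by metis
next
  fix u v
  show "smooth_on S (\<lambda>x. B x u v)"
  proof (rule smooth_on_local)
    fix x assume "x \<in> S"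
    from assms[OF this] obtain T C where T: "open T" "x \<in> T" "smooth_bilinear_on T C" "\<And>y. y \<in> T \<Longrightarrow> B y = C y" by blast
    have "smooth_on T (\<lambda>x. B x u v)"
      by (rule smooth_on_cong[OF T(1) _ smooth_bilinear_onD(2)[OF T(3)]]) (simp add: T)
    then show "\<exists>T. open T \<and> x \<in> T \<and> smooth_on T (\<lambda>x. B x u v)" using T by blast
  qed
qed

text \<open>Kept as a relation because only the values of \<Gamma> over \<open>cimg c U\<close> are
  determined by the connection.\<close>

definition christoffel ::
  "('a, 'n::finite) chart set \<Rightarrow> 'a set \<Rightarrow> ('a, 'n) chart \<Rightarrow>
   (('a \<Rightarrow> real ^ 'n) \<Rightarrow> ('a \<Rightarrow> real ^ 'n) \<Rightarrow> 'a \<Rightarrow> real ^ 'n) \<Rightarrow>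
   (real ^ 'n \<Rightarrow> real ^ 'n \<Rightarrow> real ^ 'n \<Rightarrow> real ^ 'n) \<Rightarrow> bool" where
  "christoffel A U c D \<Gamma> \<longleftrightarrow> smooth_bilinear_on (cimg c U) \<Gamma> \<and>
     (\<forall>X\<in>vector_fields A U. \<forall>Y\<in>vector_fields A U. \<forall>p\<in>fst c \<inter> U.
        coords_in A c p (D X Y p) = ddir (local_rep A c Y) (snd c p) (coords_in A c p (X p))
          + \<Gamma> (snd c p) (coords_in A c p (X p)) (coords_in A c p (Y p)))"

context smooth_atlas
begin

lemma affine_connectionD:
  assumes "affine_connection A U D" "X \<in> vector_fields A U" "Y \<in> vector_fields A U"
  shows connection_field: "D X Y \<in> vector_fields A U"
    and connection_add1: "X' \<in> vector_fields A U \<Longrightarrow> p \<in> U \<Longrightarrow> D (\<lambda>q. X q + X' q) Y p = D X Y p + D X' Y p"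
    and connection_add2: "Y' \<in> vector_fields A U \<Longrightarrow> p \<in> U \<Longrightarrow> D X (\<lambda>q. Y q + Y' q) p = D X Y p + D X Y' p"
    and connection_scale1: "smooth_fun A U f \<Longrightarrow> p \<in> U \<Longrightarrow> D (\<lambda>q. f q *\<^sub>R X q) Y p = f p *\<^sub>R D X Y p"
    and connection_scale2: "smooth_fun A U f \<Longrightarrow> p \<in> U \<Longrightarrow>
      D X (\<lambda>q. f q *\<^sub>R Y q) p = dir_deriv A X f p *\<^sub>R Y p + f p *\<^sub>R D X Y p"
    and connection_cong: "X' \<in> vector_fields A U \<Longrightarrow> Y' \<in> vector_fields A U \<Longrightarrow> (\<And>q. q \<in> U \<Longrightarrow> X q = X' q)
      \<Longrightarrow> (\<And>q. q \<in> U \<Longrightarrow> Y q = Y' q) \<Longrightarrow> p \<in> U \<Longrightarrow> D X Y p = D X' Y' p"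
  using assms unfolding affine_connection_def by blast+

lemma vector_field_scale:
  assumes U: "open U" and f: "smooth_fun A U f" and X: "X \<in> vector_fields A U"
  shows "(\<lambda>q. f q *\<^sub>R X q) \<in> vector_fields A U"
  unfolding vector_fields_def
proof (rule CollectI, rule ballI)
  fix c assume c: "c \<in> A"
  have "smooth_on (cimg c U) (\<lambda>x. (f \<circ> chart_inv c) x *\<^sub>R local_rep A c X x)"
    by (intro smooth_on_scaleR open_cimg[OF c U] smooth_funD[OF f c] vector_fieldD[OF X c])
  then show "smooth_on (cimg c U) (local_rep A c (\<lambda>q. f q *\<^sub>R X q))"
    by (rule smooth_on_cong[OF open_cimg[OF c U], rotated])
      (use c coords_in_linear[OF c] in \<open>auto simp: local_rep_apply linear_cmul\<close>)
qed

lemma vector_field_add: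
  assumes U: "open U" and X: "X \<in> vector_fields A U" and Y: "Y \<in> vector_fields A U"
  shows "(\<lambda>q. X q + Y q) \<in> vector_fields A U"
  unfolding vector_fields_def
proof (rule CollectI, rule ballI)
  fix c assume c: "c \<in> A"
  have "smooth_on (cimg c U) (\<lambda>x. local_rep A c X x + local_rep A c Y x)"
    by (intro smooth_on_add open_cimg[OF c U] vector_fieldD[OF X c] vector_fieldD[OF Y c])
  then show "smooth_on (cimg c U) (local_rep A c (\<lambda>q. X q + Y q))"
    by (rule smooth_on_cong[OF open_cimg[OF c U], rotated])
      (use c coords_in_linear[OF c] in \<open>auto simp: local_rep_apply linear_add\<close>)
qed

lemma vector_field_sum:
  assumes U: "open U" and "finite I" "I \<noteq> {}" "\<And>i. i \<in> I \<Longrightarrow> smooth_fun A U (f i)" "\<And>i. i \<in> I \<Longrightarrow> E i \<in> vector_fields A U"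
  shows "(\<lambda>q. \<Sum>i\<in>I. f i q *\<^sub>R E i q) \<in> vector_fields A U"
  using assms(2-)
proof (induction I rule: finite_ne_induct)
  case (singleton i)
  then show ?case by (simp add: vector_field_scale[OF U])
next
  case (insert i I)
  have "(\<lambda>q. f i q *\<^sub>R E i q + (\<Sum>i\<in>I. f i q *\<^sub>R E i q)) \<in> vector_fields A U"
    using insert by (intro vector_field_add vector_field_scale U) auto
  then show ?case using insert by simp
qed

text \<open>Induction over nonempty sets starts at a single scaled field, so that the zero field
  never has to be treated.\<close>

lemma connection_sum1:
  assumes U: "open U" and D: "affine_connection A U D" and Y: "Y \<in> vector_fields A U" and p: "p \<in> U"
    and "finite I" "I \<noteq> {}" "\<And>i. i \<in> I \<Longrightarrow> smooth_fun A U (f i)" "\<And>i. i \<in> I \<Longrightarrow> E i \<in> vector_fields A U"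
  shows "D (\<lambda>q. \<Sum>i\<in>I. f i q *\<^sub>R E i q) Y p = (\<Sum>i\<in>I. f i p *\<^sub>R D (E i) Y p)"
  using assms(5-)
proof (induction I rule: finite_ne_induct)
  case (singleton i)
  then show ?case using connection_scale1[OF D _ Y _ p] by simp
next
  case (insert i I)
  have "D (\<lambda>q. f i q *\<^sub>R E i q + (\<Sum>i\<in>I. f i q *\<^sub>R E i q)) Y p =
     D (\<lambda>q. f i q *\<^sub>R E i q) Y p + D (\<lambda>q. \<Sum>i\<in>I. f i q *\<^sub>R E i q) Y p"
    using insert by (intro connection_add1[OF D _ Y] vector_field_scale vector_field_sum U p) auto
  then show ?case using insert connection_scale1[OF D _ Y _ p] by simp
qed

lemma connection_sum2:
  assumes U: "open U" and D: "affine_connection A U D" and X: "X \<in> vector_fields A U" and p: "p \<in> U"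
    and "finite I" "I \<noteq> {}" "\<And>i. i \<in> I \<Longrightarrow> smooth_fun A U (f i)" "\<And>i. i \<in> I \<Longrightarrow> E i \<in> vector_fields A U"
  shows "D X (\<lambda>q. \<Sum>i\<in>I. f i q *\<^sub>R E i q) p = (\<Sum>i\<in>I. dir_deriv A X (f i) p *\<^sub>R E i p + f i p *\<^sub>R D X (E i) p)"
  using assms(5-)
proof (induction I rule: finite_ne_induct)
  case (singleton i)
  then show ?case using connection_scale2[OF D X _ _ p] by simp
next
  case (insert i I)
  have "D X (\<lambda>q. f i q *\<^sub>R E i q + (\<Sum>i\<in>I. f i q *\<^sub>R E i q)) p =
     D X (\<lambda>q. f i q *\<^sub>R E i q) p + D X (\<lambda>q. \<Sum>i\<in>I. f i q *\<^sub>R E i q) p"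
    using insert by (intro connection_add2[OF D X] vector_field_scale vector_field_sum U p) auto
  then show ?case using insert connection_scale2[OF D X _ _ p] by simp
qed

text \<open>Multiplying a field by the square of a cutoff function \<open>\<theta>\<close> turns it into a combination of the
  global fields \<open>\<theta> \<partial>\<^sub>b\<close>, with coefficients \<open>\<theta> X\<^sup>b\<close>.\<close>

lemma christoffel_local:
  assumes U: "open U" "U \<subseteq> M" and D: "affine_connection A U D" and c: "c \<in> A" "p \<in> fst c" "p \<in> U"
  obtains V \<Gamma> where "open V" "p \<in> V" "V \<subseteq> fst c \<inter> U" "smooth_bilinear_on (snd c ` V) \<Gamma>"
    "\<And>X Y q. X \<in> vector_fields A U \<Longrightarrow> Y \<in> vector_fields A U \<Longrightarrow> q \<in> V \<Longrightarrow>
      coords_in A c q (D X Y q) = ddir (local_rep A c Y) (snd c q) (coords_in A c q (X q))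
          + \<Gamma> (snd c q) (coords_in A c q (X q)) (coords_in A c q (Y q))"
proof -
  obtain \<theta> :: "'a \<Rightarrow> real" and V where V: "open V" "p \<in> V" "V \<subseteq> fst c \<inter> U" and \<theta>: "\<And>q. q \<in> V \<Longrightarrow> \<theta> q = 1"
    and hM: "\<And>h. smooth_on (cimg c U) h \<Longrightarrow> smooth_fun A M (\<lambda>q. if q \<in> fst c \<inter> U then \<theta> q * h (snd c q) else 0)"
    and HM: "\<And>H. smooth_on (cimg c U) H \<Longrightarrow>
       (\<lambda>q. if q \<in> fst c \<inter> U then \<theta> q *\<^sub>R vec_of c q (H (snd c q)) else 0) \<in> vector_fields A M"
    by (rule cutoff[OF U c]) (rule that; assumption)
  define ct where "ct h q = (if q \<in> fst c \<inter> U then \<theta> q * h (snd c q) else 0)" for h :: "real ^ 'n \<Rightarrow> real" and q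
  define E where "E b q = (if q \<in> fst c \<inter> U then \<theta> q *\<^sub>R vec_of c q b else 0)" for b q
  have W: "open (cimg c U)" by (rule open_cimg[OF c(1) U(1)])
  have ct: "smooth_fun A U (ct h)" if "smooth_on (cimg c U) h" for h
    using smooth_fun_subset[OF hM[OF that] U(2)] by (simp add: ct_def[abs_def])
  have E: "E b \<in> vector_fields A U" for b
    using vector_fields_subset[OF HM[OF smooth_on_const[OF W, of b]] U(2)] by (simp add: E_def[abs_def])
  define co where "co X b x = local_rep A c X x \<bullet> b" for X b x
  have co: "smooth_on (cimg c U) (co X b)" if "X \<in> vector_fields A U" for X b
    unfolding co_def[abs_def] by (intro smooth_on_inner W vector_fieldD[OF that c(1)] smooth_on_const)
  define \<tau> where "\<tau> = (\<lambda>q. ct (\<lambda>_. 1) q * ct (\<lambda>_. 1) q)"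
  have \<tau>: "smooth_fun A U \<tau>"
    unfolding smooth_fun_def
  proof
    fix d assume d: "d \<in> A"
    have "smooth_on (cimg d U) (\<lambda>x. (ct (\<lambda>_. 1) \<circ> chart_inv d) x * (ct (\<lambda>_. 1) \<circ> chart_inv d) x)"
      by (intro smooth_on_mult open_cimg[OF d U(1)] smooth_funD[OF ct d] smooth_on_const W)
    then show "smooth_on (cimg d U) (\<tau> \<circ> chart_inv d)" by (simp add: \<tau>_def o_def)
  qed
  have \<tau>1: "\<tau> q = 1" if "q \<in> V" for q using \<theta>[OF that] V(3) that by (auto simp: \<tau>_def ct_def)
  \<comment> \<open>One factor \<theta> makes the coefficient a global function, the other makes the
    coordinate field global; hence the square.\<close>
  have dec: "(\<lambda>q. \<tau> q *\<^sub>R X q) = (\<lambda>q. \<Sum>b\<in>Basis. ct (co X b) q *\<^sub>R E b q)" for X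
  proof
    fix q show "\<tau> q *\<^sub>R X q = (\<Sum>b\<in>Basis. ct (co X b) q *\<^sub>R E b q)"
    proof (cases "q \<in> fst c \<inter> U")
      case True
      then have q: "q \<in> fst c" by simp
      have "X q = vec_of c q (coords_in A c q (X q))" using c q by simp
      also have "\<dots> = (\<Sum>b\<in>Basis. co X b (snd c q) *\<^sub>R vec_of c q b)"
        by (subst linear_basis_expand[OF vec_of_linear[OF c(1) q]]) (simp add: co_def local_rep_apply c q)
      finally show ?thesis using True
        by (simp add: \<tau>_def ct_def E_def scaleR_sum_right mult_ac)
    next
      case False
      then have "ct h q = 0" for h by (simp only: ct_def if_False)
      then show ?thesis by (simp add: \<tau>_def)
    qed
  qed
  have dct: "dir_deriv A X (ct h) q = ddir h (snd c q) (coords_in A c q (X q))" if h: "smooth_on (cimg c U) h" and q: "q \<in> V" for X h q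
  proof -
    have qc: "q \<in> fst c" "q \<in> U" using q V by auto
    have "ddir (ct h \<circ> chart_inv c) (snd c q) = ddir h (snd c q)"
      by (rule ddir_cong[OF open_cimg[OF c(1) V(1)]]) (use q V c \<theta> in \<open>auto simp: ct_def\<close>)
    then show ?thesis using dir_deriv_smooth[OF ct[OF h] c(1) qc] by simp
  qed
  have d\<tau>: "dir_deriv A X \<tau> q = 0" if q: "q \<in> V" for X q
  proof -
    have qc: "q \<in> fst c" "q \<in> U" using q V by auto
    have "ddir (\<tau> \<circ> chart_inv c) (snd c q) = ddir (\<lambda>_. 1) (snd c q)"
      by (rule ddir_cong[OF open_cimg[OF c(1) V(1)]]) (use q V c \<tau>1 in auto)
    then show ?thesis using dir_deriv_smooth[OF \<tau> c(1) qc] by (simp add: ddir_eqI[OF has_derivative_const])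
  qed
  have EV: "coords_in A c q (E b q) = b" if "q \<in> V" for q b
    using that V c \<theta>[OF that] by (auto simp: E_def)
  have step1: "D X Y q = (\<Sum>b\<in>Basis. co X b (snd c q) *\<^sub>R D (E b) Y q)"
    if X: "X \<in> vector_fields A U" and Y: "Y \<in> vector_fields A U" and q: "q \<in> V" for X Y q
  proof -
    have qc: "q \<in> fst c" "q \<in> U" using q V by auto
    have "D X Y q = D (\<lambda>q. \<tau> q *\<^sub>R X q) Y q"
      using connection_scale1[OF D X Y \<tau> qc(2)] \<tau>1[OF q] by simp
    also have "\<dots> = (\<Sum>b\<in>Basis. ct (co X b) q *\<^sub>R D (E b) Y q)"
      unfolding dec by (rule connection_sum1[OF U(1) D Y qc(2)]) (auto intro: ct co X E)
    finally show ?thesis using \<theta>[OF q] qc by (simp add: ct_def)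
  qed
  \<comment> \<open>In the second argument the Leibniz rule also differentiates \<tau>, which
    contributes nothing because \<tau> is constantly 1 on \<open>V\<close>.\<close>
  have step2: "D X Y q = (\<Sum>b\<in>Basis. ddir (co Y b) (snd c q) (coords_in A c q (X q)) *\<^sub>R E b q + co Y b (snd c q) *\<^sub>R D X (E b) q)"
    if X: "X \<in> vector_fields A U" and Y: "Y \<in> vector_fields A U" and q: "q \<in> V" for X Y q
  proof -
    have qc: "q \<in> fst c" "q \<in> U" using q V by auto
    have "D X Y q = D X (\<lambda>q. \<tau> q *\<^sub>R Y q) q"
      using connection_scale2[OF D X Y \<tau> qc(2)] \<tau>1[OF q] d\<tau>[OF q] by simp
    also have "\<dots> = (\<Sum>b\<in>Basis. dir_deriv A X (ct (co Y b)) q *\<^sub>R E b q + ct (co Y b) q *\<^sub>R D X (E b) q)"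
      unfolding dec by (rule connection_sum2[OF U(1) D X qc(2)]) (auto intro: ct co Y E)
    finally show ?thesis using \<theta>[OF q] qc by (simp add: ct_def[of _ q] dct[OF co[OF Y] q])
  qed
  define \<Gamma> where "\<Gamma> x u v = (\<Sum>a\<in>Basis. \<Sum>b\<in>Basis. ((u \<bullet> a) * (v \<bullet> b)) *\<^sub>R local_rep A c (D (E a) (E b)) x)" for x u v
  show ?thesis
  proof (rule that[OF V, of \<Gamma>])
    have V': "cimg c V = snd c ` V" using V(3) by (simp add: Int_absorb1)
    then have o: "open (snd c ` V)" using open_cimg[OF c(1) V(1)] by simp
    show "smooth_bilinear_on (snd c ` V) \<Gamma>"
      unfolding \<Gamma>_def
    proof (rule smooth_bilinear_on_expansion[OF o])
      show "smooth_on (snd c ` V) (local_rep A c (D (E a) (E b)))" for a b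
        by (rule smooth_on_subset[OF vector_fieldD[OF connection_field[OF D E E] c(1)]]) (use V in auto)
    qed
    fix X Y q assume X: "X \<in> vector_fields A U" and Y: "Y \<in> vector_fields A U" and q: "q \<in> V"
    have qc: "q \<in> fst c" "q \<in> U" using q V by auto
    let ?J = "coords_in A c q"
    note J = coords_in_linear[OF c(1) qc(1)]
    have "?J (D X Y q) = (\<Sum>b\<in>Basis. ddir (co Y b) (snd c q) (?J (X q)) *\<^sub>R b + co Y b (snd c q) *\<^sub>R ?J (D X (E b) q))"
      unfolding step2[OF X Y q] by (simp add: linear_sum[OF J] linear_add[OF J] linear_cmul[OF J] EV[OF q])
    also have "\<dots> = (\<Sum>b\<in>Basis. ddir (co Y b) (snd c q) (?J (X q)) *\<^sub>R b)
        + (\<Sum>b\<in>Basis. co Y b (snd c q) *\<^sub>R ?J (D X (E b) q))" by (rule sum.distrib)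
    also have "(\<Sum>b\<in>Basis. ddir (co Y b) (snd c q) (?J (X q)) *\<^sub>R b) = ddir (local_rep A c Y) (snd c q) (?J (X q))"
    proof -
      have "ddir (co Y b) (snd c q) v = ddir (local_rep A c Y) (snd c q) v \<bullet> b" for b v
        using ddir_eqI[OF has_derivative_inner_left[OF smooth_on_has_derivative[OF vector_fieldD[OF Y c(1)]], of "snd c q" b]] qc
        by (simp add: co_def[abs_def])
      then show ?thesis by (simp add: euclidean_representation)
    qed
    also have "(\<Sum>b\<in>Basis. co Y b (snd c q) *\<^sub>R ?J (D X (E b) q)) = \<Gamma> (snd c q) (?J (X q)) (?J (Y q))"
    proof -
      have "?J (D X (E b) q) = (\<Sum>a\<in>Basis. co X a (snd c q) *\<^sub>R ?J (D (E a) (E b) q))" for b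
        unfolding step1[OF X E q] by (simp add: linear_sum[OF J] linear_cmul[OF J])
      then have "(\<Sum>b\<in>Basis. co Y b (snd c q) *\<^sub>R ?J (D X (E b) q)) =
        (\<Sum>b\<in>Basis. \<Sum>a\<in>Basis. (co X a (snd c q) * co Y b (snd c q)) *\<^sub>R ?J (D (E a) (E b) q))"
        by (simp add: scaleR_sum_right mult.commute)
      also have "\<dots> = (\<Sum>a\<in>Basis. \<Sum>b\<in>Basis. (co X a (snd c q) * co Y b (snd c q)) *\<^sub>R ?J (D (E a) (E b) q))"
        by (rule sum.swap)
      finally show ?thesis using c qc by (simp add: \<Gamma>_def co_def local_rep_apply)
    qed
    finally show "?J (D X Y q) = ddir (local_rep A c Y) (snd c q) (?J (X q)) + \<Gamma> (snd c q) (?J (X q)) (?J (Y q))" .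
  qed
qed

text \<open>The local symbols fit together: at each point the bilinear map is determined by the
  connection, as fields with any prescribed values exist there. A pointwise choice therefore
  coincides with a smooth local symbol near every point.\<close>

lemma christoffel_exists:
  assumes U: "open U" "U \<subseteq> M" and D: "affine_connection A U D" and c: "c \<in> A"
  obtains \<Gamma> where "christoffel A U c D \<Gamma>"
proof -
  define Q where "Q q B \<longleftrightarrow> bilinear B \<and> (\<forall>X\<in>vector_fields A U. \<forall>Y\<in>vector_fields A U.
     coords_in A c q (D X Y q) = ddir (local_rep A c Y) (snd c q) (coords_in A c q (X q))
          + B (coords_in A c q (X q)) (coords_in A c q (Y q)))" for q B
  have uniq: "B = B'" if "Q q B" "Q q B'" "q \<in> fst c \<inter> U" for q B B'
  proof (intro ext)
    fix u v
    have q: "q \<in> fst c" "q \<in> U" using that by auto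
    obtain X where X: "X \<in> vector_fields A M" "coords_in A c q (X q) = u"
      using constant_field[OF U c q, of u] by metis
    obtain Y where Y: "Y \<in> vector_fields A M" "coords_in A c q (Y q) = v"
      using constant_field[OF U c q, of v] by metis
    have "ddir (local_rep A c Y) (snd c q) u + B u v = ddir (local_rep A c Y) (snd c q) u + B' u v"
      using that(1,2)[unfolded Q_def] X Y vector_fields_subset[OF X(1) U(2)] vector_fields_subset[OF Y(1) U(2)] by metis
    then show "B u v = B' u v" by simp
  qed
  have loc: "\<exists>V \<Gamma>. open V \<and> p \<in> V \<and> V \<subseteq> fst c \<inter> U \<and> smooth_bilinear_on (snd c ` V) \<Gamma> \<and> (\<forall>q\<in>V. Q q (\<Gamma> (snd c q)))"
    if p: "p \<in> fst c \<inter> U" for p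
  proof -
    have "p \<in> fst c" "p \<in> U" using p by auto
    from christoffel_local[OF U D c this] obtain V \<Gamma> where V: "open V" "p \<in> V" "V \<subseteq> fst c \<inter> U" "smooth_bilinear_on (snd c ` V) \<Gamma>"
      "\<And>X Y q. X \<in> vector_fields A U \<Longrightarrow> Y \<in> vector_fields A U \<Longrightarrow> q \<in> V \<Longrightarrow>
      coords_in A c q (D X Y q) = ddir (local_rep A c Y) (snd c q) (coords_in A c q (X q))
          + \<Gamma> (snd c q) (coords_in A c q (X q)) (coords_in A c q (Y q))" by blast
    then have "Q q (\<Gamma> (snd c q))" if "q \<in> V" for q
      using smooth_bilinear_onD(1)[OF V(4)] that unfolding Q_def by blast
    with V(1-4) show ?thesis by blast
  qed
  define \<Gamma> where "\<Gamma> x = (SOME B. Q (chart_inv c x) B)" for x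
  have P: "Q q (\<Gamma> (snd c q))" if q: "q \<in> fst c \<inter> U" for q
  proof -
    have "\<exists>B. Q q B" using loc[OF q] by blast
    from someI_ex[OF this] show ?thesis using q c by (simp add: \<Gamma>_def)
  qed
  show ?thesis
  proof (rule that)
    show "christoffel A U c D \<Gamma>"
      unfolding christoffel_def
    proof (intro conjI ballI)
      show "smooth_bilinear_on (cimg c U) \<Gamma>"
      proof (rule smooth_bilinear_on_local)
        fix x assume "x \<in> cimg c U"
        then obtain p where p: "p \<in> fst c \<inter> U" "x = snd c p" by auto
        obtain V \<Gamma>' where V: "open V" "p \<in> V" "V \<subseteq> fst c \<inter> U" "smooth_bilinear_on (snd c ` V) \<Gamma>'"
          "\<And>q. q \<in> V \<Longrightarrow> Q q (\<Gamma>' (snd c q))" using loc[OF p(1)] by blast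
        have V': "cimg c V = snd c ` V" using V(3) by (simp add: Int_absorb1)
        have o: "open (snd c ` V)" using open_cimg[OF c(1) V(1)] V' by simp
        have "\<Gamma> (snd c q) = \<Gamma>' (snd c q)" if "q \<in> V" for q
          by (rule uniq[OF P V(5)]) (use that V in auto)
        then show "\<exists>T C. open T \<and> x \<in> T \<and> smooth_bilinear_on T C \<and> (\<forall>y\<in>T. \<Gamma> y = C y)"
          using o V p by (intro exI[of _ "snd c ` V"] exI[of _ \<Gamma>']) auto
      qed
    qed (use P in \<open>unfold Q_def, blast\<close>)
  qed
qed

lemma christoffelD:
  assumes "christoffel A U c D \<Gamma>"
  shows "smooth_bilinear_on (cimg c U) \<Gamma>"
    "X \<in> vector_fields A U \<Longrightarrow> Y \<in> vector_fields A U \<Longrightarrow> p \<in> fst c \<Longrightarrow> p \<in> U \<Longrightarrow>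
      coords_in A c p (D X Y p) = ddir (local_rep A c Y) (snd c p) (coords_in A c p (X p))
          + \<Gamma> (snd c p) (coords_in A c p (X p)) (coords_in A c p (Y p))"
  using assms unfolding christoffel_def by blast+

text \<open>Test fields: with vanishing coordinate derivatives at p, brackets vanish at p and D X Y
  reduces there to the Christoffel term of the two values.\<close>

lemma coords_fieldE:
  assumes U: "open U" "U \<subseteq> M" and c: "c \<in> A" "p \<in> fst c" "p \<in> U"
  obtains X where "X \<in> vector_fields A M" "X \<in> vector_fields A U" "coords_in A c p (X p) = w"
    "\<And>v. ddir (local_rep A c X) (snd c p) v = 0"
proof -
  obtain X V where X: "X \<in> vector_fields A M" "open V" "p \<in> V" "V \<subseteq> fst c \<inter> U"
    "\<And>q. q \<in> V \<Longrightarrow> coords_in A c q (X q) = w" using constant_field[OF U c] by metis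
  show ?thesis
    by (rule that[of X])
      (use X vector_fields_subset[OF X(1) U(2)] constant_field_deriv[of V p c X w] c in auto)
qed

lemma christoffel_symmetric:
  assumes U: "open U" "U \<subseteq> M" and c: "c \<in> A" and \<Gamma>: "christoffel A U c D \<Gamma>" and tf: "torsion_free A U D"
    and x: "x \<in> cimg c U"
  shows "\<Gamma> x u v = \<Gamma> x v u"
proof -
  obtain p where p: "p \<in> fst c" "p \<in> U" "x = snd c p" using x by auto
  obtain X where X: "X \<in> vector_fields A U" "coords_in A c p (X p) = u" "\<And>v. ddir (local_rep A c X) (snd c p) v = 0"
    using coords_fieldE[OF U c p(1,2)] by metis
  obtain Y where Y: "Y \<in> vector_fields A U" "coords_in A c p (Y p) = v" "\<And>v. ddir (local_rep A c Y) (snd c p) v = 0"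
    using coords_fieldE[OF U c p(1,2)] by metis
  have "D X Y p - D Y X p = lie_bracket A X Y p" using tf X Y p unfolding torsion_free_def by blast
  then have "coords_in A c p (D X Y p) - coords_in A c p (D Y X p) = coords_in A c p (lie_bracket A X Y p)"
    using linear_diff[OF coords_in_linear[OF c p(1)]] by metis
  then show ?thesis
    by (simp add: christoffelD(2)[OF \<Gamma>] coords_lie_bracket[OF U(1) p(2) c p(1)] X Y p)
qed

text \<open>Proved for arbitrary fields, so it contains tensoriality: the second derivatives of Z
  cancel by symmetry, and every term with a first derivative of X or Y is matched by the bracket
  term.\<close>

lemma coords_curvature:
  assumes U: "open U" "U \<subseteq> M" and D: "affine_connection A U D" and c: "c \<in> A" and \<Gamma>: "christoffel A U c D \<Gamma>"
    and p: "p \<in> fst c" "p \<in> U"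
    and X: "X \<in> vector_fields A U" and Y: "Y \<in> vector_fields A U" and Z: "Z \<in> vector_fields A U"
  shows "coords_in A c p (curvature A D X Y Z p) =
    riem \<Gamma> (snd c p) (coords_in A c p (X p)) (coords_in A c p (Y p)) (coords_in A c p (Z p))"
proof -
  let ?S = "cimg c U" and ?x = "snd c p" and ?r = "local_rep A c"
  have S: "open ?S" "?x \<in> ?S" using open_cimg[OF c U(1)] p by auto
  note \<Gamma>1 = christoffelD(1)[OF \<Gamma>]
  note bil = smooth_bilinear_onD(1)[OF \<Gamma>1 S(2)]
  have rx: "?r W ?x = coords_in A c p (W p)" for W using c p by (simp add: local_rep_apply)
  have second: "coords_in A c p (D X (D Y Z) p) =
      ddir (\<lambda>y. ddir (?r Z) y (?r Y ?x)) ?x (?r X ?x) + ddir (?r Z) ?x (ddir (?r Y) ?x (?r X ?x))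
      + ddir (\<lambda>y. \<Gamma> y (?r Y ?x) (?r Z ?x)) ?x (?r X ?x)
      + \<Gamma> ?x (ddir (?r Y) ?x (?r X ?x)) (?r Z ?x) + \<Gamma> ?x (?r Y ?x) (ddir (?r Z) ?x (?r X ?x))
      + \<Gamma> ?x (?r X ?x) (ddir (?r Z) ?x (?r Y ?x)) + \<Gamma> ?x (?r X ?x) (\<Gamma> ?x (?r Y ?x) (?r Z ?x))"
    if X: "X \<in> vector_fields A U" and Y: "Y \<in> vector_fields A U" for X Y
  proof -
    have dY: "(?r Y has_derivative ddir (?r Y) ?x) (at ?x)" and dZ: "(?r Z has_derivative ddir (?r Z) ?x) (at ?x)"
      using smooth_on_has_derivative[OF vector_fieldD[OF _ c] S(2)] Y Z by auto
    have "((\<lambda>y. ddir (?r Z) y (?r Y y) + \<Gamma> y (?r Y y) (?r Z y)) has_derivative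
      (\<lambda>h. (ddir (\<lambda>y. ddir (?r Z) y (?r Y ?x)) ?x h + ddir (?r Z) ?x (ddir (?r Y) ?x h))
        + (ddir (\<lambda>y. \<Gamma> y (?r Y ?x) (?r Z ?x)) ?x h + \<Gamma> ?x (ddir (?r Y) ?x h) (?r Z ?x)
           + \<Gamma> ?x (?r Y ?x) (ddir (?r Z) ?x h)))) (at ?x)"
      by (intro has_derivative_add smooth_bilinear_on_has_derivative[OF S(1) \<Gamma>1 S(2) dY dZ]
          smooth_linear_on_has_derivative[OF S(1) smooth_linear_on_ddir[OF vector_fieldD[OF Z c]] S(2) dY])
    then have "(?r (D Y Z) has_derivative
      (\<lambda>h. (ddir (\<lambda>y. ddir (?r Z) y (?r Y ?x)) ?x h + ddir (?r Z) ?x (ddir (?r Y) ?x h))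
        + (ddir (\<lambda>y. \<Gamma> y (?r Y ?x) (?r Z ?x)) ?x h + \<Gamma> ?x (ddir (?r Y) ?x h) (?r Z ?x)
           + \<Gamma> ?x (?r Y ?x) (ddir (?r Z) ?x h)))) (at ?x)"
      by (rule has_derivative_transform_within_open[OF _ S])
        (use c in \<open>auto simp: local_rep_apply christoffelD(2)[OF \<Gamma> Y Z]\<close>)
    from ddir_eqI[OF this]
    show ?thesis
      using christoffelD(2)[OF \<Gamma> X connection_field[OF D Y Z] p] christoffelD(2)[OF \<Gamma> Y Z p]
      by (simp add: rx bilinear_radd[OF bil])
  qed
  have linZ: "linear (ddir (?r Z) ?x)" by (rule smooth_on_linear_ddir[OF vector_fieldD[OF Z c] S(2)])
  have br: "coords_in A c p (D (lie_bracket A X Y) Z p) =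
     ddir (?r Z) ?x (ddir (?r Y) ?x (?r X ?x)) - ddir (?r Z) ?x (ddir (?r X) ?x (?r Y ?x))
     + \<Gamma> ?x (ddir (?r Y) ?x (?r X ?x)) (?r Z ?x) - \<Gamma> ?x (ddir (?r X) ?x (?r Y ?x)) (?r Z ?x)"
    using christoffelD(2)[OF \<Gamma> lie_bracket_vector_field[OF U X Y] Z p]
    by (simp add: coords_lie_bracket[OF U(1) p(2) c p(1) X Y] rx linear_diff[OF linZ] bilinear_lsub[OF bil])
  have comm: "ddir (\<lambda>y. ddir (?r Z) y (?r Y ?x)) ?x (?r X ?x) = ddir (\<lambda>y. ddir (?r Z) y (?r X ?x)) ?x (?r Y ?x)"
    by (rule ddir_commute[OF S vector_fieldD[OF Z c]])
  show ?thesis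
    unfolding curvature_def linear_diff[OF coords_in_linear[OF c p(1)]] second[OF X Y] second[OF Y X] br comm
    by (simp add: riem_def rx)
qed

end

section \<open>Connections and volume forms on a chart domain\<close>

context smooth_atlas
begin

definition conn_of :: "('a, 'n) chart \<Rightarrow> (real ^ 'n \<Rightarrow> real ^ 'n \<Rightarrow> real ^ 'n \<Rightarrow> real ^ 'n) \<Rightarrow>
    ('a \<Rightarrow> real ^ 'n) \<Rightarrow> ('a \<Rightarrow> real ^ 'n) \<Rightarrow> 'a \<Rightarrow> real ^ 'n" where
  "conn_of c \<Gamma> X Y p = vec_of c p (ddir (local_rep A c Y) (snd c p) (coords_in A c p (X p))
     + \<Gamma> (snd c p) (coords_in A c p (X p)) (coords_in A c p (Y p)))"

lemma coords_conn_of: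
  assumes "c \<in> A" "p \<in> fst c"
  shows "coords_in A c p (conn_of c \<Gamma> X Y p) = ddir (local_rep A c Y) (snd c p) (coords_in A c p (X p))
     + \<Gamma> (snd c p) (coords_in A c p (X p)) (coords_in A c p (Y p))"
  by (simp only: conn_of_def coords_vec_of[OF assms])

lemma christoffel_conn_of:
  assumes "c \<in> A" "smooth_bilinear_on (cimg c U) \<Gamma>"
  shows "christoffel A U c (conn_of c \<Gamma>) \<Gamma>"
  unfolding christoffel_def using assms by (auto simp: coords_conn_of)

lemma affine_connection_conn_of:
  assumes c: "c \<in> A" and U: "open U" "U \<subseteq> fst c" and \<Gamma>: "smooth_bilinear_on (cimg c U) \<Gamma>"
  shows "affine_connection A U (conn_of c \<Gamma>)"
proof -
  note W = open_cimg[OF c U(1)]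
  have cU: "cimg c U = snd c ` U" using U(2) by (simp add: Int_absorb1)
  have inW: "snd c p \<in> cimg c U" "p \<in> fst c" if "p \<in> U" for p using that U by auto
  have rep: "local_rep A c X x = coords_in A c p (X p)" if "p \<in> U" "x = snd c p" for X x p
    using that inW c by (simp add: local_rep_apply)
  have field: "conn_of c \<Gamma> X Y \<in> vector_fields A U" if X: "X \<in> vector_fields A U" and Y: "Y \<in> vector_fields A U" for X Y
  proof (rule vector_field_chart[OF c U])
    have "smooth_on (cimg c U) (\<lambda>x. ddir (local_rep A c Y) x (local_rep A c X x) + \<Gamma> x (local_rep A c X x) (local_rep A c Y x))"
      by (intro smooth_on_add[OF W] smooth_bilinear_on_apply[OF W \<Gamma>]
          smooth_linear_on_apply[OF W smooth_linear_on_ddir] vector_fieldD[OF X c] vector_fieldD[OF Y c])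
    then have "smooth_on (cimg c U) (local_rep A c (conn_of c \<Gamma> X Y))"
      by (rule smooth_on_cong[OF W, rotated]) (use c in \<open>auto simp: local_rep_apply coords_conn_of\<close>)
    then show "smooth_on (snd c ` U) (local_rep A c (conn_of c \<Gamma> X Y))" by (simp only: cU)
  qed
  have cong: "conn_of c \<Gamma> X Y p = conn_of c \<Gamma> X' Y' p"
    if "\<forall>q\<in>U. X q = X' q \<and> Y q = Y' q" "p \<in> U" for X X' Y Y' p
  proof -
    have "ddir (local_rep A c Y) (snd c p) = ddir (local_rep A c Y') (snd c p)"
      by (rule ddir_cong[OF W inW(1)[OF that(2)]]) (use that c in \<open>auto simp: local_rep_apply\<close>)
    then show ?thesis using that by (simp add: conn_of_def)
  qed
  have dY: "(local_rep A c Y has_derivative ddir (local_rep A c Y) (snd c p)) (at (snd c p))"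
    if "Y \<in> vector_fields A U" "p \<in> U" for Y p
    by (rule smooth_on_has_derivative[OF vector_fieldD[OF that(1) c] inW(1)[OF that(2)]])
  have eqI: "conn_of c \<Gamma> X Y p = v"
    if "p \<in> U" "coords_in A c p (conn_of c \<Gamma> X Y p) = coords_in A c p v" for X Y p v
    using coords_inject[OF c inW(2)[OF that(1)] that(2)] .
  have lin: "linear (coords_in A c p)" if "p \<in> U" for p
    by (rule coords_in_linear[OF c inW(2)[OF that]])
  have bil: "bilinear (\<Gamma> (snd c p))" if "p \<in> U" for p
    by (rule smooth_bilinear_onD(1)[OF \<Gamma> inW(1)[OF that]])
  have ld: "linear (ddir (local_rep A c Y) (snd c p))" if "Y \<in> vector_fields A U" "p \<in> U" for Y p
    using dY[OF that] has_derivative_linear by blast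
  have add1: "conn_of c \<Gamma> (\<lambda>q. X q + X' q) Y p = conn_of c \<Gamma> X Y p + conn_of c \<Gamma> X' Y p"
    if Y: "Y \<in> vector_fields A U" and p: "p \<in> U" for X X' Y p
    by (rule eqI[OF p]) (simp add: coords_conn_of c inW[OF p] linear_add[OF lin[OF p]] linear_add[OF ld[OF Y p]]
        bilinear_ladd[OF bil[OF p]])
  have scale1: "conn_of c \<Gamma> (\<lambda>q. f q *\<^sub>R X q) Y p = f p *\<^sub>R conn_of c \<Gamma> X Y p"
    if Y: "Y \<in> vector_fields A U" and p: "p \<in> U" for X Y p and f :: "'a \<Rightarrow> real"
    by (rule eqI[OF p]) (simp add: coords_conn_of c inW[OF p] linear_cmul[OF lin[OF p]] linear_cmul[OF ld[OF Y p]]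
        bilinear_lmul[OF bil[OF p]] scaleR_add_right)
  have add2: "conn_of c \<Gamma> X (\<lambda>q. Y q + Y' q) p = conn_of c \<Gamma> X Y p + conn_of c \<Gamma> X Y' p"
    if Y: "Y \<in> vector_fields A U" and Y': "Y' \<in> vector_fields A U" and p: "p \<in> U" for X Y Y' p
  proof (rule eqI[OF p])
    have "(local_rep A c (\<lambda>q. Y q + Y' q) has_derivative
        (\<lambda>v. ddir (local_rep A c Y) (snd c p) v + ddir (local_rep A c Y') (snd c p) v)) (at (snd c p))"
      by (rule has_derivative_transform_within_open[OF has_derivative_add[OF dY[OF Y p] dY[OF Y' p]] W inW(1)[OF p]])
        (use c lin in \<open>auto simp: local_rep_apply linear_add\<close>)
    then show "coords_in A c p (conn_of c \<Gamma> X (\<lambda>q. Y q + Y' q) p) = coords_in A c p (conn_of c \<Gamma> X Y p + conn_of c \<Gamma> X Y' p)"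
      by (simp add: coords_conn_of c inW[OF p] linear_add[OF lin[OF p]] bilinear_radd[OF bil[OF p]] ddir_eqI)
  qed
  have scale2: "conn_of c \<Gamma> X (\<lambda>q. f q *\<^sub>R Y q) p = dir_deriv A X f p *\<^sub>R Y p + f p *\<^sub>R conn_of c \<Gamma> X Y p"
    if f: "smooth_fun A U f" and Y: "Y \<in> vector_fields A U" and p: "p \<in> U" for f X Y p
  proof (rule eqI[OF p])
    have "((f \<circ> chart_inv c) has_derivative ddir (f \<circ> chart_inv c) (snd c p)) (at (snd c p))"
      by (rule smooth_on_has_derivative[OF smooth_funD[OF f c] inW(1)[OF p]])
    from has_derivative_scaleR[OF this dY[OF Y p]]
    have "(local_rep A c (\<lambda>q. f q *\<^sub>R Y q) has_derivative
        (\<lambda>v. (f \<circ> chart_inv c) (snd c p) *\<^sub>R ddir (local_rep A c Y) (snd c p) v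
           + ddir (f \<circ> chart_inv c) (snd c p) v *\<^sub>R local_rep A c Y (snd c p))) (at (snd c p))"
      by (rule has_derivative_transform_within_open[OF _ W inW(1)[OF p]])
        (use c lin in \<open>auto simp: local_rep_apply linear_cmul\<close>)
    from ddir_eqI[OF this] have "ddir (local_rep A c (\<lambda>q. f q *\<^sub>R Y q)) (snd c p) v = f p *\<^sub>R ddir (local_rep A c Y) (snd c p) v
           + ddir (f \<circ> chart_inv c) (snd c p) v *\<^sub>R coords_in A c p (Y p)" for v
      using c inW[OF p] by (simp add: rep[OF p refl])
    then show "coords_in A c p (conn_of c \<Gamma> X (\<lambda>q. f q *\<^sub>R Y q) p) =
        coords_in A c p (dir_deriv A X f p *\<^sub>R Y p + f p *\<^sub>R conn_of c \<Gamma> X Y p)"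
      by (simp add: coords_conn_of c inW[OF p] linear_add[OF lin[OF p]] linear_cmul[OF lin[OF p]]
          bilinear_rmul[OF bil[OF p]] dir_deriv_smooth[OF f c inW(2)[OF p] p] scaleR_add_right)
  qed
  show ?thesis
    unfolding affine_connection_def
    by (intro conjI ballI allI impI field cong add1 add2 scale1 scale2) (assumption | blast)+
qed

lemma torsion_free_conn_of:
  assumes c: "c \<in> A" and U: "open U" "U \<subseteq> fst c" and sym: "\<And>x u v. x \<in> cimg c U \<Longrightarrow> \<Gamma> x u v = \<Gamma> x v u"
  shows "torsion_free A U (conn_of c \<Gamma>)"
  unfolding torsion_free_def
proof (intro ballI)
  fix X Y p assume X: "X \<in> vector_fields A U" and Y: "Y \<in> vector_fields A U" and p: "p \<in> U"
  have pc: "p \<in> fst c" using p U by auto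
  have x: "snd c p \<in> cimg c U" using p pc by auto
  show "conn_of c \<Gamma> X Y p - conn_of c \<Gamma> Y X p = lie_bracket A X Y p"
    by (rule coords_inject[OF c pc])
      (simp add: linear_diff[OF coords_in_linear[OF c pc]] coords_conn_of c pc coords_lie_bracket[OF U(1) p c pc X Y]
        sym[OF x, of "coords_in A c p (Y p)"])
qed

lemma flat_conn_of:
  assumes c: "c \<in> A" and U: "open U" "U \<subseteq> fst c" and \<Gamma>: "smooth_bilinear_on (cimg c U) \<Gamma>"
    and R: "\<And>x u v w. x \<in> cimg c U \<Longrightarrow> riem \<Gamma> x u v w = 0"
  shows "flat A U (conn_of c \<Gamma>)"
  unfolding flat_def
proof (intro ballI)
  fix X Y Z p assume X: "X \<in> vector_fields A U" and Y: "Y \<in> vector_fields A U" and Z: "Z \<in> vector_fields A U" and p: "p \<in> U"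
  have pc: "p \<in> fst c" using p U by auto
  have UM: "U \<subseteq> M" using U chart_subset[OF c] by auto
  have "coords_in A c p (curvature A (conn_of c \<Gamma>) X Y Z p) = 0"
    using coords_curvature[OF U(1) UM affine_connection_conn_of[OF c U \<Gamma>] c christoffel_conn_of[OF c \<Gamma>] pc p X Y Z] R p pc
    by simp
  then show "curvature A (conn_of c \<Gamma>) X Y Z p = 0"
    using coords_inject[OF c pc, of _ 0] linear_0[OF coords_in_linear[OF c pc]] by simp
qed

definition coord_volume :: "('a, 'n) chart \<Rightarrow> (real ^ 'n \<Rightarrow> real) \<Rightarrow> 'a \<Rightarrow> ('n \<Rightarrow> real ^ 'n) \<Rightarrow> real" where
  "coord_volume c f p u = f (snd c p) * det (\<chi> i. coords_in A c p (u i))"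

lemma smooth_on_det:
  fixes F :: "'k \<Rightarrow> 'b::real_normed_vector \<Rightarrow> real ^ 'k::finite"
  assumes "open S" "\<And>i. smooth_on S (F i)"
  shows "smooth_on S (\<lambda>x. det (\<chi> i. F i x))"
  unfolding det_def
  using assms by (simp, intro smooth_on_sum smooth_on_mult smooth_on_prod smooth_on_const
      smooth_on_linear[OF bounded_linear_vec_nth])

lemma det_row_linear:
  fixes z :: "'k::finite \<Rightarrow> real ^ 'k"
  shows "linear (\<lambda>v. det (\<chi> k. if k = i then v else z k))"
  unfolding linear_iff
proof (intro conjI allI)
  show "det (\<chi> k. if k = i then x + y else z k) = det (\<chi> k. if k = i then x else z k) + det (\<chi> k. if k = i then y else z k)" for x y
    using det_row_add[of i "\<lambda>_. x" "\<lambda>_. y" z] .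
  show "det (\<chi> k. if k = i then a *\<^sub>R x else z k) = a *\<^sub>R det (\<chi> k. if k = i then x else z k)" for a x
    using det_row_mul[of i a "\<lambda>_. x" z] by (simp add: scalar_mult_eq_scaleR cong: if_cong)
qed

lemma volume_form_coord_volume:
  assumes c: "c \<in> A" and V: "open V" "V \<subseteq> fst c" and f: "smooth_on (cimg c V) f" "\<And>x. x \<in> cimg c V \<Longrightarrow> f x \<noteq> 0"
  shows "volume_form A V (coord_volume c f)"
  unfolding volume_form_def
proof (intro conjI ballI allI impI)
  fix p assume p: "p \<in> V"
  then have pc: "p \<in> fst c" using V by auto
  note lin = coords_in_linear[OF c pc]
  have upd: "(\<chi> k. coords_in A c p ((u(i := v)) k)) = (\<chi> k. if k = i then coords_in A c p v else coords_in A c p (u k))" for u i v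
    by (simp add: vec_eq_iff)
  show "linear (\<lambda>v. coord_volume c f p (u(i := v)))" for i u
    unfolding linear_iff coord_volume_def upd
    by (simp add: linear_add[OF lin] linear_cmul[OF lin] linear_add[OF det_row_linear] linear_cmul[OF det_row_linear]
        distrib_left cong: if_cong)
  show "coord_volume c f p u = 0" if "i \<noteq> j" "u i = u j" for i j u
    unfolding coord_volume_def
    using det_identical_rows[OF that(1), of "\<chi> i. coords_in A c p (u i)"] that(2) by (simp add: row_def)
  have "det (\<chi> i. coords_in A c p (vec_of c p (axis i 1))) = det (mat 1 :: real ^ 'n ^ 'n)"
    using c pc by (intro arg_cong[of _ _ det]) (simp add: vec_eq_iff mat_def axis_def)
  then have "coord_volume c f p (\<lambda>i. vec_of c p (axis i 1)) \<noteq> 0"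
    using f(2)[of "snd c p"] p pc by (simp add: coord_volume_def)
  then show "\<exists>u. coord_volume c f p u \<noteq> 0" by blast
next
  fix Y :: "'n \<Rightarrow> 'a \<Rightarrow> real ^ 'n" assume Y: "\<forall>i. Y i \<in> vector_fields A V"
  have cV: "cimg c V = snd c ` V" using V(2) by (simp add: Int_absorb1)
  show "smooth_fun A V (\<lambda>p. coord_volume c f p (\<lambda>i. Y i p))"
  proof (rule smooth_fun_chart[OF c V])
    have "smooth_on (cimg c V) (\<lambda>x. f x * det (\<chi> i. local_rep A c (Y i) x))"
      using Y by (intro smooth_on_mult smooth_on_det open_cimg c V f(1) vector_fieldD) auto
    then have "smooth_on (cimg c V) ((\<lambda>p. coord_volume c f p (\<lambda>i. Y i p)) \<circ> chart_inv c)"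
      by (rule smooth_on_cong[OF open_cimg[OF c V(1)], rotated])
        (use c in \<open>auto simp: coord_volume_def local_rep_apply\<close>)
    then show "smooth_on (snd c ` V) ((\<lambda>p. coord_volume c f p (\<lambda>i. Y i p)) \<circ> chart_inv c)" by (simp only: cV)
  qed
qed

text \<open>Differentiating the determinant row by row reproduces the derivative parts of D X (Y j).
  The Christoffel parts add up to tr \<Gamma> times the determinant, which the equation for f
  balances.\<close>

lemma parallel_coord_volume:
  assumes c: "c \<in> A" and U: "open U" and V: "open V" "V \<subseteq> fst c" "V \<subseteq> U" and \<Gamma>: "christoffel A U c D \<Gamma>"
    and f: "\<And>x. x \<in> cimg c V \<Longrightarrow> (f has_derivative (\<lambda>v. trace (matrix (\<Gamma> x v)) * f x)) (at x)"
  shows "parallel_on A U V D (coord_volume c f)"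
  unfolding parallel_on_def
proof (intro ballI allI impI)
  fix X :: "'a \<Rightarrow> real ^ 'n" and Y :: "'n \<Rightarrow> 'a \<Rightarrow> real ^ 'n" and p
  assume X: "X \<in> vector_fields A U" and Y': "\<forall>i. Y i \<in> vector_fields A U" and p: "p \<in> V"
  have Y: "Y i \<in> vector_fields A U" for i using Y' by blast
  have pc: "p \<in> fst c" "p \<in> U" using p V by auto
  let ?x = "snd c p" and ?J = "coords_in A c p"
  have x: "?x \<in> cimg c V" "?x \<in> cimg c U" using p pc by auto
  have lin\<Gamma>: "linear (\<Gamma> ?x (?J (X p)))" using smooth_bilinear_onD(3)[OF christoffelD(1)[OF \<Gamma>] x(2)] .
  have dY: "(local_rep A c (Y i) has_derivative ddir (local_rep A c (Y i)) ?x) (at ?x)" for i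
    by (rule smooth_on_has_derivative[OF vector_fieldD[OF Y c] x(2)])
  have rY: "local_rep A c (Y i) ?x = ?J (Y i p)" for i using c pc by (simp add: local_rep_apply)
  let ?y = "\<lambda>i. ?J (Y i p)" and ?d = "\<lambda>i. ddir (local_rep A c (Y i)) ?x (?J (X p))"
  have "((\<lambda>x. f x * det (\<chi> i. local_rep A c (Y i) x)) has_derivative
     (\<lambda>h. f ?x * (\<Sum>j\<in>UNIV. det (\<chi> i. if i = j then ddir (local_rep A c (Y i)) ?x h else local_rep A c (Y i) ?x))
        + (trace (matrix (\<Gamma> ?x h)) * f ?x) * det (\<chi> i. local_rep A c (Y i) ?x))) (at ?x)"
    by (rule has_derivative_mult[OF f[OF x(1)] det_has_derivative[OF dY]])
  then have der: "(((\<lambda>q. coord_volume c f q (\<lambda>i. Y i q)) \<circ> chart_inv c) has_derivative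
     (\<lambda>h. f ?x * (\<Sum>j\<in>UNIV. det (\<chi> i. if i = j then ddir (local_rep A c (Y i)) ?x h else local_rep A c (Y i) ?x))
        + (trace (matrix (\<Gamma> ?x h)) * f ?x) * det (\<chi> i. local_rep A c (Y i) ?x))) (at ?x)"
    by (rule has_derivative_transform_within_open[OF _ open_cimg[OF c V(1)] x(1)])
      (use c in \<open>auto simp: coord_volume_def local_rep_apply\<close>)
  then have "((\<lambda>q. coord_volume c f q (\<lambda>i. Y i q)) \<circ> chart_inv c) differentiable (at ?x)"
    by (auto simp: differentiable_def)
  from dir_deriv_chart[OF c pc(1) this, of X]
  have d: "dir_deriv A X (\<lambda>q. coord_volume c f q (\<lambda>i. Y i q)) p =
     f ?x * (\<Sum>j\<in>UNIV. det (\<chi> i. if i = j then ?d i else ?y i))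
        + (trace (matrix (\<Gamma> ?x (?J (X p)))) * f ?x) * det (\<chi> i. ?y i)"
    unfolding ddir_eqI[OF der] rY .
  have "coord_volume c f p ((\<lambda>i. Y i p)(j := D X (Y j) p)) =
      f ?x * det (\<chi> i. if i = j then ?d i else ?y i) + f ?x * det (\<chi> i. if i = j then \<Gamma> ?x (?J (X p)) (?y i) else ?y i)" for j
  proof -
    have "(\<chi> i. ?J (((\<lambda>i. Y i p)(j := D X (Y j) p)) i)) = (\<chi> i. if i = j then ?d i + \<Gamma> ?x (?J (X p)) (?y i) else ?y i)"
      using christoffelD(2)[OF \<Gamma> X Y pc] by (simp add: vec_eq_iff)
    then show ?thesis unfolding coord_volume_def by (simp add: det_row_add distrib_left)
  qed
  then have "(\<Sum>j\<in>UNIV. coord_volume c f p ((\<lambda>i. Y i p)(j := D X (Y j) p))) =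
     f ?x * (\<Sum>j\<in>UNIV. det (\<chi> i. if i = j then ?d i else ?y i)) + f ?x * (trace (matrix (\<Gamma> ?x (?J (X p)))) * det (\<chi> i. ?y i))"
    by (simp only: sum.distrib sum_distrib_left[symmetric] sum_det_apply[OF lin\<Gamma>])
  then show "dir_deriv A X (\<lambda>q. coord_volume c f q (\<lambda>i. Y i q)) p
     - (\<Sum>j\<in>UNIV. coord_volume c f p ((\<lambda>i. Y i p)(j := D X (Y j) p))) = 0"
    unfolding d by simp
qed

lemma locally_equiaffine_conn_of:
  assumes c: "c \<in> A" and U: "open U" "U \<subseteq> fst c" and \<Gamma>: "smooth_bilinear_on (cimg c U) \<Gamma>"
    and sym: "\<And>x u v. x \<in> cimg c U \<Longrightarrow> \<Gamma> x u v = \<Gamma> x v u"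
    and tr: "\<And>x u v. x \<in> cimg c U \<Longrightarrow> trace (matrix (riem \<Gamma> x u v)) = 0"
  shows "locally_equiaffine A U (conn_of c \<Gamma>)"
  unfolding locally_equiaffine_def
proof (intro conjI ballI affine_connection_conn_of[OF c U \<Gamma>] torsion_free_conn_of[OF c U sym])
  fix p assume p: "p \<in> U"
  then have x: "snd c p \<in> cimg c U" using U by auto
  obtain r f where r: "r > 0" "ball (snd c p) r \<subseteq> cimg c U" and f: "smooth_on (ball (snd c p) r) f"
    "\<And>x. x \<in> ball (snd c p) r \<Longrightarrow> f x \<noteq> 0"
    "\<And>x. x \<in> ball (snd c p) r \<Longrightarrow> (f has_derivative (\<lambda>v. trace (matrix (\<Gamma> x v)) * f x)) (at x)"
    by (rule local_parallel_density[OF open_cimg[OF c U(1)] x \<Gamma> sym tr]) (assumption | rule that)+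
  define V where "V = U \<inter> (fst c \<inter> snd c -` ball (snd c p) r)"
  have V: "open V" "V \<subseteq> fst c" "V \<subseteq> U" unfolding V_def
    using open_chart_vimage[OF c open_ball] U by auto
  have cV: "cimg c V \<subseteq> ball (snd c p) r" unfolding V_def by auto
  have "volume_form A V (coord_volume c f)"
    by (rule volume_form_coord_volume[OF c V(1,2) smooth_on_subset[OF f(1) cV]]) (use f(2) cV in blast)
  moreover have "parallel_on A U V (conn_of c \<Gamma>) (coord_volume c f)"
    by (rule parallel_coord_volume[OF c U(1) V christoffel_conn_of[OF c \<Gamma>]]) (use f(3) cV in blast)
  moreover have "p \<in> V" using p U r by (auto simp: V_def)
  ultimately show "\<exists>V \<omega>. open V \<and> p \<in> V \<and> V \<subseteq> U \<and> volume_form A V \<omega> \<and> parallel_on A U V (conn_of c \<Gamma>) \<omega>"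
    using V by blast
qed simp_all

text \<open>In X \<rho>(Y) - Y \<rho>(X) the derivatives of the fields assemble into \<rho>([X, Y]);
  what remains is the skew part of the derivative of \<rho>.\<close>

lemma closed_one_form_coords:
  assumes c: "c \<in> A" and U: "open U" "U \<subseteq> fst c" and \<rho>: "smooth_linear_on (cimg c U) \<rho>"
    and cl: "\<And>x u v. x \<in> cimg c U \<Longrightarrow> ddir (\<lambda>y. \<rho> y v) x u = ddir (\<lambda>y. \<rho> y u) x v"
  shows "closed_one_form A U (\<lambda>p v. \<rho> (snd c p) (coords_in A c p v))"
  unfolding closed_one_form_def one_form_def
proof (intro conjI ballI)
  note W = open_cimg[OF c U(1)]
  have cU: "cimg c U = snd c ` U" using U(2) by (simp add: Int_absorb1)
  have inW: "snd c p \<in> cimg c U" "p \<in> fst c" if "p \<in> U" for p using that U by auto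
  show "linear (\<lambda>v. \<rho> (snd c p) (coords_in A c p v))" if "p \<in> U" for p
    using linear_compose[OF coords_in_linear[OF c inW(2)[OF that]] smooth_linear_onD(1)[OF \<rho> inW(1)[OF that]]]
    by (simp add: o_def)
  have eq: "((\<lambda>p. \<rho> (snd c p) (coords_in A c p (X p))) \<circ> chart_inv c) x = \<rho> x (local_rep A c X x)" if "x \<in> cimg c U" for X x
    using that c by (auto simp: local_rep_apply)
  show sf: "smooth_fun A U (\<lambda>p. \<rho> (snd c p) (coords_in A c p (X p)))" if X: "X \<in> vector_fields A U" for X
  proof (rule smooth_fun_chart[OF c U])
    show "smooth_on (snd c ` U) ((\<lambda>p. \<rho> (snd c p) (coords_in A c p (X p))) \<circ> chart_inv c)"
      unfolding cU[symmetric]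
      by (rule smooth_on_cong[OF W eq[symmetric] smooth_linear_on_apply[OF W \<rho> vector_fieldD[OF X c]]])
  qed
  fix X Y p assume X: "X \<in> vector_fields A U" and Y: "Y \<in> vector_fields A U" and p: "p \<in> U"
  let ?x = "snd c p"
  have d: "dir_deriv A X (\<lambda>q. \<rho> (snd c q) (coords_in A c q (Y q))) p =
      ddir (\<lambda>y. \<rho> y (coords_in A c p (Y p))) ?x (coords_in A c p (X p)) + \<rho> ?x (ddir (local_rep A c Y) ?x (coords_in A c p (X p)))"
    if X: "X \<in> vector_fields A U" and Y: "Y \<in> vector_fields A U" for X Y
  proof -
    have "((\<lambda>x. \<rho> x (local_rep A c Y x)) has_derivative
       (\<lambda>h. ddir (\<lambda>y. \<rho> y (local_rep A c Y ?x)) ?x h + \<rho> ?x (ddir (local_rep A c Y) ?x h))) (at ?x)"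
      by (rule smooth_linear_on_has_derivative[OF W \<rho> inW(1)[OF p]
          smooth_on_has_derivative[OF vector_fieldD[OF Y c] inW(1)[OF p]]])
    then have "(((\<lambda>p. \<rho> (snd c p) (coords_in A c p (Y p))) \<circ> chart_inv c) has_derivative
       (\<lambda>h. ddir (\<lambda>y. \<rho> y (local_rep A c Y ?x)) ?x h + \<rho> ?x (ddir (local_rep A c Y) ?x h))) (at ?x)"
      by (rule has_derivative_transform_within_open[OF _ W inW(1)[OF p] eq[symmetric]])
    from ddir_eqI[OF this] dir_deriv_smooth[OF sf[OF Y] c inW(2)[OF p] p, of X] show ?thesis
      using c inW[OF p] by (simp add: local_rep_apply)
  qed
  show "dir_deriv A X (\<lambda>q. \<rho> (snd c q) (coords_in A c q (Y q))) p - dir_deriv A Y (\<lambda>q. \<rho> (snd c q) (coords_in A c q (X q))) p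
     - \<rho> (snd c p) (coords_in A c p (lie_bracket A X Y p)) = 0"
    unfolding d[OF X Y] d[OF Y X] coords_lie_bracket[OF U(1) p c inW(2)[OF p] X Y]
      linear_diff[OF smooth_linear_onD(1)[OF \<rho> inW(1)[OF p]]] cl[OF inW(1)[OF p], of "coords_in A c p (Y p)"]
    by simp
qed

end

section \<open>Statistical manifolds of constant curvature\<close>

lemma smooth_bilinear_on_subset: "smooth_bilinear_on S B \<Longrightarrow> T \<subseteq> S \<Longrightarrow> smooth_bilinear_on T B"
  unfolding smooth_bilinear_on_def using smooth_on_subset[of S _ T] by blast

lemma cimg_mono: "U \<subseteq> W \<Longrightarrow> cimg c U \<subseteq> cimg c W"
  by blast

lemma smooth_proj_tensor:
  assumes "open S" "smooth_bilinear_on S \<Gamma>" "smooth_linear_on S \<rho>"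
  shows "smooth_on S (\<lambda>y. proj_tensor \<Gamma> \<rho> y u w)"
  unfolding proj_tensor_def
  by (intro smooth_on_diff smooth_on_mult smooth_on_ddir smooth_linear_onD(2)[OF assms(3)] assms(1)
      smooth_linear_on_apply[OF assms(1,3) smooth_bilinear_onD(2)[OF assms(2)]])

lemma proj_tensor_bilinear:
  assumes S: "x \<in> S" and \<Gamma>: "smooth_bilinear_on S \<Gamma>" "\<And>u v. \<Gamma> x u v = \<Gamma> x v u"
    and \<rho>: "smooth_linear_on S \<rho>" "\<And>u v. ddir (\<lambda>y. \<rho> y v) x u = ddir (\<lambda>y. \<rho> y u) x v"
  shows "bilinear (proj_tensor \<Gamma> \<rho> x)" "proj_tensor \<Gamma> \<rho> x u v = proj_tensor \<Gamma> \<rho> x v u"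
proof -
  have sym: "proj_tensor \<Gamma> \<rho> x u v = proj_tensor \<Gamma> \<rho> x v u" for u v
    by (simp add: proj_tensor_def \<Gamma>(2)[of u v] \<rho>(2)[of v u])
  then show "proj_tensor \<Gamma> \<rho> x u v = proj_tensor \<Gamma> \<rho> x v u" .
  have lin: "linear (\<lambda>u. proj_tensor \<Gamma> \<rho> x u v)" for v
    using smooth_on_linear_ddir[OF smooth_linear_onD(2)[OF \<rho>(1)] S, of v]
      smooth_linear_onD(1)[OF \<rho>(1) S] smooth_bilinear_onD(4)[OF \<Gamma>(1) S, of v]
    unfolding linear_iff proj_tensor_def by (simp add: algebra_simps)
  have "linear (\<lambda>v. proj_tensor \<Gamma> \<rho> x u v)" for u
    using lin[of u] sym[of u] by (metis (no_types, lifting) ext)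
  with lin show "bilinear (proj_tensor \<Gamma> \<rho> x)" by (simp add: bilinear_def)
qed

section \<open>The coordinate form of a statistical structure\<close>

locale statistical = smooth_atlas M A
  for M :: "'a::{t2_space, second_countable_topology} set" and A :: "('a, 'n::finite) chart set" +
  fixes g :: "'a \<Rightarrow> real ^ 'n \<Rightarrow> real ^ 'n \<Rightarrow> real"
    and D Ds :: "('a \<Rightarrow> real ^ 'n) \<Rightarrow> ('a \<Rightarrow> real ^ 'n) \<Rightarrow> 'a \<Rightarrow> real ^ 'n"
  assumes stat: "statistical_manifold M A g D" and dual: "dual_connection A M g D Ds"
begin

lemma metric:
  assumes "p \<in> M"
  shows "bilinear (g p)" "g p v w = g p w v" "(\<And>w. g p v w = 0) \<Longrightarrow> v = 0"
  using assms stat unfolding statistical_manifold_def pseudo_riemannian_def by blast+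

lemma metric_smooth: "X \<in> vector_fields A M \<Longrightarrow> Y \<in> vector_fields A M \<Longrightarrow> smooth_fun A M (\<lambda>p. g p (X p) (Y p))"
  using stat unfolding statistical_manifold_def pseudo_riemannian_def by blast

lemma connections: "affine_connection A M D" "torsion_free A M D" "affine_connection A M Ds" "torsion_free A M Ds"
  using stat dual unfolding statistical_manifold_def dual_connection_def by blast+

definition Gam where "Gam c = (SOME \<Gamma>. christoffel A M c D \<Gamma>)"
definition Gams where "Gams c = (SOME \<Gamma>. christoffel A M c Ds \<Gamma>)"
definition met where "met c x u v = g (chart_inv c x) (vec_of c (chart_inv c x) u) (vec_of c (chart_inv c x) v)"

lemma Gam: assumes c: "c \<in> A"
  shows "christoffel A M c D (Gam c)" "christoffel A M c Ds (Gams c)"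
proof -
  have "\<exists>\<Gamma>. christoffel A M c D \<Gamma>"
    by (rule christoffel_exists[OF open_M subset_refl connections(1) c]) (rule exI)
  then show "christoffel A M c D (Gam c)" unfolding Gam_def by (rule someI_ex)
  have "\<exists>\<Gamma>. christoffel A M c Ds \<Gamma>"
    by (rule christoffel_exists[OF open_M subset_refl connections(3) c]) (rule exI)
  then show "christoffel A M c Ds (Gams c)" unfolding Gams_def by (rule someI_ex)
qed

lemma Gam_smooth: "c \<in> A \<Longrightarrow> smooth_bilinear_on (cimg c M) (Gam c)" "c \<in> A \<Longrightarrow> smooth_bilinear_on (cimg c M) (Gams c)"
  using christoffelD(1)[OF Gam(1)] christoffelD(1)[OF Gam(2)] by auto

lemma Gam_sym: "c \<in> A \<Longrightarrow> x \<in> cimg c M \<Longrightarrow> Gam c x u v = Gam c x v u"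
  by (rule christoffel_symmetric[OF open_M subset_refl _ Gam(1) connections(2)])

lemma in_cimg: "c \<in> A \<Longrightarrow> p \<in> fst c \<Longrightarrow> snd c p \<in> cimg c M" and in_M: "c \<in> A \<Longrightarrow> p \<in> fst c \<Longrightarrow> p \<in> M"
  using chart_subset by blast+

lemma met_coords: "c \<in> A \<Longrightarrow> p \<in> fst c \<Longrightarrow> met c (snd c p) (coords_in A c p v) (coords_in A c p w) = g p v w"
  by (simp add: met_def)

text \<open>Smoothness of g is given only on global fields, so each component is recovered near a
  point from two fields that have constant components there.\<close>

lemma met_smooth:
  assumes c: "c \<in> A" shows "smooth_bilinear_on (cimg c M) (met c)"
  unfolding smooth_bilinear_on_def
proof (intro conjI ballI allI)
  fix x assume "x \<in> cimg c M"
  then obtain p where p: "p \<in> fst c" "x = snd c p" by auto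
  note b = metric(1)[OF in_M[OF c p(1)]] and l = vec_of_linear[OF c p(1)]
  show "bilinear (met c x)"
    unfolding bilinear_def linear_iff met_def p(2) chart_inv[OF c p(1)]
    by (simp add: linear_add[OF l] linear_cmul[OF l] bilinear_ladd[OF b] bilinear_radd[OF b]
        bilinear_lmul[OF b] bilinear_rmul[OF b])
next
  fix u v
  show "smooth_on (cimg c M) (\<lambda>x. met c x u v)"
  proof (rule smooth_on_local)
    fix x assume "x \<in> cimg c M"
    then obtain p where p: "p \<in> fst c" "x = snd c p" by auto
    note pM = in_M[OF c p(1)]
    obtain X V where X: "X \<in> vector_fields A M" "open V" "p \<in> V" "V \<subseteq> fst c \<inter> M" "\<And>q. q \<in> V \<Longrightarrow> coords_in A c q (X q) = u"
      using constant_field[OF open_M subset_refl c p(1) pM, of u] by metis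
    obtain Y W where Y: "Y \<in> vector_fields A M" "open W" "p \<in> W" "W \<subseteq> fst c \<inter> M" "\<And>q. q \<in> W \<Longrightarrow> coords_in A c q (Y q) = v"
      using constant_field[OF open_M subset_refl c p(1) pM, of v] by metis
    have o: "open (cimg c (V \<inter> W))" using open_cimg[OF c] X(2) Y(2) by blast
    have sub: "cimg c (V \<inter> W) \<subseteq> cimg c M" using X(4) by blast
    have "smooth_on (cimg c (V \<inter> W)) (\<lambda>x. met c x u v)"
    proof (rule smooth_on_cong[OF o _ smooth_on_subset[OF smooth_funD[OF metric_smooth[OF X(1) Y(1)] c] sub]])
      fix y assume "y \<in> cimg c (V \<inter> W)"
      then obtain q where q: "q \<in> fst c" "q \<in> V" "q \<in> W" "y = snd c q" by auto
      show "((\<lambda>p. g p (X p) (Y p)) \<circ> chart_inv c) y = met c y u v"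
        using met_coords[OF c q(1), of "X q" "Y q"] X(5)[OF q(2)] Y(5)[OF q(3)] c q by simp
    qed
    then show "\<exists>T. open T \<and> x \<in> T \<and> smooth_on T (\<lambda>x. met c x u v)"
      using o p X(3) Y(3) by (intro exI[of _ "cimg c (V \<inter> W)"]) auto
  qed
qed

lemma met_sym: "c \<in> A \<Longrightarrow> x \<in> cimg c M \<Longrightarrow> met c x u v = met c x v u"
  using metric(2) in_M by (auto simp: met_def)

lemma met_nondeg:
  assumes c: "c \<in> A" "x \<in> cimg c M" and v: "\<forall>w. met c x v w = 0" shows "v = 0"
proof -
  obtain p where p: "p \<in> fst c" "x = snd c p" using c by auto
  have "g p (vec_of c p v) w = 0" for w
    using v met_coords[OF c(1) p(1), of "vec_of c p v" w] c p by simp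
  then have "vec_of c p v = 0" by (rule metric(3)[OF in_M[OF c(1) p(1)]])
  then have "coords_in A c p (vec_of c p v) = 0" using linear_0[OF coords_in_linear[OF c(1) p(1)]] by simp
  then show ?thesis using c p by simp
qed

lemma coordinate_field:
  assumes c: "c \<in> A" "p \<in> fst c"
  obtains X where "X \<in> vector_fields A M" "coords_in A c p (X p) = w" "\<And>v. ddir (local_rep A c X) (snd c p) v = 0"
  using coords_fieldE[OF open_M subset_refl c in_M[OF c], of w] by metis

lemma dir_deriv_metric:
  assumes c: "c \<in> A" "p \<in> fst c" and X: "X \<in> vector_fields A M" and Y: "Y \<in> vector_fields A M" and Z: "Z \<in> vector_fields A M"
    and dY: "\<And>v. ddir (local_rep A c Y) (snd c p) v = 0" and dZ: "\<And>v. ddir (local_rep A c Z) (snd c p) v = 0"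
  shows "dir_deriv A X (\<lambda>q. g q (Y q) (Z q)) p =
    ddir (\<lambda>y. met c y (coords_in A c p (Y p)) (coords_in A c p (Z p))) (snd c p) (coords_in A c p (X p))"
proof -
  note W = open_cimg[OF c(1) open_M] and x = in_cimg[OF c]
  have r: "local_rep A c Y (snd c p) = coords_in A c p (Y p)" for Y using c by (simp add: local_rep_apply)
  have b: "bilinear (met c (snd c p))" by (rule smooth_bilinear_onD(1)[OF met_smooth[OF c(1)] x])
  have "((\<lambda>y. met c y (local_rep A c Y y) (local_rep A c Z y)) has_derivative
    (\<lambda>h. ddir (\<lambda>y. met c y (local_rep A c Y (snd c p)) (local_rep A c Z (snd c p))) (snd c p) h
      + met c (snd c p) (ddir (local_rep A c Y) (snd c p) h) (local_rep A c Z (snd c p))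
      + met c (snd c p) (local_rep A c Y (snd c p)) (ddir (local_rep A c Z) (snd c p) h))) (at (snd c p))"
    by (rule smooth_bilinear_on_has_derivative[OF W met_smooth[OF c(1)] x
        smooth_on_has_derivative[OF vector_fieldD[OF Y c(1)] x] smooth_on_has_derivative[OF vector_fieldD[OF Z c(1)] x]])
  then have "(((\<lambda>q. g q (Y q) (Z q)) \<circ> chart_inv c) has_derivative
    (\<lambda>h. ddir (\<lambda>y. met c y (coords_in A c p (Y p)) (coords_in A c p (Z p))) (snd c p) h)) (at (snd c p))"
    unfolding dY dZ r bilinear_lzero[OF b] bilinear_rzero[OF b] add_0_right
    by (rule has_derivative_transform_within_open[OF _ W x])
      (use c in \<open>auto simp: local_rep_apply met_coords\<close>)
  from ddir_eqI[OF this] dir_deriv_smooth[OF metric_smooth[OF Y Z] c in_M[OF c], of X] show ?thesis by simp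
qed

text \<open>Evaluation on test fields turns covariant derivatives into Christoffel terms. In the
  Codazzi equation the terms g(D X Y, Z) and g(D Y X, Z) have already cancelled by symmetry of
  \<open>Gam\<close>.\<close>

lemma met_derivative:
  assumes c: "c \<in> A" "x \<in> cimg c M"
  shows met_dual: "ddir (\<lambda>y. met c y v w) x u = met c x (Gam c x u v) w + met c x v (Gams c x u w)"
    and met_codazzi: "ddir (\<lambda>y. met c y v w) x u - met c x v (Gam c x u w) = ddir (\<lambda>y. met c y u w) x v - met c x u (Gam c x v w)"
proof -
  obtain p where p: "p \<in> fst c" "x = snd c p" using c by auto
  note pM = in_M[OF c(1) p(1)]
  obtain X where X: "X \<in> vector_fields A M" "coords_in A c p (X p) = u" "\<And>v. ddir (local_rep A c X) (snd c p) v = 0"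
    using coordinate_field[OF c(1) p(1)] by metis
  obtain Y where Y: "Y \<in> vector_fields A M" "coords_in A c p (Y p) = v" "\<And>v. ddir (local_rep A c Y) (snd c p) v = 0"
    using coordinate_field[OF c(1) p(1)] by metis
  obtain Z where Z: "Z \<in> vector_fields A M" "coords_in A c p (Z p) = w" "\<And>v. ddir (local_rep A c Z) (snd c p) v = 0"
    using coordinate_field[OF c(1) p(1)] by metis
  note m = met_coords[OF c(1) p(1), symmetric] and ch = christoffelD(2)[OF Gam(1)[OF c(1)] _ _ p(1) pM]
    and chs = christoffelD(2)[OF Gam(2)[OF c(1)] _ _ p(1) pM]
  have "dir_deriv A X (\<lambda>q. g q (Y q) (Z q)) p = g p (D X Y p) (Z p) + g p (Y p) (Ds X Z p)"
    using dual X(1) Y(1) Z(1) pM unfolding dual_connection_def by blast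
  then show "ddir (\<lambda>y. met c y v w) x u = met c x (Gam c x u v) w + met c x v (Gams c x u w)"
    unfolding dir_deriv_metric[OF c(1) p(1) X(1) Y(1) Z(1) Y(3) Z(3)] m
    by (simp add: ch[OF X(1) Y(1)] chs[OF X(1) Z(1)] X Y Z p(2))
  have "cubic_form A g D X Y Z p = cubic_form A g D Y X Z p"
    using stat X(1) Y(1) Z(1) pM unfolding statistical_manifold_def by blast
  then show "ddir (\<lambda>y. met c y v w) x u - met c x v (Gam c x u w) = ddir (\<lambda>y. met c y u w) x v - met c x u (Gam c x v w)"
    unfolding cubic_form_def dir_deriv_metric[OF c(1) p(1) X(1) Y(1) Z(1) Y(3) Z(3)]
      dir_deriv_metric[OF c(1) p(1) Y(1) X(1) Z(1) X(3) Z(3)] m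
    by (simp add: ch[OF X(1) Y(1)] ch[OF Y(1) X(1)] ch[OF X(1) Z(1)] ch[OF Y(1) Z(1)] X Y Z p(2)
        Gam_sym[OF c(1) in_cimg[OF c(1) p(1)], of v u])
qed

lemma riem_duality:
  assumes c: "c \<in> A" "x \<in> cimg c M"
  shows "met c x (riem (Gam c) x u v w) z = - met c x w (riem (Gams c) x u v z)"
  by (rule riem_dual[where S="cimg c M" and \<Gamma>="Gam c" and \<Gamma>s="Gams c" and G="met c", OF open_cimg[OF c(1) open_M] c(2) Gam_smooth(1)[OF c(1)] Gam_smooth(2)[OF c(1)] met_smooth[OF c(1)]
        met_dual[OF c(1)]])

section \<open>Constant curvature implies conjugate symmetry and projective flatness\<close>

text \<open>Separates the algebraic shape of the curvature at one point from the constancy of k,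
  which is a differential statement.\<close>

definition curvature_at :: "real \<Rightarrow> 'a \<Rightarrow> bool" where
  "curvature_at k p \<longleftrightarrow> (\<forall>X\<in>vector_fields A M. \<forall>Y\<in>vector_fields A M. \<forall>Z\<in>vector_fields A M.
     curvature A D X Y Z p = k *\<^sub>R (g p (Y p) (Z p) *\<^sub>R X p - g p (X p) (Z p) *\<^sub>R Y p))"

lemma constant_curvature_iff: "constant_curvature A M g D \<longleftrightarrow> (\<exists>k. \<forall>p\<in>M. curvature_at k p)"
  unfolding constant_curvature_def curvature_at_def by blast

lemma curvature_at_iff:
  assumes c: "c \<in> A" "p \<in> fst c"
  shows "curvature_at k p \<longleftrightarrow> (\<forall>u v w. riem (Gam c) (snd c p) u v w =
    k *\<^sub>R (met c (snd c p) v w *\<^sub>R u - met c (snd c p) u w *\<^sub>R v))" (is "_ = ?R")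
proof
  note pM = in_M[OF c] and lin = coords_in_linear[OF c]
  note cc = coords_curvature[OF open_M subset_refl connections(1) c(1) Gam(1)[OF c(1)] c(2) pM]
  {
    assume k: "curvature_at k p"
    show ?R
    proof (intro allI)
      fix u v w
      obtain X where X: "X \<in> vector_fields A M" "coords_in A c p (X p) = u" using coordinate_field[OF c] by metis
      obtain Y where Y: "Y \<in> vector_fields A M" "coords_in A c p (Y p) = v" using coordinate_field[OF c] by metis
      obtain Z where Z: "Z \<in> vector_fields A M" "coords_in A c p (Z p) = w" using coordinate_field[OF c] by metis
      have "curvature A D X Y Z p = k *\<^sub>R (g p (Y p) (Z p) *\<^sub>R X p - g p (X p) (Z p) *\<^sub>R Y p)"
        using k X(1) Y(1) Z(1) unfolding curvature_at_def by blast
      then have "coords_in A c p (curvature A D X Y Z p) = k *\<^sub>R (g p (Y p) (Z p) *\<^sub>R u - g p (X p) (Z p) *\<^sub>R v)"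
        by (simp add: linear_diff[OF lin] linear_cmul[OF lin] X Y)
      then show "riem (Gam c) (snd c p) u v w = k *\<^sub>R (met c (snd c p) v w *\<^sub>R u - met c (snd c p) u w *\<^sub>R v)"
        unfolding cc[OF X(1) Y(1) Z(1)] met_coords[OF c, symmetric] X Y Z .
    qed
  }
  {
    assume R: ?R
    show "curvature_at k p"
      unfolding curvature_at_def
    proof (intro ballI)
      fix X Y Z assume X: "X \<in> vector_fields A M" and Y: "Y \<in> vector_fields A M" and Z: "Z \<in> vector_fields A M"
      show "curvature A D X Y Z p = k *\<^sub>R (g p (Y p) (Z p) *\<^sub>R X p - g p (X p) (Z p) *\<^sub>R Y p)"
        by (rule coords_inject[OF c])
          (simp add: cc[OF X Y Z] R linear_diff[OF lin] linear_cmul[OF lin] met_coords[OF c])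
    qed
  }
qed

text \<open>By duality the dual curvature is minus the g-adjoint of the curvature. The endomorphism
  w \<mapsto> k (g(v, w)u - g(u, w)v) is skew for g, hence equal to minus its own adjoint.\<close>

lemma constant_curvature_imp_conjugate_symmetric:
  assumes k: "\<And>p. p \<in> M \<Longrightarrow> curvature_at k p"
  shows "conjugate_symmetric A M D Ds"
  unfolding conjugate_symmetric_def
proof (intro ballI)
  fix X Y Z p
  assume X: "X \<in> vector_fields A M" and Y: "Y \<in> vector_fields A M" and Z: "Z \<in> vector_fields A M" and p: "p \<in> M"
  define c where "c = chart_at A p"
  have c: "c \<in> A" "p \<in> fst c" using chart_at_in[OF p] in_chart_at[OF p] by (auto simp: c_def)
  let ?x = "snd c p"
  note x = in_cimg[OF c]
  note b = smooth_bilinear_onD(1)[OF met_smooth[OF c(1)] x]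
  have R: "riem (Gam c) ?x u v w = k *\<^sub>R (met c ?x v w *\<^sub>R u - met c ?x u w *\<^sub>R v)" for u v w
    using k[OF p] curvature_at_iff[OF c] by blast
  have "riem (Gams c) ?x u v z = riem (Gam c) ?x u v z" for u v z
  proof -
    have "met c ?x (riem (Gams c) ?x u v z - riem (Gam c) ?x u v z) w = 0" for w
      using riem_duality[OF c(1) x, of u v w z]
      by (simp add: R bilinear_lsub[OF b] bilinear_lmul[OF b] bilinear_ladd[OF b] met_sym[OF c(1) x, of w] algebra_simps)
    then show ?thesis using met_nondeg[OF c(1) x] by (metis right_minus_eq)
  qed
  then have "coords_in A c p (curvature A D X Y Z p) = coords_in A c p (curvature A Ds X Y Z p)"
    using coords_curvature[OF open_M subset_refl connections(1) c(1) Gam(1)[OF c(1)] c(2) p X Y Z]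
      coords_curvature[OF open_M subset_refl connections(3) c(1) Gam(2)[OF c(1)] c(2) p X Y Z]
    by simp
  then show "curvature A D X Y Z p = curvature A Ds X Y Z p" by (rule coords_inject[OF c])
qed

lemma constant_curvature_imp_projectively_flat:
  assumes k: "\<And>p. p \<in> M \<Longrightarrow> curvature_at k p"
  shows "projectively_flat A M D"
  unfolding projectively_flat_def
proof
  fix p assume p: "p \<in> M"
  define c where "c = chart_at A p"
  have c: "c \<in> A" "p \<in> fst c" using chart_at_in[OF p] in_chart_at[OF p] by (auto simp: c_def)
  let ?S = "cimg c M"
  have R: "riem (Gam c) x u v w = k *\<^sub>R (met c x v w *\<^sub>R u - met c x u w *\<^sub>R v)" if "x \<in> ?S" for x u v w
  proof -
    obtain q where q: "q \<in> fst c" "q \<in> M" "x = snd c q" using \<open>x \<in> ?S\<close> by auto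
    then show ?thesis using k curvature_at_iff[OF c(1) q(1)] by blast
  qed
  obtain r \<rho> where r: "r > 0" "ball (snd c p) r \<subseteq> ?S" and \<rho>: "smooth_linear_on (ball (snd c p) r) \<rho>"
    and cl: "\<And>x u v. x \<in> ball (snd c p) r \<Longrightarrow> ddir (\<lambda>y. \<rho> y v) x u = ddir (\<lambda>y. \<rho> y u) x v"
    and P: "\<And>x u w. x \<in> ball (snd c p) r \<Longrightarrow> proj_tensor (Gam c) \<rho> x u w = k * met c x u w"
    by (rule local_projective[where S="cimg c M" and \<Gamma>="Gam c" and G="met c" and k=k, OF open_cimg[OF c(1) open_M] in_cimg[OF c] Gam_smooth(1)[OF c(1)] Gam_sym[OF c(1)]
          met_smooth[OF c(1)] met_sym[OF c(1)] met_codazzi[OF c(1)] R]) (assumption | rule that)+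
  define U where "U = fst c \<inter> snd c -` ball (snd c p) r"
  have U: "open U" "U \<subseteq> fst c" "p \<in> U" unfolding U_def using open_chart_vimage[OF c(1) open_ball] c r by auto
  have UM: "U \<subseteq> M" using U(2) chart_subset[OF c(1)] by blast
  have cU: "cimg c U \<subseteq> ball (snd c p) r" by (auto simp: U_def)
  then have cM: "cimg c U \<subseteq> ?S" using r by blast
  note W = open_cimg[OF c(1) U(1)]
  have \<Gamma>: "smooth_bilinear_on (cimg c U) (Gam c)" by (rule smooth_bilinear_on_subset[OF Gam_smooth(1)[OF c(1)] cM])
  have \<Gamma>s: "Gam c x u v = Gam c x v u" if "x \<in> cimg c U" for x u v using Gam_sym[OF c(1)] that cM by blast
  have \<rho>U: "smooth_linear_on (cimg c U) \<rho>" using \<rho> cU smooth_on_subset unfolding smooth_linear_on_def by blast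
  have clU: "ddir (\<lambda>y. \<rho> y v) x u = ddir (\<lambda>y. \<rho> y u) x v" if "x \<in> cimg c U" for x u v using cl that cU by blast
  define \<Gamma>' where "\<Gamma>' x u v = Gam c x u v + \<rho> x u *\<^sub>R v + \<rho> x v *\<^sub>R u" for x u v
  have \<Gamma>': "smooth_bilinear_on (cimg c U) \<Gamma>'"
    unfolding smooth_bilinear_on_def
  proof (intro conjI ballI allI)
    fix x assume x: "x \<in> cimg c U"
    note b = smooth_bilinear_onD(1)[OF \<Gamma> x] and l = smooth_linear_onD(1)[OF \<rho>U x]
    show "bilinear (\<Gamma>' x)" unfolding \<Gamma>'_def bilinear_def linear_iff
      by (simp add: bilinear_ladd[OF b] bilinear_radd[OF b] bilinear_lmul[OF b] bilinear_rmul[OF b]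
          linear_add[OF l] linear_cmul[OF l] algebra_simps)
  next
    show "smooth_on (cimg c U) (\<lambda>x. \<Gamma>' x u v)" for u v unfolding \<Gamma>'_def
      by (intro smooth_on_add smooth_on_scaleR smooth_on_const W smooth_bilinear_onD(2)[OF \<Gamma>] smooth_linear_onD(2)[OF \<rho>U])
  qed
  have \<Gamma>'s: "\<Gamma>' x u v = \<Gamma>' x v u" if "x \<in> cimg c U" for x u v
    using \<Gamma>s[OF that] by (simp add: \<Gamma>'_def)
  \<comment> \<open>P = k g, so the projective change subtracts exactly the constant curvature
    expression.\<close>
  have R': "riem \<Gamma>' x u v w = 0" if x: "x \<in> cimg c U" for x u v w
  proof -
    have xB: "x \<in> ball (snd c p) r" "x \<in> ?S" using x cU cM by blast+
    have "riem \<Gamma>' x u v w = riem (Gam c) x u v w + proj_tensor (Gam c) \<rho> x u w *\<^sub>R v - proj_tensor (Gam c) \<rho> x v w *\<^sub>R u"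
      by (rule riem_projective[where S="cimg c U" and \<Gamma>="Gam c" and \<Gamma>'=\<Gamma>' and \<rho>=\<rho>, OF W x \<Gamma> \<Gamma>s[OF x] \<rho>U clU[OF x]]) (simp add: \<Gamma>'_def)
    then show ?thesis by (simp add: R[OF xB(2)] P[OF xB(1)] algebra_simps)
  qed
  \<comment> \<open>The trace of w \<mapsto> k (g(v, w)u - g(u, w)v) is k (g(v, u) - g(u, v)) = 0;
    this supplies the parallel volume form of the original connection.\<close>
  have tr: "trace (matrix (riem (Gam c) x u v)) = 0" if x: "x \<in> cimg c U" for x u v
  proof -
    have xS: "x \<in> ?S" using x cM by blast
    have lin: "linear (met c x v)" for v by (rule smooth_bilinear_onD(3)[OF met_smooth[OF c(1)] xS])
    have "riem (Gam c) x u v = (\<lambda>w. k *\<^sub>R (met c x v w *\<^sub>R u - met c x u w *\<^sub>R v))" by (simp add: fun_eq_iff R[OF xS])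
    then show ?thesis
      by (simp only: trace_matrix_linear trace_matrix_rank_one[OF lin] met_sym[OF c(1) xS, of v u]) simp
  qed
  have tr': "trace (matrix (riem \<Gamma>' x u v)) = 0" if "x \<in> cimg c U" for x u v
    using R'[OF that] by (simp add: trace_matrix)
  have "restricts_to A M U D (conn_of c (Gam c))"
    unfolding restricts_to_def
  proof (intro conjI ballI affine_connection_conn_of[OF c(1) U(1,2) \<Gamma>])
    fix X Y q assume X: "X \<in> vector_fields A M" and Y: "Y \<in> vector_fields A M" and q: "q \<in> U"
    then have qc: "q \<in> fst c" using U by blast
    show "conn_of c (Gam c) X Y q = D X Y q"
      by (rule coords_inject[OF c(1) qc])
        (simp add: coords_conn_of[OF c(1) qc] christoffelD(2)[OF Gam(1)[OF c(1)] X Y qc in_M[OF c(1) qc]])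
  qed
  moreover have "projectively_equivalent A U (conn_of c (Gam c)) (conn_of c \<Gamma>')"
    unfolding projectively_equivalent_def
  proof (intro conjI exI ballI)
    show "locally_equiaffine A U (conn_of c (Gam c))" by (rule locally_equiaffine_conn_of[OF c(1) U(1,2) \<Gamma> \<Gamma>s tr])
    show "locally_equiaffine A U (conn_of c \<Gamma>')" by (rule locally_equiaffine_conn_of[OF c(1) U(1,2) \<Gamma>' \<Gamma>'s tr'])
    show "closed_one_form A U (\<lambda>p v. \<rho> (snd c p) (coords_in A c p v))"
      by (rule closed_one_form_coords[OF c(1) U(1,2) \<rho>U clU])
    fix X Y q assume "q \<in> U"
    then have qc: "q \<in> fst c" using U by blast
    note lin = coords_in_linear[OF c(1) qc]
    show "conn_of c \<Gamma>' X Y q = conn_of c (Gam c) X Y q + \<rho> (snd c q) (coords_in A c q (X q)) *\<^sub>R Y q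
        + \<rho> (snd c q) (coords_in A c q (Y q)) *\<^sub>R X q"
      by (rule coords_inject[OF c(1) qc])
        (simp add: coords_conn_of[OF c(1) qc] linear_add[OF lin] linear_cmul[OF lin] \<Gamma>'_def)
  qed
  moreover have "flat A U (conn_of c \<Gamma>')" by (rule flat_conn_of[OF c(1) U(1,2) \<Gamma>' R'])
  ultimately show "\<exists>U D\<^sub>U D'. open U \<and> p \<in> U \<and> U \<subseteq> M \<and> restricts_to A M U D D\<^sub>U \<and>
        projectively_equivalent A U D\<^sub>U D' \<and> flat A U D'"
    using U UM by blast
qed

section \<open>From Ricci symmetry to constant curvature\<close>

text \<open>Expresses the given 1-form \<sigma> in the chart c as \<rho>. For the flat connection
  the projective change formula has left side 0, which determines the curvature of D by P
  alone.\<close>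

lemma projectively_flat_coords:
  assumes U: "open U" "U \<subseteq> M" and res: "restricts_to A M U D DU" and eq: "projectively_equivalent A U DU D'"
    and flat: "flat A U D'" and c: "c \<in> A"
  obtains \<rho> where "smooth_linear_on (cimg c U) \<rho>"
    "\<And>x u v. x \<in> cimg c U \<Longrightarrow> ddir (\<lambda>y. \<rho> y v) x u = ddir (\<lambda>y. \<rho> y u) x v"
    "\<And>x u v w. x \<in> cimg c U \<Longrightarrow> riem (Gam c) x u v w = proj_tensor (Gam c) \<rho> x v w *\<^sub>R u - proj_tensor (Gam c) \<rho> x u w *\<^sub>R v"
proof -
  obtain \<sigma> where \<sigma>: "closed_one_form A U \<sigma>" and eq': "\<And>X Y p. X \<in> vector_fields A U \<Longrightarrow> Y \<in> vector_fields A U \<Longrightarrow> p \<in> U \<Longrightarrow>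
           D' X Y p = DU X Y p + \<sigma> p (X p) *\<^sub>R Y p + \<sigma> p (Y p) *\<^sub>R X p"
    using eq unfolding projectively_equivalent_def by blast
  have D': "affine_connection A U D'" using eq unfolding projectively_equivalent_def locally_equiaffine_def by blast
  have \<sigma>l: "linear (\<sigma> p)" if "p \<in> U" for p using \<sigma> that unfolding closed_one_form_def one_form_def by blast
  have \<sigma>s: "smooth_fun A U (\<lambda>p. \<sigma> p (X p))" if "X \<in> vector_fields A U" for X
    using \<sigma> that unfolding closed_one_form_def one_form_def by blast
  define \<rho> where "\<rho> x u = \<sigma> (chart_inv c x) (vec_of c (chart_inv c x) u)" for x u
  have \<rho>c: "\<rho> (snd c q) (coords_in A c q v) = \<sigma> q v" if "q \<in> fst c" for q v using that c by (simp add: \<rho>_def)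
  note W = open_cimg[OF c U(1)]
  have cM: "cimg c U \<subseteq> cimg c M" using U(2) by blast
  have \<rho>: "smooth_linear_on (cimg c U) \<rho>"
    unfolding smooth_linear_on_def
  proof (intro conjI ballI allI)
    fix x assume "x \<in> cimg c U"
    then obtain p where p: "p \<in> fst c" "p \<in> U" "x = snd c p" by auto
    then show "linear (\<rho> x)"
      using linear_compose[OF vec_of_linear[OF c p(1)] \<sigma>l[OF p(2)]] c by (simp add: \<rho>_def[abs_def] o_def)
  next
    fix u
    show "smooth_on (cimg c U) (\<lambda>x. \<rho> x u)"
    proof (rule smooth_on_local)
      fix x assume "x \<in> cimg c U"
      then obtain p where p: "p \<in> fst c" "p \<in> U" "x = snd c p" by auto
      obtain X V where X: "X \<in> vector_fields A M" "open V" "p \<in> V" "V \<subseteq> fst c \<inter> U" "\<And>q. q \<in> V \<Longrightarrow> coords_in A c q (X q) = u"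
        using constant_field[OF U c p(1,2), of u] by metis
      have o: "open (cimg c V)" using open_cimg[OF c X(2)] .
      have sub: "cimg c V \<subseteq> cimg c U" using X(4) by blast
      have "smooth_on (cimg c V) (\<lambda>x. \<rho> x u)"
      proof (rule smooth_on_cong[OF o _ smooth_on_subset[OF smooth_funD[OF \<sigma>s[OF vector_fields_subset[OF X(1) U(2)]] c] sub]])
        fix y assume "y \<in> cimg c V"
        then obtain q where q: "q \<in> fst c" "q \<in> V" "y = snd c q" by auto
        show "((\<lambda>p. \<sigma> p (X p)) \<circ> chart_inv c) y = \<rho> y u"
          using \<rho>c[OF q(1), of "X q"] X(5)[OF q(2)] c q by simp
      qed
      then show "\<exists>T. open T \<and> x \<in> T \<and> smooth_on T (\<lambda>x. \<rho> x u)"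
        using o p X(3) by (intro exI[of _ "cimg c V"]) auto
    qed
  qed
  have cl: "ddir (\<lambda>y. \<rho> y v) x u = ddir (\<lambda>y. \<rho> y u) x v" if x: "x \<in> cimg c U" for x u v
  proof -
    obtain p where p: "p \<in> fst c" "p \<in> U" "x = snd c p" using x by auto
    obtain X where X: "X \<in> vector_fields A U" "coords_in A c p (X p) = u" "\<And>v. ddir (local_rep A c X) (snd c p) v = 0"
      using coords_fieldE[OF U c p(1,2), of u] by metis
    obtain Y where Y: "Y \<in> vector_fields A U" "coords_in A c p (Y p) = v" "\<And>v. ddir (local_rep A c Y) (snd c p) v = 0"
      using coords_fieldE[OF U c p(1,2), of v] by metis
    have d: "dir_deriv A X (\<lambda>q. \<sigma> q (Y q)) p = ddir (\<lambda>y. \<rho> y (coords_in A c p (Y p))) x (coords_in A c p (X p))"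
      if Y: "Y \<in> vector_fields A U" "\<And>v. ddir (local_rep A c Y) (snd c p) v = 0" for X Y
    proof -
      have "((\<lambda>x. \<rho> x (local_rep A c Y x)) has_derivative
         (\<lambda>h. ddir (\<lambda>y. \<rho> y (local_rep A c Y x)) x h + \<rho> x (ddir (local_rep A c Y) x h))) (at x)"
        by (rule smooth_linear_on_has_derivative[OF W \<rho> x smooth_on_has_derivative[OF vector_fieldD[OF Y(1) c] x]])
      then have "(((\<lambda>q. \<sigma> q (Y q)) \<circ> chart_inv c) has_derivative
         (\<lambda>h. ddir (\<lambda>y. \<rho> y (local_rep A c Y x)) x h + \<rho> x (ddir (local_rep A c Y) x h))) (at x)"
        by (rule has_derivative_transform_within_open[OF _ W x])
          (use c in \<open>auto simp: local_rep_apply \<rho>c\<close>)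
      from ddir_eqI[OF this] dir_deriv_smooth[OF \<sigma>s[OF Y(1)] c p(1,2), of X] show ?thesis
        using c p Y(2) linear_0[OF smooth_linear_onD(1)[OF \<rho> x]] by (simp add: local_rep_apply)
    qed
    have "coords_in A c p (lie_bracket A X Y p) = coords_in A c p 0"
      using coords_lie_bracket[OF U(1) p(2) c p(1) X(1) Y(1)] X(3) Y(3) linear_0[OF coords_in_linear[OF c p(1)]] by simp
    then have "lie_bracket A X Y p = 0" by (rule coords_inject[OF c p(1)])
    moreover have "dir_deriv A X (\<lambda>q. \<sigma> q (Y q)) p - dir_deriv A Y (\<lambda>q. \<sigma> q (X q)) p - \<sigma> p (lie_bracket A X Y p) = 0"
      using \<sigma> X(1) Y(1) p unfolding closed_one_form_def by blast
    ultimately show ?thesis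
      using d[OF Y(1,3), of X] d[OF X(1,3), of Y] linear_0[OF \<sigma>l[OF p(2)]] by (simp add: X Y)
  qed
  obtain \<Gamma>' where \<Gamma>': "christoffel A U c D' \<Gamma>'" by (rule christoffel_exists[OF U D' c])
  have \<Gamma>'eq: "\<Gamma>' x u v = Gam c x u v + \<rho> x u *\<^sub>R v + \<rho> x v *\<^sub>R u" if x: "x \<in> cimg c U" for x u v
  proof -
    obtain p where p: "p \<in> fst c" "p \<in> U" "x = snd c p" using x by auto
    obtain X where X: "X \<in> vector_fields A M" "X \<in> vector_fields A U" "coords_in A c p (X p) = u" "\<And>v. ddir (local_rep A c X) (snd c p) v = 0"
      using coords_fieldE[OF U c p(1,2), of u] by metis
    obtain Y where Y: "Y \<in> vector_fields A M" "Y \<in> vector_fields A U" "coords_in A c p (Y p) = v" "\<And>v. ddir (local_rep A c Y) (snd c p) v = 0"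
      using coords_fieldE[OF U c p(1,2), of v] by metis
    \<comment> \<open>The restricted connection is tied to D only on fields that come from M, which
      is why the test fields are taken global.\<close>
    have "DU X Y p = D X Y p" using res X(1) Y(1) p unfolding restricts_to_def by blast
    then have "D' X Y p = D X Y p + \<sigma> p (X p) *\<^sub>R Y p + \<sigma> p (Y p) *\<^sub>R X p" using eq'[OF X(2) Y(2) p(2)] by simp
    then have "coords_in A c p (D' X Y p) = coords_in A c p (D X Y p) + \<sigma> p (X p) *\<^sub>R v + \<sigma> p (Y p) *\<^sub>R u"
      using coords_in_linear[OF c p(1)] by (simp add: linear_add linear_cmul X Y)
    then show ?thesis
      using christoffelD(2)[OF \<Gamma>' X(2) Y(2) p(1,2)] christoffelD(2)[OF Gam(1)[OF c] X(1) Y(1) p(1) in_M[OF c p(1)]]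
      by (simp add: X Y p(3) \<rho>c[OF p(1), symmetric])
  qed
  show ?thesis
  proof (rule that[OF \<rho> cl])
    fix x u v w assume x: "x \<in> cimg c U"
    obtain p where p: "p \<in> fst c" "p \<in> U" "x = snd c p" using x by auto
    obtain X where X: "X \<in> vector_fields A U" "coords_in A c p (X p) = u" using coords_fieldE[OF U c p(1,2), of u] by metis
    obtain Y where Y: "Y \<in> vector_fields A U" "coords_in A c p (Y p) = v" using coords_fieldE[OF U c p(1,2), of v] by metis
    obtain Z where Z: "Z \<in> vector_fields A U" "coords_in A c p (Z p) = w" using coords_fieldE[OF U c p(1,2), of w] by metis
    have "curvature A D' X Y Z p = 0" using flat X(1) Y(1) Z(1) p(2) unfolding flat_def by blast
    then have "riem \<Gamma>' x u v w = 0"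
      using coords_curvature[OF U D' c \<Gamma>' p(1,2) X(1) Y(1) Z(1)] linear_0[OF coords_in_linear[OF c p(1)]]
      by (simp add: X Y Z p(3))
    moreover have "riem \<Gamma>' x u v w = riem (Gam c) x u v w + proj_tensor (Gam c) \<rho> x u w *\<^sub>R v - proj_tensor (Gam c) \<rho> x v w *\<^sub>R u"
      by (rule riem_projective[where S="cimg c U" and \<Gamma>="Gam c" and \<Gamma>'=\<Gamma>' and \<rho>=\<rho>, OF W x smooth_bilinear_on_subset[OF Gam_smooth(1)[OF c] cM] Gam_sym[OF c subsetD[OF cM x]] \<rho> cl[OF x] \<Gamma>'eq])
    ultimately show "riem (Gam c) x u v w = proj_tensor (Gam c) \<rho> x v w *\<^sub>R u - proj_tensor (Gam c) \<rho> x u w *\<^sub>R v"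
      by (simp add: algebra_simps eq_neg_iff_add_eq_0)
  qed
qed

text \<open>In the chart chosen at p components coincide with the stored vectors, so the trace needs
  no change of basis.\<close>

lemma ricci_coords:
  assumes p: "p \<in> M"
  shows "trace (matrix (\<lambda>v. riem (Gam (chart_at A p)) (snd (chart_at A p) p) v y z)) =
      ricci A M D (field_through A M p y) (field_through A M p z) p"
    and "trace (matrix (\<lambda>v. riem (Gams (chart_at A p)) (snd (chart_at A p) p) v y z)) =
      ricci A M Ds (field_through A M p y) (field_through A M p z) p"
proof -
  note c = chart_at_in[OF p] in_chart_at[OF p] and F = field_through[OF open_M subset_refl p]
  note J = coords_in_chart_at[OF p]
  have "curvature A D (field_through A M p v) (field_through A M p y) (field_through A M p z) p
      = riem (Gam (chart_at A p)) (snd (chart_at A p) p) v y z" for v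
    using coords_curvature[OF open_M subset_refl connections(1) c(1) Gam(1)[OF c(1)] c(2) p F(1) F(1) F(1), of v y z]
    unfolding J F(2) .
  then show "trace (matrix (\<lambda>v. riem (Gam (chart_at A p)) (snd (chart_at A p) p) v y z)) =
      ricci A M D (field_through A M p y) (field_through A M p z) p" by (simp add: ricci_def)
  have "curvature A Ds (field_through A M p v) (field_through A M p y) (field_through A M p z) p
      = riem (Gams (chart_at A p)) (snd (chart_at A p) p) v y z" for v
    using coords_curvature[OF open_M subset_refl connections(3) c(1) Gam(2)[OF c(1)] c(2) p F(1) F(1) F(1), of v y z]
    unfolding J F(2) .
  then show "trace (matrix (\<lambda>v. riem (Gams (chart_at A p)) (snd (chart_at A p) p) v y z)) =
      ricci A M Ds (field_through A M p y) (field_through A M p z) p" by (simp add: ricci_def)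
qed

lemma pointwise_constant_curvature:
  assumes pf: "projectively_flat A M D" and crs: "conjugate_ricci_symmetric A M D Ds" and p: "p \<in> M"
  shows "\<exists>k. curvature_at k p"
proof -
  obtain U DU D' where U: "open U" "p \<in> U" "U \<subseteq> M" and res: "restricts_to A M U D DU"
    and eq: "projectively_equivalent A U DU D'" and fl: "flat A U D'"
    using pf p unfolding projectively_flat_def by blast
  define c where "c = chart_at A p"
  have c: "c \<in> A" "p \<in> fst c" using chart_at_in[OF p] in_chart_at[OF p] by (auto simp: c_def)
  obtain \<rho> where \<rho>: "smooth_linear_on (cimg c U) \<rho>"
    "\<And>x u v. x \<in> cimg c U \<Longrightarrow> ddir (\<lambda>y. \<rho> y v) x u = ddir (\<lambda>y. \<rho> y u) x v"
    and R: "\<And>x u v w. x \<in> cimg c U \<Longrightarrow> riem (Gam c) x u v w = proj_tensor (Gam c) \<rho> x v w *\<^sub>R u - proj_tensor (Gam c) \<rho> x u w *\<^sub>R v"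
    using projectively_flat_coords[OF U(1,3) res eq fl c(1)] by blast
  let ?x = "snd c p"
  have x: "?x \<in> cimg c U" "?x \<in> cimg c M" using c U in_cimg[OF c] by auto
  note pt = proj_tensor_bilinear[where S="cimg c U" and \<Gamma>="Gam c" and \<rho>=\<rho>, OF x(1) smooth_bilinear_on_subset[OF Gam_smooth(1)[OF c(1)] cimg_mono[OF U(3)]]
      Gam_sym[OF c(1) x(2)] \<rho>(1) \<rho>(2)[OF x(1)]]
  have ric: "trace (matrix (\<lambda>v. riem (Gam c) ?x v y z)) = trace (matrix (\<lambda>v. riem (Gams c) ?x v y z))" for y z
    using crs field_through(1)[OF open_M subset_refl p] p
    unfolding c_def ricci_coords[OF p] conjugate_ricci_symmetric_def by blast
  have "\<exists>l. \<forall>u v. proj_tensor (Gam c) \<rho> ?x u v = l * met c ?x u v"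
    by (rule ricci_symmetric_proportional[where g="met c ?x" and P="proj_tensor (Gam c) \<rho> ?x" and R="riem (Gam c) ?x" and R'="riem (Gams c) ?x", OF smooth_bilinear_onD(1)[OF met_smooth[OF c(1)] x(2)] met_sym[OF c(1) x(2)]
          met_nondeg[OF c(1) x(2)] pt R[OF x(1)] riem_duality[OF c(1) x(2)] ric])
  then obtain l where l: "\<And>u v. proj_tensor (Gam c) \<rho> ?x u v = l * met c ?x u v" by blast
  have "curvature_at l p"
    unfolding curvature_at_iff[OF c] using R[OF x(1)] l by (simp add: scaleR_diff_right)
  then show ?thesis by blast
qed

text \<open>If two values k were possible, then g(v, w)u = g(u, w)v for all u, v, w. In dimension at
  least 2 this makes g vanish, against nondegeneracy.\<close>

lemma curvature_at_unique:
  assumes p: "p \<in> M" and dim: "CARD('n) \<ge> 2" and k: "curvature_at k p" "curvature_at k' p"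
  shows "k = k'"
proof (rule ccontr)
  assume ne: "k \<noteq> k'"
  note c = chart_at_in[OF p] in_chart_at[OF p]
  let ?G = "met (chart_at A p) (snd (chart_at A p) p)"
  have "?G v w *\<^sub>R u = ?G u w *\<^sub>R v" for u v w
  proof -
    have "k *\<^sub>R (?G v w *\<^sub>R u - ?G u w *\<^sub>R v) = k' *\<^sub>R (?G v w *\<^sub>R u - ?G u w *\<^sub>R v)"
      using k unfolding curvature_at_iff[OF c] by metis
    then show ?thesis using ne by simp
  qed
  then have "?G v w = 0" for v w
    by (intro proportional_zero[where d="\<lambda>v. ?G v w"]) (use dim in simp_all)
  then have "v = 0" for v using met_nondeg[OF c(1) in_cimg[OF c]] by blast
  then have "axis undefined 1 = (0 :: real ^ 'n)" .
  then show False by (simp add: axis_eq_0_iff)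
qed

lemma curvature_locally_constant:
  assumes pf: "projectively_flat A M D" and crs: "conjugate_ricci_symmetric A M D Ds" and dim: "CARD('n) \<ge> 2" and p: "p \<in> M"
  shows "\<exists>V k. open V \<and> p \<in> V \<and> (\<forall>q\<in>V. curvature_at k q)"
proof -
  obtain U DU D' where U: "open U" "p \<in> U" "U \<subseteq> M" and res: "restricts_to A M U D DU"
    and eq: "projectively_equivalent A U DU D'" and fl: "flat A U D'"
    using pf p unfolding projectively_flat_def by blast
  define c where "c = chart_at A p"
  have c: "c \<in> A" "p \<in> fst c" using chart_at_in[OF p] in_chart_at[OF p] by (auto simp: c_def)
  obtain \<rho> where \<rho>: "smooth_linear_on (cimg c U) \<rho>"
    "\<And>x u v. x \<in> cimg c U \<Longrightarrow> ddir (\<lambda>y. \<rho> y v) x u = ddir (\<lambda>y. \<rho> y u) x v"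
    and R: "\<And>x u v w. x \<in> cimg c U \<Longrightarrow> riem (Gam c) x u v w = proj_tensor (Gam c) \<rho> x v w *\<^sub>R u - proj_tensor (Gam c) \<rho> x u w *\<^sub>R v"
    using projectively_flat_coords[OF U(1,3) res eq fl c(1)] by blast
  let ?S = "cimg c U"
  note W = open_cimg[OF c(1) U(1)]
  have cM: "?S \<subseteq> cimg c M" using U(3) by blast
  note \<Gamma> = smooth_bilinear_on_subset[OF Gam_smooth(1)[OF c(1)] cM] and G = smooth_bilinear_on_subset[OF met_smooth[OF c(1)] cM]
  \<comment> \<open>A choice at each point separately; differentiability of \<open>l\<close> is
    established only afterwards.\<close>
  define l where "l x = (SOME k. curvature_at k (chart_inv c x))" for x
  have l: "curvature_at (l (snd c q)) q" if "q \<in> fst c" for q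
    using someI_ex[OF pointwise_constant_curvature[OF pf crs in_M[OF c(1) that]]] that c by (simp add: l_def)
  have Rl: "riem (Gam c) x u v w = l x *\<^sub>R (met c x v w *\<^sub>R u - met c x u w *\<^sub>R v)" if x: "x \<in> ?S" for x u v w
  proof -
    obtain q where q: "q \<in> fst c" "x = snd c q" using x by auto
    show ?thesis using l[OF q(1)] unfolding curvature_at_iff[OF c(1) q(1)] q(2) by blast
  qed
  \<comment> \<open>The pointwise lemma hides its own 1-form, so P = l g is recovered for the
    present \<rho> by comparing the two expressions of the curvature.\<close>
  have P: "proj_tensor (Gam c) \<rho> x u w = l x * met c x u w" if x: "x \<in> ?S" for x u w
  proof -
    let ?d = "\<lambda>v. proj_tensor (Gam c) \<rho> x v w - l x * met c x v w"
    have "?d u = 0"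
    proof (rule proportional_zero[where d="?d" and v=u])
      show "DIM(real ^ 'n) \<ge> 2" using dim by simp
      show "?d v *\<^sub>R u = ?d u *\<^sub>R v" for u v
        using R[OF x, of u v w] Rl[OF x, of u v w] by (simp add: algebra_simps)
    qed
    then show ?thesis by simp
  qed
  have ldiff: "l differentiable (at x)" if x: "x \<in> ?S" for x
  proof -
    have xM: "x \<in> cimg c M" using x cM by blast
    \<comment> \<open>A nonzero vector and nondegeneracy give a component of the metric that is
      nonzero at x and hence nearby; dividing by it writes \<open>l\<close> as a quotient of smooth
      functions.\<close>
    have "axis undefined 1 \<noteq> (0 :: real ^ 'n)" by (simp add: axis_eq_0_iff)
    then obtain u w where uw: "met c x u w \<noteq> 0" using met_nondeg[OF c(1) xM] by blast
    define T where "T = ?S \<inter> (\<lambda>y. met c y u w) -` (- {0})"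
    have sG: "smooth_on ?S (\<lambda>y. met c y u w)" using smooth_bilinear_onD(2)[OF G] .
    have T: "open T" unfolding T_def
      by (rule continuous_open_preimage[OF smooth_on_continuous[OF sG] W]) auto
    have xT: "x \<in> T" using x uw by (simp add: T_def)
    have sub: "T \<subseteq> ?S" by (auto simp: T_def)
    have "smooth_on T (\<lambda>y. proj_tensor (Gam c) \<rho> y u w * inverse (met c y u w))"
      by (intro smooth_on_mult smooth_on_inverse T smooth_on_subset[OF smooth_proj_tensor[OF W \<Gamma> \<rho>(1)] sub]
          smooth_on_subset[OF sG sub]) (simp add: T_def)
    then have "(\<lambda>y. proj_tensor (Gam c) \<rho> y u w * inverse (met c y u w)) differentiable (at x)"
      using xT by (rule smooth_on_differentiable)
    then show ?thesis
      by (rule differentiable_cong[OF T xT, rotated]) (simp add: T_def P)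
  qed
  have zero: "ddir l x v = 0" if x: "x \<in> ?S" for x v
  proof (rule schur[where S="cimg c U" and \<Gamma>="Gam c" and G="met c" and \<rho>=\<rho> and l=l, OF W x \<Gamma> _ G _ _ _ \<rho>(1) _ P Rl[OF x] ldiff[OF x]])
    have xM: "x \<in> cimg c M" using x cM by blast
    show "Gam c x u v = Gam c x v u" for u v by (rule Gam_sym[OF c(1) xM])
    show "v = 0" if "\<forall>w. met c x v w = 0" for v by (rule met_nondeg[OF c(1) xM that])
    show "met c x u v = met c x v u" for u v by (rule met_sym[OF c(1) xM])
    show "ddir (\<lambda>y. met c y u w) x v - met c x u (Gam c x v w) = ddir (\<lambda>y. met c y v w) x u - met c x v (Gam c x u w)" for u v w
      by (rule met_codazzi[OF c(1) xM])
    show "ddir (\<lambda>y. \<rho> y v) x u = ddir (\<lambda>y. \<rho> y u) x v" for u v by (rule \<rho>(2)[OF x])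
    show "DIM(real ^ 'n) \<ge> 2" using dim by simp
  qed
  have "snd c p \<in> ?S" using c U by auto
  then obtain r where r: "r > 0" "ball (snd c p) r \<subseteq> ?S" using W openE by blast
  have "\<exists>k. \<forall>x\<in>ball (snd c p) r. l x = k"
  proof (rule has_derivative_zero_constant[OF convex_ball])
    fix x assume "x \<in> ball (snd c p) r"
    then have x: "x \<in> ?S" using r by blast
    have "(l has_derivative ddir l x) (at x)" using ldiff[OF x] frechet_derivative_works by blast
    moreover have "ddir l x = (\<lambda>h. 0)" using zero[OF x] by auto
    ultimately show "(l has_derivative (\<lambda>h. 0)) (at x within ball (snd c p) r)" by (simp add: has_derivative_at_withinI)
  qed
  then obtain k where k: "\<And>x. x \<in> ball (snd c p) r \<Longrightarrow> l x = k" by blast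
  define V where "V = fst c \<inter> snd c -` ball (snd c p) r"
  have "open V" unfolding V_def by (rule open_chart_vimage[OF c(1) open_ball])
  moreover have "p \<in> V" using c r by (simp add: V_def)
  moreover have "curvature_at k q" if "q \<in> V" for q using l[of q] k[of "snd c q"] that by (simp add: V_def)
  ultimately show ?thesis by blast
qed

text \<open>All vectors are multiples of one, so g(v, w)u - g(u, w)v vanishes and the value of k is
  arbitrary; 0 is a choice common to all points.\<close>

lemma dimension_one_trivial:
  assumes dim: "CARD('n) < 2" and p: "p \<in> M" and k: "curvature_at k p"
  shows "curvature_at 0 p"
proof -
  note c = chart_at_in[OF p] in_chart_at[OF p]
  let ?x = "snd (chart_at A p) p"
  let ?G = "met (chart_at A p) ?x"
  have one: "CARD('n) = 1" using dim by (metis One_nat_def less_2_cases_iff less_numeral_extra(3) zero_less_card_finite)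
  obtain i :: 'n where i: "(UNIV :: 'n set) = {i}" using one card_1_singletonE by blast
  have e: "u = u $ i *\<^sub>R axis i 1" for u :: "real ^ 'n"
    using i by (auto simp: vec_eq_iff axis_def)
  have b: "bilinear ?G" by (rule smooth_bilinear_onD(1)[OF met_smooth[OF c(1)] in_cimg[OF c]])
  have "?G v w *\<^sub>R u = ?G u w *\<^sub>R v" for u v w
  proof -
    have "?G v w = v $ i * ?G (axis i 1) w" for v by (subst e[of v]) (simp add: bilinear_lmul[OF b])
    then have "?G v w *\<^sub>R u = (v $ i * ?G (axis i 1) w * u $ i) *\<^sub>R axis i 1"
      and "?G u w *\<^sub>R v = (u $ i * ?G (axis i 1) w * v $ i) *\<^sub>R axis i 1"
      using e[of u] e[of v] by (metis scaleR_scaleR)+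
    then show ?thesis by (simp add: mult_ac)
  qed
  then show ?thesis using k unfolding curvature_at_iff[OF c] by simp
qed

text \<open>In dimension at least 2 uniqueness identifies the pointwise choice with the local
  constant near each point, and connectedness makes these constants agree. In dimension 1 the common
  value is 0.\<close>

lemma constant_curvature_of_ricci_symmetric:
  assumes con: "connected M" and pf: "projectively_flat A M D" and crs: "conjugate_ricci_symmetric A M D Ds"
  shows "constant_curvature A M g D"
proof (cases "CARD('n) \<ge> 2")
  case False
  then have "\<forall>p\<in>M. curvature_at 0 p"
    using dimension_one_trivial pointwise_constant_curvature[OF pf crs] by (metis not_le)
  then show ?thesis unfolding constant_curvature_iff by blast
next
  case True
  define l where "l p = (SOME k. curvature_at k p)" for p
  have l: "curvature_at (l p) p" if "p \<in> M" for p
    unfolding l_def by (rule someI_ex[OF pointwise_constant_curvature[OF pf crs that]])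
  have "l constant_on M"
  proof (rule locally_constant_imp_constant[OF con])
    fix p assume p: "p \<in> M"
    obtain V k where V: "open V" "p \<in> V" "\<And>q. q \<in> V \<Longrightarrow> curvature_at k q"
      using curvature_locally_constant[OF pf crs True p] by blast
    have "l q = k" if "q \<in> V" "q \<in> M" for q
      by (rule curvature_at_unique[OF that(2) True l[OF that(2)] V(3)[OF that(1)]])
    then show "\<exists>T. openin (top_of_set M) T \<and> p \<in> T \<and> (\<forall>x\<in>T. l x = l p)"
      using V p by (intro exI[of _ "M \<inter> V"]) (auto simp: openin_open_Int)
  qed
  then obtain k where "\<And>p. p \<in> M \<Longrightarrow> l p = k" unfolding constant_on_def by blast
  then show ?thesis unfolding constant_curvature_iff using l by metis
qed

end

theorem theorem2p6:
  fixes M :: "'a::{t2_space, second_countable_topology} set"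
    and A :: "('a, 'n::finite) chart set"
    and g :: "'a \<Rightarrow> real ^ 'n \<Rightarrow> real ^ 'n \<Rightarrow> real"
    and D Ds :: "('a \<Rightarrow> real ^ 'n) \<Rightarrow> ('a \<Rightarrow> real ^ 'n) \<Rightarrow> 'a \<Rightarrow> real ^ 'n"
  assumes "statistical_manifold M A g D"
    and "connected M"
    and "orientable M A"
    and "dual_connection A M g D Ds"
  shows "(constant_curvature A M g D \<longleftrightarrow>
            projectively_flat A M D \<and> conjugate_symmetric A M D Ds)
       \<and> (projectively_flat A M D \<and> conjugate_symmetric A M D Ds \<longleftrightarrow>
            projectively_flat A M D \<and> conjugate_ricci_symmetric A M D Ds)"
proof -
  interpret statistical M A g D Ds
    using assms(1,4) by unfold_locales (auto simp: statistical_manifold_def)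
  have 12: "projectively_flat A M D \<and> conjugate_symmetric A M D Ds" if "constant_curvature A M g D"
    using that constant_curvature_imp_projectively_flat constant_curvature_imp_conjugate_symmetric
    unfolding constant_curvature_iff by blast
  \<comment> \<open>Both traces use the same \<open>field_through\<close>, so equal curvatures give
    the same endomorphism.\<close>
  have 23: "conjugate_ricci_symmetric A M D Ds" if "conjugate_symmetric A M D Ds"
    unfolding conjugate_ricci_symmetric_def ricci_def
    using that field_through(1)[OF open_M subset_refl] by (simp add: conjugate_symmetric_def)
  show ?thesis
    using 12 23 constant_curvature_of_ricci_symmetric[OF assms(2)] by blast
qed

end
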